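(* Let $G$ be a non-trivial nilpotent group and let $A$ be a non-trivial abelian group with trivial $G$-module structure. Define $$\Delta=\{\gamma\in H^2(G,A)\mid \overline{\kappa}(\gamma)\text{ is surjective}\}.$$ (a) $\Delta$ is invariant under the action of $\mathrm{Comp}(G,A)$ on $H^2(G,A)$. Let $\Omega$ denote a set of orbit representatives of the action of $\mathrm{Comp}(G,A)$ on $\Delta$. (b) The extensions of $A$ by $G$ defined by the elements of $\Omega$ form a complete and irredundant set of isomorphism type representatives of the lower central series extensions of $A$ by $G$; that is, each of them is a lower central series extension of $A$ by $G$, every lower central series extension of $A$ by $G$ is isomorphic (as a group) to one of them, and extensions defined by distinct elements of $\Omega$ are not isomorphic as groups. (c) For $\delta\in Z^2(G,A)$ with $[\delta]\in\Delta$ denote the corresponding extension by $E$. Then $\mathrm{Aut}(E)=\mathrm{Aut}_A(E)$, and there exists a short exact sequence of groups $$1\to Z^1(G,A)\to \mathrm{Aut}(E)\to \mathrm{Stab}_{\mathrm{Comp}(G,A)}([\delta])\to 1.$$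
   Context: $G$ is written multiplicatively and $A$ additively; automorphisms are written as exponents (acting on the right). $Z^2(G,A)$ is the group of normalized 2-cocycles $\delta : G\times G\to A$ (trivial action): $\delta(g,h)+\delta(gh,k)=\delta(h,k)+\delta(g,hk)$ and $\delta(g,1)=\delta(1,g)=0$ for all $g,h,k\in G$. $B^2(G,A)$ is the subgroup of coboundaries $(g,h)\mapsto\epsilon(g)+\epsilon(h)-\epsilon(gh)$ with $\epsilon:G\to A$, $\epsilon(1)=0$; $H^2(G,A)=Z^2(G,A)/B^2(G,A)$ and $[\delta]=\delta+B^2(G,A)$. $Z^1(G,A)$ is the group of 1-cocycles (here $\mathrm{Hom}(G,A)$, as the action is trivial). An extension of $A$ by $G$ is a group $E$ with a short exact sequence $A\hookrightarrow E\twoheadrightarrow G$ inducing the given (trivial) $G$-action on $A$. For $\delta\in Z^2(G,A)$, the corresponding extension is the set $G\times A$ with multiplication $(g,a)(g',a')=(gg',a+a'+\delta(g,g'))$, with $A$ embedded via $a\mapsto(1,a)$ and projection $(g,a)\mapsto g$; $A$ is identified with its image $\overline{A}=\{(1,a)\mid a\in A\}$. The extension defined by a class in $H^2(G,A)$ is the one given by any representing cocycle (well defined up to equivalence of extensions). $\mathrm{Aut}_A(E)=\{\alpha\in\mathrm{Aut}(E)\mid A^\alpha=A\}$. An extension $E$ of $A$ by $G$, with image $\overline{A}$ of $A$ in $E$, is a lower central series extension if $E$ is nilpotent and $\overline{A}$ equals the smallest non-trivial term of the lower central series of $E$. The group of compatible pairs is $\mathrm{Comp}(G,A)=\{(\eta,\nu)\in\mathrm{Aut}(G)\times\mathrm{Aut}(A)\mid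 (a^\nu)^{(g^\eta)}=(a^g)^\nu\text{ for all }g\in G,a\in A\}$, where $a^g$ is the module action; as the action is trivial, it equals $\mathrm{Aut}(G)\times\mathrm{Aut}(A)$. It acts on $Z^2(G,A)$ by $\delta^{(\eta,\nu)}(g,h)=\left(\delta(g^{\eta^{-1}},h^{\eta^{-1}})\right)^\nu$, and this induces an action on $H^2(G,A)$ by $[\delta]^{(\eta,\nu)}=[\delta^{(\eta,\nu)}]$; $\mathrm{Stab}_{\mathrm{Comp}(G,A)}([\delta])$ is the stabilizer of $[\delta]$. For a non-trivial nilpotent group $G$, $\lambda(G)$ denotes the smallest non-trivial term of the lower central series of $G$; it is contained in $Z(G)$. Write ${}^h g=hgh^{-1}$. For $H\le Z(G)$, the non-abelian exterior product $G\wedge H$ is the group generated by the symbols $g\wedge h$ ($g\in G$, $h\in H$) subject to the relations $gg'\wedge h=({}^g g'\wedge {}^g h)(g\wedge h)$, $g\wedge hh'=(g\wedge h)({}^h g\wedge {}^h h')$ and $h\wedge h=1$ for all $g,g'\in G$, $h,h'\in H$. The Schur multiplier $M(G,H)$ of the pair is the kernel of $G\wedge H\to[G,H]$, $g\wedge h\mapsto ghg^{-1}h^{-1}$; for $H\le Z(G)$ one has $M(G,H)=G\wedge H$. For $\delta\in Z^2(G,A)$ put $\hat\delta(g,h)=\delta(g,h)-\delta(h,g)-\delta((hg)^{-1},hg)+\delta((hg)^{-1},gh)$; for $h\in Z(G)$ this equals $\delta(g,h)-\delta(h,g)$. The map $\overline{\kappa}:H^2(G,A)\to\mathrm{Hom}(M(G,\lambda(G)),A)$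 sends $[\delta]$ to the homomorphism determined by $g\wedge h\mapsto\hat\delta(g,h)$, $g\in G$, $h\in\lambda(G)$ (it is well defined). *)

theory Defs
  imports "HOL-Algebra.Bij" "HOL-Algebra.Group_Action" "HOL-Algebra.Generated_Groups"
begin

text \<open>
  All groups, including the abelian coefficient group \<open>A\<close>, are multiplicative groups of HOL-Algebra.
  Cocycles, homomorphisms forming a group, and automorphisms are extensional functions, so that
  equality of functions is equality on the carrier. Automorphisms act on the left and are multiplied
  by composition, as in \<^const>\<open>AutoGroup\<close>. Passing to right actions replaces automorphism
  groups by their opposites, which changes neither orbits and stabilizers nor (as homomorphisms into
  an opposite group from an abelian one, or between two opposite groups, are the same maps) the
  short exact sequences considered.
\<close>

subsection \<open>Lower central series\<close>

definition commutator_subgroup ::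
    "('g, 'm) monoid_scheme \<Rightarrow> 'g set \<Rightarrow> 'g set \<Rightarrow> 'g set" where
  "commutator_subgroup G H K =
     generate G {h \<otimes>\<^bsub>G\<^esub> k \<otimes>\<^bsub>G\<^esub> inv\<^bsub>G\<^esub> h \<otimes>\<^bsub>G\<^esub> inv\<^bsub>G\<^esub> k | h k. h \<in> H \<and> k \<in> K}"

primrec lower_central :: "('g, 'm) monoid_scheme \<Rightarrow> nat \<Rightarrow> 'g set" where
  "lower_central G 0 = carrier G"
| "lower_central G (Suc n) = commutator_subgroup G (carrier G) (lower_central G n)"

definition nilpotent_group :: "('g, 'm) monoid_scheme \<Rightarrow> bool" where
  "nilpotent_group G \<longleftrightarrow> group G \<and> (\<exists>n. lower_central G n = {\<one>\<^bsub>G\<^esub>})"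

text \<open>Meaningful for non-trivial nilpotent groups; the least element is taken with respect to
  inclusion.\<close>

definition last_lower_central :: "('g, 'm) monoid_scheme \<Rightarrow> 'g set" where
  "last_lower_central G = (LEAST H. H \<in> range (lower_central G) \<and> H \<noteq> {\<one>\<^bsub>G\<^esub>})"

subsection \<open>Group extensions\<close>

text \<open>The library's \<open>short_exact_sequence\<close> forces all groups to have the same element type.\<close>

definition short_exact ::
    "('a, 'k) monoid_scheme \<Rightarrow> ('a \<Rightarrow> 'e) \<Rightarrow> ('e, 'l) monoid_scheme \<Rightarrow> ('e \<Rightarrow> 'g) \<Rightarrow>
     ('g, 'm) monoid_scheme \<Rightarrow> bool" where
  "short_exact A i E p G \<longleftrightarrow> group A \<and> group E \<and> group G \<and>
     i \<in> mon A E \<and> p \<in> epi E G \<and> i ` carrier A = kernel E G p"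

text \<open>The conjugation action of \<open>E\<close> on the image of \<open>A\<close> induces an action of \<open>G\<close> on \<open>A\<close>;
  the last conjunct says that this action is the trivial one.\<close>

definition extension_of ::
    "('a, 'k) monoid_scheme \<Rightarrow> ('g, 'm) monoid_scheme \<Rightarrow> ('e, 'l) monoid_scheme \<Rightarrow>
     ('a \<Rightarrow> 'e) \<Rightarrow> ('e \<Rightarrow> 'g) \<Rightarrow> bool" where
  "extension_of A G E i p \<longleftrightarrow> short_exact A i E p G \<and>
     (\<forall>a\<in>carrier A. \<forall>e\<in>carrier E. inv\<^bsub>E\<^esub> e \<otimes>\<^bsub>E\<^esub> i a \<otimes>\<^bsub>E\<^esub> e = i a)"

definition lcs_extension_of ::
    "('a, 'k) monoid_scheme \<Rightarrow> ('g, 'm) monoid_scheme \<Rightarrow> ('e, 'l) monoid_scheme \<Rightarrow>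
     ('a \<Rightarrow> 'e) \<Rightarrow> ('e \<Rightarrow> 'g) \<Rightarrow> bool" where
  "lcs_extension_of A G E i p \<longleftrightarrow> extension_of A G E i p \<and> nilpotent_group E \<and>
     i ` carrier A = last_lower_central E"

subsection \<open>Cohomology with trivial action\<close>

definition Z1_group ::
    "('g, 'm) monoid_scheme \<Rightarrow> ('a, 'k) monoid_scheme \<Rightarrow> ('g \<Rightarrow> 'a) monoid" where
  "Z1_group G A =
     \<lparr>carrier = hom G A \<inter> extensional (carrier G),
      mult = (\<lambda>f f'. \<lambda>g\<in>carrier G. f g \<otimes>\<^bsub>A\<^esub> f' g),
      one = (\<lambda>g\<in>carrier G. \<one>\<^bsub>A\<^esub>)\<rparr>"

definition Z2_group ::
    "('g, 'm) monoid_scheme \<Rightarrow> ('a, 'k) monoid_scheme \<Rightarrow> ('g \<times> 'g \<Rightarrow> 'a) monoid" where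
  "Z2_group G A =
     \<lparr>carrier = {\<delta> \<in> carrier G \<times> carrier G \<rightarrow>\<^sub>E carrier A.
        (\<forall>g\<in>carrier G. \<forall>h\<in>carrier G. \<forall>k\<in>carrier G.
           \<delta> (g, h) \<otimes>\<^bsub>A\<^esub> \<delta> (g \<otimes>\<^bsub>G\<^esub> h, k) = \<delta> (h, k) \<otimes>\<^bsub>A\<^esub> \<delta> (g, h \<otimes>\<^bsub>G\<^esub> k)) \<and>
        (\<forall>g\<in>carrier G. \<delta> (g, \<one>\<^bsub>G\<^esub>) = \<one>\<^bsub>A\<^esub> \<and> \<delta> (\<one>\<^bsub>G\<^esub>, g) = \<one>\<^bsub>A\<^esub>)},
      mult = (\<lambda>\<delta> \<delta>'. \<lambda>x\<in>carrier G \<times> carrier G. \<delta> x \<otimes>\<^bsub>A\<^esub> \<delta>' x),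
      one = (\<lambda>x\<in>carrier G \<times> carrier G. \<one>\<^bsub>A\<^esub>)\<rparr>"

definition B2_set ::
    "('g, 'm) monoid_scheme \<Rightarrow> ('a, 'k) monoid_scheme \<Rightarrow> ('g \<times> 'g \<Rightarrow> 'a) set" where
  "B2_set G A =
     {\<lambda>(g, h)\<in>carrier G \<times> carrier G. \<epsilon> g \<otimes>\<^bsub>A\<^esub> \<epsilon> h \<otimes>\<^bsub>A\<^esub> inv\<^bsub>A\<^esub> \<epsilon> (g \<otimes>\<^bsub>G\<^esub> h) | \<epsilon>.
        \<epsilon> \<in> carrier G \<rightarrow> carrier A \<and> \<epsilon> \<one>\<^bsub>G\<^esub> = \<one>\<^bsub>A\<^esub>}"

definition H2_group ::
    "('g, 'm) monoid_scheme \<Rightarrow> ('a, 'k) monoid_scheme \<Rightarrow> ('g \<times> 'g \<Rightarrow> 'a) set monoid" where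
  "H2_group G A = Z2_group G A Mod B2_set G A"

definition H2_class ::
    "('g, 'm) monoid_scheme \<Rightarrow> ('a, 'k) monoid_scheme \<Rightarrow> ('g \<times> 'g \<Rightarrow> 'a) \<Rightarrow> ('g \<times> 'g \<Rightarrow> 'a) set" where
  "H2_class G A \<delta> = B2_set G A #>\<^bsub>Z2_group G A\<^esub> \<delta>"

definition cocycle_extension ::
    "('g, 'm) monoid_scheme \<Rightarrow> ('a, 'k) monoid_scheme \<Rightarrow> ('g \<times> 'g \<Rightarrow> 'a) \<Rightarrow> ('g \<times> 'a) monoid" where
  "cocycle_extension G A \<delta> =
     \<lparr>carrier = carrier G \<times> carrier A,
      mult = (\<lambda>(g, a) (g', a'). (g \<otimes>\<^bsub>G\<^esub> g', a \<otimes>\<^bsub>A\<^esub> a' \<otimes>\<^bsub>A\<^esub> \<delta> (g, g'))),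
      one = (\<one>\<^bsub>G\<^esub>, \<one>\<^bsub>A\<^esub>)\<rparr>"

definition kernel_embedding :: "('g, 'm) monoid_scheme \<Rightarrow> 'a \<Rightarrow> 'g \<times> 'a" where
  "kernel_embedding G a = (\<one>\<^bsub>G\<^esub>, a)"

subsection \<open>Compatible pairs\<close>

text \<open>For the trivial action the compatibility condition on a pair reads \<open>\<nu> a = \<nu> a\<close>, so all pairs
  of automorphisms are compatible.\<close>

definition Comp ::
    "('g, 'm) monoid_scheme \<Rightarrow> ('a, 'k) monoid_scheme \<Rightarrow> (('g \<Rightarrow> 'g) \<times> ('a \<Rightarrow> 'a)) monoid" where
  "Comp G A = AutoGroup G \<times>\<times> AutoGroup A"

definition Z2_act ::
    "('g, 'm) monoid_scheme \<Rightarrow> ('g \<Rightarrow> 'g) \<times> ('a \<Rightarrow> 'a) \<Rightarrow> ('g \<times> 'g \<Rightarrow> 'a) \<Rightarrow> ('g \<times> 'g \<Rightarrow> 'a)" where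
  "Z2_act G = (\<lambda>(\<eta>, \<nu>) \<delta>. \<lambda>(g, h)\<in>carrier G \<times> carrier G.
     \<nu> (\<delta> (inv_into (carrier G) \<eta> g, inv_into (carrier G) \<eta> h)))"

text \<open>The action on classes is given on representatives; the union is over equal sets.\<close>

definition H2_act ::
    "('g, 'm) monoid_scheme \<Rightarrow> ('a, 'k) monoid_scheme \<Rightarrow> ('g \<Rightarrow> 'g) \<times> ('a \<Rightarrow> 'a) \<Rightarrow>
     ('g \<times> 'g \<Rightarrow> 'a) set \<Rightarrow> ('g \<times> 'g \<Rightarrow> 'a) set" where
  "H2_act G A c = (\<lambda>\<gamma>\<in>carrier (H2_group G A). \<Union>\<delta>\<in>\<gamma>. H2_class G A (Z2_act G c \<delta>))"

definition stabilizer_group ::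
    "('c, 'm) monoid_scheme \<Rightarrow> ('c \<Rightarrow> 'x \<Rightarrow> 'x) \<Rightarrow> 'x \<Rightarrow> ('c, 'm) monoid_scheme" where
  "stabilizer_group C \<phi> x = C\<lparr>carrier := stabilizer C \<phi> x\<rparr>"

definition orbit_reps ::
    "('c, 'm) monoid_scheme \<Rightarrow> ('c \<Rightarrow> 'x \<Rightarrow> 'x) \<Rightarrow> 'x set \<Rightarrow> 'x set \<Rightarrow> bool" where
  "orbit_reps C \<phi> X \<Omega> \<longleftrightarrow> \<Omega> \<subseteq> X \<and> (\<forall>x\<in>X. \<exists>!\<omega>. \<omega> \<in> \<Omega> \<and> \<omega> \<in> orbit C \<phi> x)"

definition auto_stabilizing :: "('e, 'm) monoid_scheme \<Rightarrow> 'e set \<Rightarrow> ('e \<Rightarrow> 'e) set" where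
  "auto_stabilizing E N = {\<alpha> \<in> auto E. \<alpha> ` N = N}"

subsection \<open>Groups given by generators and relations\<close>

text \<open>A word over \<open>X\<close> is a list of letters \<open>(x, True)\<close>, standing for \<open>x\<close>, and \<open>(x, False)\<close>, standing
  for the inverse of \<open>x\<close>. A relation \<open>u = v\<close> is the pair of words \<open>(u, v)\<close>.\<close>

inductive word_cong ::
    "'x set \<Rightarrow> (('x \<times> bool) list \<times> ('x \<times> bool) list) set \<Rightarrow>
     ('x \<times> bool) list \<Rightarrow> ('x \<times> bool) list \<Rightarrow> bool"
  for X R where
  refl: "w \<in> lists (X \<times> UNIV) \<Longrightarrow> word_cong X R w w"
| sym: "word_cong X R u v \<Longrightarrow> word_cong X R v u"
| trans: "word_cong X R u v \<Longrightarrow> word_cong X R v w \<Longrightarrow> word_cong X R u w"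
| append: "word_cong X R u v \<Longrightarrow> word_cong X R u' v' \<Longrightarrow> word_cong X R (u @ u') (v @ v')"
| cancel: "x \<in> X \<Longrightarrow> word_cong X R [(x, b), (x, \<not> b)] []"
| rel: "(u, v) \<in> R \<Longrightarrow> u \<in> lists (X \<times> UNIV) \<Longrightarrow> v \<in> lists (X \<times> UNIV) \<Longrightarrow> word_cong X R u v"

definition word_class ::
    "'x set \<Rightarrow> (('x \<times> bool) list \<times> ('x \<times> bool) list) set \<Rightarrow>
     ('x \<times> bool) list \<Rightarrow> ('x \<times> bool) list set" where
  "word_class X R w = {v. word_cong X R w v}"

definition presented_group ::
    "'x set \<Rightarrow> (('x \<times> bool) list \<times> ('x \<times> bool) list) set \<Rightarrow> ('x \<times> bool) list set monoid" where
  "presented_group X R =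
     \<lparr>carrier = word_class X R ` lists (X \<times> UNIV),
      mult = (\<lambda>P Q. \<Union>u\<in>P. \<Union>v\<in>Q. word_class X R (u @ v)),
      one = word_class X R []\<rparr>"

subsection \<open>Non-abelian exterior product and Schur multiplier of a pair\<close>

definition conj_by :: "('g, 'm) monoid_scheme \<Rightarrow> 'g \<Rightarrow> 'g \<Rightarrow> 'g" where
  "conj_by G h g = h \<otimes>\<^bsub>G\<^esub> g \<otimes>\<^bsub>G\<^esub> inv\<^bsub>G\<^esub> h"

definition wedge_relations ::
    "('g, 'm) monoid_scheme \<Rightarrow> 'g set \<Rightarrow> ((('g \<times> 'g) \<times> bool) list \<times> (('g \<times> 'g) \<times> bool) list) set" where
  "wedge_relations G H =
     {([((g \<otimes>\<^bsub>G\<^esub> g', h), True)],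
       [((conj_by G g g', conj_by G g h), True), ((g, h), True)]) | g g' h.
        g \<in> carrier G \<and> g' \<in> carrier G \<and> h \<in> H} \<union>
     {([((g, h \<otimes>\<^bsub>G\<^esub> h'), True)],
       [((g, h), True), ((conj_by G h g, conj_by G h h'), True)]) | g h h'.
        g \<in> carrier G \<and> h \<in> H \<and> h' \<in> H} \<union>
     {([((h, h), True)], []) | h. h \<in> H}"

definition ext_product ::
    "('g, 'm) monoid_scheme \<Rightarrow> 'g set \<Rightarrow> (('g \<times> 'g) \<times> bool) list set monoid" where
  "ext_product G H = presented_group (carrier G \<times> H) (wedge_relations G H)"

definition wedge ::
    "('g, 'm) monoid_scheme \<Rightarrow> 'g set \<Rightarrow> 'g \<Rightarrow> 'g \<Rightarrow> (('g \<times> 'g) \<times> bool) list set" where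
  "wedge G H g h = word_class (carrier G \<times> H) (wedge_relations G H) [((g, h), True)]"

definition commutator_map ::
    "('g, 'm) monoid_scheme \<Rightarrow> 'g set \<Rightarrow> (('g \<times> 'g) \<times> bool) list set \<Rightarrow> 'g" where
  "commutator_map G H = (THE f.
     f \<in> hom (ext_product G H) (G\<lparr>carrier := commutator_subgroup G (carrier G) H\<rparr>) \<and>
     f \<in> extensional (carrier (ext_product G H)) \<and>
     (\<forall>g\<in>carrier G. \<forall>h\<in>H. f (wedge G H g h) = g \<otimes>\<^bsub>G\<^esub> h \<otimes>\<^bsub>G\<^esub> inv\<^bsub>G\<^esub> g \<otimes>\<^bsub>G\<^esub> inv\<^bsub>G\<^esub> h))"

definition schur_multiplier ::
    "('g, 'm) monoid_scheme \<Rightarrow> 'g set \<Rightarrow> (('g \<times> 'g) \<times> bool) list set monoid" where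
  "schur_multiplier G H = (ext_product G H)
     \<lparr>carrier := kernel (ext_product G H) (G\<lparr>carrier := commutator_subgroup G (carrier G) H\<rparr>)
                  (commutator_map G H)\<rparr>"

subsection \<open>The map from cohomology to homomorphisms on the Schur multiplier\<close>

definition cocycle_hat ::
    "('g, 'm) monoid_scheme \<Rightarrow> ('a, 'k) monoid_scheme \<Rightarrow> ('g \<times> 'g \<Rightarrow> 'a) \<Rightarrow> 'g \<Rightarrow> 'g \<Rightarrow> 'a" where
  "cocycle_hat G A \<delta> g h =
     \<delta> (g, h) \<otimes>\<^bsub>A\<^esub> inv\<^bsub>A\<^esub> \<delta> (h, g)
       \<otimes>\<^bsub>A\<^esub> inv\<^bsub>A\<^esub> \<delta> (inv\<^bsub>G\<^esub> (h \<otimes>\<^bsub>G\<^esub> g), h \<otimes>\<^bsub>G\<^esub> g)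
       \<otimes>\<^bsub>A\<^esub> \<delta> (inv\<^bsub>G\<^esub> (h \<otimes>\<^bsub>G\<^esub> g), g \<otimes>\<^bsub>G\<^esub> h)"

text \<open>The homomorphism does not depend on the representative \<open>\<delta>\<close>, hence the condition may be imposed
  for all \<open>\<delta> \<in> \<gamma>\<close>.\<close>

definition kappa_bar ::
    "('g, 'm) monoid_scheme \<Rightarrow> ('a, 'k) monoid_scheme \<Rightarrow> ('g \<times> 'g \<Rightarrow> 'a) set \<Rightarrow>
     (('g \<times> 'g) \<times> bool) list set \<Rightarrow> 'a" where
  "kappa_bar G A \<gamma> = (THE f.
     f \<in> hom (schur_multiplier G (last_lower_central G)) A \<and>
     f \<in> extensional (carrier (schur_multiplier G (last_lower_central G))) \<and>
     (\<forall>\<delta>\<in>\<gamma>. \<forall>g\<in>carrier G. \<forall>h\<in>last_lower_central G.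
        f (wedge G (last_lower_central G) g h) = cocycle_hat G A \<delta> g h))"

definition Delta ::
    "('g, 'm) monoid_scheme \<Rightarrow> ('a, 'k) monoid_scheme \<Rightarrow> ('g \<times> 'g \<Rightarrow> 'a) set set" where
  "Delta G A = {\<gamma> \<in> carrier (H2_group G A).
     kappa_bar G A \<gamma> ` carrier (schur_multiplier G (last_lower_central G)) = carrier A}"

end

theory Submission
  imports Defs
begin

text \<open>
  Let \<open>L\<close> be the last non-trivial term of the lower central series of \<open>G\<close>, at index \<open>n\<close>, and let \<open>E\<close>
  be the extension given by a cocycle \<open>\<delta>\<close>. As \<open>L\<close> is central in \<open>G\<close>, commutators of elements of \<open>E\<close>
  over \<open>g\<close> with elements over \<open>h \<in> L\<close> are the elements \<open>\<delta>(g, h) - \<delta>(h, g)\<close> of \<open>A\<close>. Hence the term of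
  index \<open>n + 1\<close> for \<open>E\<close> is the copy of the subgroup of \<open>A\<close> generated by these values, which is the
  image of the homomorphism attached to \<open>[\<delta>]\<close>. So \<open>[\<delta>] \<in> \<Delta>\<close> if and only if \<open>E\<close> is a lower central
  series extension. Every isomorphism between two lower central series extensions preserves
  the copies of \<open>A\<close>, being the last terms of the lower central series, and so is given by a
  compatible pair together with a cochain comparing the two cocycles. This yields the
  correspondence between isomorphism types and orbits, and the exact sequence for automorphisms;
  the stabilizer is the image of the automorphism group in the group of compatible pairs.
\<close>

section \<open>Lower central series\<close>

text \<open>\<open>kappa_bar\<close> is a definite description over maps out of a group given by
  words and relations, so its image is accessible only through the universal property of the
  presentation. That property applies because on commuting arguments \<open>cocycle_hat\<close> is
  the commutator pairing of the extension: it is bimultiplicative and alternating, and since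
  \<open>L\<close> is central and \<open>A\<close> abelian these are just the exterior relations.
  Centrality of \<open>L\<close> also makes the commutator map trivial, so the Schur multiplier is
  the whole exterior product.

  The delicate point of the criterion is the index. A term of the series of \<open>E\<close> equal
  to the copy of \<open>A\<close> projects to the trivial subgroup of \<open>G\<close>, while the
  terms up to index \<open>n\<close> project onto non-trivial ones; so it can only occur after index
  \<open>n\<close>. Conversely, non-triviality of \<open>A\<close> makes term \<open>n + 1\<close>
  count as non-trivial.

  Once the criterion is available, membership in \<open>Delta\<close> is moved along isomorphisms
  that match the copies of \<open>A\<close>, instead of evaluating \<open>kappa_bar\<close> at a
  transported cocycle. Both the invariance of \<open>Delta\<close> and the handling of arbitrary
  extensions rest on this.\<close>

lemma commutator_subgroup_image:
  assumes "group E" "group F" "f \<in> hom E F" "H \<subseteq> carrier E" "K \<subseteq> carrier E"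
  shows "f ` commutator_subgroup E H K = commutator_subgroup F (f ` H) (f ` K)"
proof -
  interpret f: group_hom E F f
    using assms by (simp add: group_hom_def group_hom_axioms_def)
  let ?S = "{h \<otimes>\<^bsub>E\<^esub> k \<otimes>\<^bsub>E\<^esub> inv\<^bsub>E\<^esub> h \<otimes>\<^bsub>E\<^esub> inv\<^bsub>E\<^esub> k | h k. h \<in> H \<and> k \<in> K}"
  have eq: "f (h \<otimes>\<^bsub>E\<^esub> k \<otimes>\<^bsub>E\<^esub> inv\<^bsub>E\<^esub> h \<otimes>\<^bsub>E\<^esub> inv\<^bsub>E\<^esub> k)
      = f h \<otimes>\<^bsub>F\<^esub> f k \<otimes>\<^bsub>F\<^esub> inv\<^bsub>F\<^esub> f h \<otimes>\<^bsub>F\<^esub> inv\<^bsub>F\<^esub> f k" if "h \<in> H" "k \<in> K" for h k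
    using that assms(4,5) by (simp add: subset_iff)
  have "f ` ?S = {h \<otimes>\<^bsub>F\<^esub> k \<otimes>\<^bsub>F\<^esub> inv\<^bsub>F\<^esub> h \<otimes>\<^bsub>F\<^esub> inv\<^bsub>F\<^esub> k | h k. h \<in> f ` H \<and> k \<in> f ` K}"
  proof (intro equalityI subsetI)
    fix y assume "y \<in> f ` ?S"
    then show "y \<in> {h \<otimes>\<^bsub>F\<^esub> k \<otimes>\<^bsub>F\<^esub> inv\<^bsub>F\<^esub> h \<otimes>\<^bsub>F\<^esub> inv\<^bsub>F\<^esub> k | h k. h \<in> f ` H \<and> k \<in> f ` K}"
      using eq by blast
  next
    fix y assume "y \<in> {h \<otimes>\<^bsub>F\<^esub> k \<otimes>\<^bsub>F\<^esub> inv\<^bsub>F\<^esub> h \<otimes>\<^bsub>F\<^esub> inv\<^bsub>F\<^esub> k | h k. h \<in> f ` H \<and> k \<in> f ` K}"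
    then obtain h k where "h \<in> H" "k \<in> K" "y = f h \<otimes>\<^bsub>F\<^esub> f k \<otimes>\<^bsub>F\<^esub> inv\<^bsub>F\<^esub> f h \<otimes>\<^bsub>F\<^esub> inv\<^bsub>F\<^esub> f k"
      by blast
    then show "y \<in> f ` ?S"
      by (intro image_eqI[of _ _ "h \<otimes>\<^bsub>E\<^esub> k \<otimes>\<^bsub>E\<^esub> inv\<^bsub>E\<^esub> h \<otimes>\<^bsub>E\<^esub> inv\<^bsub>E\<^esub> k"]) (auto simp: eq)
  qed
  moreover have "?S \<subseteq> carrier E" using assms(4,5) by (auto simp: subset_iff)
  ultimately show ?thesis
    using f.generate_img[of ?S] by (simp add: commutator_subgroup_def)
qed

lemma commutator_subgroup_in_carrier:
  assumes "group G" "H \<subseteq> carrier G" "K \<subseteq> carrier G"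
  shows "commutator_subgroup G H K \<subseteq> carrier G"
proof -
  interpret group G by fact
  show ?thesis
    unfolding commutator_subgroup_def using assms(2,3)
    by (intro generate_incl) (auto simp: subset_iff)
qed

lemma lower_central_in_carrier: "group G \<Longrightarrow> lower_central G n \<subseteq> carrier G"
  by (induction n) (auto dest: commutator_subgroup_in_carrier[of G "carrier G"])

lemma lower_central_subgroup:
  assumes "group G"
  shows "subgroup (lower_central G n) G"
proof (cases n)
  case 0
  then show ?thesis using assms by (simp add: group.subgroup_self)
next
  case (Suc m)
  have "{h \<otimes>\<^bsub>G\<^esub> k \<otimes>\<^bsub>G\<^esub> inv\<^bsub>G\<^esub> h \<otimes>\<^bsub>G\<^esub> inv\<^bsub>G\<^esub> k | h k. h \<in> carrier G \<and> k \<in> lower_central G m}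
      \<subseteq> carrier G"
    using lower_central_in_carrier[OF assms, of m] assms
    by (auto simp: subset_iff group.is_monoid group.inv_closed monoid.m_closed)
  then show ?thesis
    using assms by (simp add: Suc commutator_subgroup_def group.generate_is_subgroup)
qed

text \<open>Each step brackets with the whole group, so surjectivity is what makes the image of a
  term a term again. It is applied to conjugations, to the projection of an extension onto
  \<open>G\<close>, and to isomorphisms.\<close>

lemma lower_central_image:
  assumes "group E" "group F" "f \<in> epi E F"
  shows "f ` lower_central E n = lower_central F n"
proof (induction n)
  case 0
  then show ?case using assms(3) by (simp add: epi_def)
next
  case (Suc n)
  then show ?case
    using commutator_subgroup_image[of E F f "carrier E" "lower_central E n"] assms
      lower_central_in_carrier[of E n] by (simp add: epi_def)
qed

lemma (in group) conj_epi:
  assumes "g \<in> carrier G"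
  shows "(\<lambda>x. g \<otimes> x \<otimes> inv g) \<in> epi G G"
proof -
  have "x \<in> (\<lambda>x. g \<otimes> x \<otimes> inv g) ` carrier G" if "x \<in> carrier G" for x
    using that assms by (intro image_eqI[of _ _ "inv g \<otimes> x \<otimes> g"]) (simp_all add: m_assoc, simp add: m_assoc[symmetric])
  moreover have "g \<otimes> (x \<otimes> y) \<otimes> inv g = g \<otimes> x \<otimes> inv g \<otimes> (g \<otimes> y \<otimes> inv g)"
    if "x \<in> carrier G" "y \<in> carrier G" for x y
    using that assms by (metis inv_closed inv_solve_right m_assoc m_closed)
  ultimately show ?thesis using assms by (auto simp: epi_iff_subset hom_def)
qed

text \<open>Normality of the terms is a case of the image lemma, conjugation being a surjective
  endomorphism.\<close>

lemma lower_central_conj: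
  assumes "group G" "g \<in> carrier G" "x \<in> lower_central G n"
  shows "g \<otimes>\<^bsub>G\<^esub> x \<otimes>\<^bsub>G\<^esub> inv\<^bsub>G\<^esub> g \<in> lower_central G n"
  using lower_central_image[OF assms(1,1) group.conj_epi[OF assms(1,2)], of n] assms(3) by blast

lemma lower_central_Suc_subset:
  fixes G (structure)
  assumes "group G"
  shows "lower_central G (Suc n) \<subseteq> lower_central G n"
proof -
  interpret group G by fact
  interpret N: subgroup "lower_central G n" G by (rule lower_central_subgroup[OF assms])
  \<comment> \<open>The commutator is the conjugate of \<open>k\<close> by \<open>h\<close> times
    the inverse of \<open>k\<close>, and both factors lie in the normal subgroup.\<close>
  have "h \<otimes> k \<otimes> inv h \<otimes> inv k \<in> lower_central G n"
    if "h \<in> carrier G" "k \<in> lower_central G n" for h k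
    using lower_central_conj[OF assms that] that(2) N.m_inv_closed N.m_closed by simp
  then show ?thesis
    by (simp, unfold commutator_subgroup_def)
      (intro generate_subgroup_incl[OF _ N.is_subgroup], auto)
qed

lemma lower_central_antimono:
  assumes "group G" "m \<le> n"
  shows "lower_central G n \<subseteq> lower_central G m"
  using lift_Suc_antimono_le[of "lower_central G", OF _ assms(2)]
    lower_central_Suc_subset[OF assms(1)] by blast

text \<open>The commutator of \<open>g\<close> and \<open>h\<close> is a generator of the next term,
  which is trivial; so the last non-trivial term is central.\<close>

lemma lower_central_last_commute:
  fixes G (structure)
  assumes "group G" "lower_central G (Suc n) = {\<one>\<^bsub>G\<^esub>}" "g \<in> carrier G" "h \<in> lower_central G n"
  shows "g \<otimes>\<^bsub>G\<^esub> h = h \<otimes>\<^bsub>G\<^esub> g"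
proof -
  interpret group G by fact
  have h: "h \<in> carrier G" using lower_central_in_carrier[OF assms(1)] assms(4) by blast
  have "g \<otimes> h \<otimes> inv g \<otimes> inv h \<in> lower_central G (Suc n)"
    using assms(3,4) by (auto simp: commutator_subgroup_def intro!: generate.incl)
  then have "g \<otimes> h \<otimes> inv g \<otimes> inv h = \<one>" using assms(2) by simp
  then show ?thesis using h assms(3) by (metis inv_closed inv_equality inv_inv inv_solve_right l_one m_closed one_closed)
qed

lemma commutator_subgroup_central:
  fixes G (structure)
  assumes "group G" "N \<subseteq> carrier G" "N \<noteq> {}" "\<And>g h. g \<in> carrier G \<Longrightarrow> h \<in> N \<Longrightarrow> g \<otimes>\<^bsub>G\<^esub> h = h \<otimes>\<^bsub>G\<^esub> g"
  shows "commutator_subgroup G (carrier G) N = {\<one>\<^bsub>G\<^esub>}"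
proof -
  interpret group G by fact
  have "h \<otimes> k \<otimes> inv h \<otimes> inv k = \<one>" if "h \<in> carrier G" "k \<in> N" for h k
    using that assms(2) by (simp add: assms(4)[OF that] subset_iff m_assoc)
  then have "{h \<otimes> k \<otimes> inv h \<otimes> inv k | h k. h \<in> carrier G \<and> k \<in> N} = {\<one>}"
    using assms(3) by (auto, metis one_closed)
  then show ?thesis by (simp add: commutator_subgroup_def generate_one)
qed

text \<open>\<open>LEAST\<close> refers to inclusion, which is not a total order, so minimality has
  to be checked: the series decreases, hence a non-trivial term has index at most \<open>n\<close>
  and contains term \<open>n\<close>.\<close>

lemma last_lower_central_eq:
  assumes "group G" "lower_central G n \<noteq> {\<one>\<^bsub>G\<^esub>}" "lower_central G (Suc n) = {\<one>\<^bsub>G\<^esub>}"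
  shows "last_lower_central G = lower_central G n"
  unfolding last_lower_central_def
proof (rule Least_equality)
  fix H assume H: "H \<in> range (lower_central G) \<and> H \<noteq> {\<one>\<^bsub>G\<^esub>}"
  then obtain m where m: "H = lower_central G m" by blast
  have "m \<le> n"
  proof (rule ccontr)
    assume "\<not> m \<le> n"
    then have "H \<subseteq> {\<one>\<^bsub>G\<^esub>}"
      using lower_central_antimono[OF assms(1), of "Suc n" m] assms(3) m by simp
    then show False
      using H subgroup.one_closed[OF lower_central_subgroup[OF assms(1), of m]] m by blast
  qed
  then show "lower_central G n \<subseteq> H"
    using lower_central_antimono[OF assms(1)] m by simp
qed (use assms in auto)

text \<open>The index \<open>n\<close> is the predecessor of the first index with a trivial term; it
  exists because term 0 is the non-trivial carrier.\<close>

lemma nilpotent_last: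
  assumes "nilpotent_group G" "carrier G \<noteq> {\<one>\<^bsub>G\<^esub>}"
  obtains n where "lower_central G n \<noteq> {\<one>\<^bsub>G\<^esub>}" "lower_central G (Suc n) = {\<one>\<^bsub>G\<^esub>}"
    "last_lower_central G = lower_central G n"
proof -
  have G: "group G" using assms(1) by (simp add: nilpotent_group_def)
  let ?P = "\<lambda>n. lower_central G n = {\<one>\<^bsub>G\<^esub>}"
  obtain m where "?P m" using assms(1) by (auto simp: nilpotent_group_def)
  moreover have "\<not> ?P 0" using assms(2) by simp
  ultimately obtain n where "\<not> ?P n" "?P (Suc n)" using ex_least_nat_less[of ?P m] by blast
  then show thesis using that[of n] last_lower_central_eq[OF G, of n] by simp
qed

lemma nilpotent_group_iso:
  assumes "nilpotent_group E" "group F" "f \<in> iso E F"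
  shows "nilpotent_group F"
proof -
  obtain n where n: "lower_central E n = {\<one>\<^bsub>E\<^esub>}" and E: "group E"
    using assms(1) by (auto simp: nilpotent_group_def)
  have "lower_central F n = {f \<one>\<^bsub>E\<^esub>}"
    using lower_central_image[OF E assms(2), of f n] n assms(3) by (simp add: iso_iff_mon_epi)
  then show ?thesis
    using hom_one[OF iso_imp_homomorphism[OF assms(3)] E assms(2)] assms(2)
    by (auto simp: nilpotent_group_def)
qed

text \<open>Terms correspond index by index, and injectivity keeps term \<open>n\<close>
  non-trivial, so the last terms of both groups sit at the same index. This is what forces
  isomorphisms to respect the copies of \<open>A\<close>.\<close>

lemma last_lower_central_iso:
  assumes "nilpotent_group E" "carrier E \<noteq> {\<one>\<^bsub>E\<^esub>}" "group F" "f \<in> iso E F"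
  shows "f ` last_lower_central E = last_lower_central F"
proof -
  have E: "group E" using assms(1) by (simp add: nilpotent_group_def)
  obtain n where n: "lower_central E n \<noteq> {\<one>\<^bsub>E\<^esub>}" "lower_central E (Suc n) = {\<one>\<^bsub>E\<^esub>}"
    "last_lower_central E = lower_central E n" using nilpotent_last[OF assms(1,2)] .
  have img: "f ` lower_central E m = lower_central F m" for m
    using lower_central_image[OF E assms(3)] assms(4) by (simp add: iso_iff_mon_epi)
  have one: "f \<one>\<^bsub>E\<^esub> = \<one>\<^bsub>F\<^esub>" using hom_one[OF iso_imp_homomorphism[OF assms(4)] E assms(3)] .
  have "lower_central F n \<noteq> f ` {\<one>\<^bsub>E\<^esub>}"
    using n(1) img[of n] lower_central_in_carrier[OF E, of n] assms(4) group.is_monoid[OF E]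
    by (metis (no_types, lifting) empty_subsetI inj_on_image_eq_iff insert_subset iso_iff monoid.one_closed)
  then show ?thesis
    using last_lower_central_eq[OF assms(3), of n] img[of "Suc n"] n one img[of n] by simp
qed

section \<open>Homomorphisms out of presented groups\<close>

text \<open>Evaluation of signed words under an assignment of the letters, before passing to
  congruence classes.\<close>

definition word_value :: "('a, 'k) monoid_scheme \<Rightarrow> ('x \<Rightarrow> 'a) \<Rightarrow> ('x \<times> bool) list \<Rightarrow> 'a" where
  "word_value A \<phi> w =
     foldr (\<lambda>(x, b) a. (if b then \<phi> x else inv\<^bsub>A\<^esub> \<phi> x) \<otimes>\<^bsub>A\<^esub> a) w \<one>\<^bsub>A\<^esub>"

lemma word_cong_in_lists:
  "word_cong X R u v \<Longrightarrow> u \<in> lists (X \<times> UNIV) \<and> v \<in> lists (X \<times> UNIV)"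
  by (induction rule: word_cong.induct) auto

lemma word_class_eqI:
  assumes "word_cong X R u v"
  shows "word_class X R u = word_class X R v"
  using word_cong.trans[OF assms] word_cong.trans[OF word_cong.sym[OF assms]]
  by (auto simp: word_class_def)

lemma mem_word_class: "w \<in> lists (X \<times> UNIV) \<Longrightarrow> w \<in> word_class X R w"
  by (simp add: word_class_def word_cong.refl)

text \<open>The product is a union over all representatives. By compatibility of the congruence with
  concatenation all its members coincide, and it collapses because the classes are
  non-empty.\<close>

lemma presented_group_mult:
  assumes "u \<in> lists (X \<times> UNIV)" "v \<in> lists (X \<times> UNIV)"
  shows "word_class X R u \<otimes>\<^bsub>presented_group X R\<^esub> word_class X R v = word_class X R (u @ v)"
proof -
  have "word_class X R (u' @ v') = word_class X R (u @ v)"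
    if "u' \<in> word_class X R u" "v' \<in> word_class X R v" for u' v'
    using that by (intro word_class_eqI word_cong.sym[OF word_cong.append]) (simp_all add: word_class_def)
  moreover have "word_class X R u \<noteq> {}" "word_class X R v \<noteq> {}"
    using mem_word_class[OF assms(1)] mem_word_class[OF assms(2)] by blast+
  ultimately show ?thesis
    unfolding presented_group_def monoid.simps by (intro SUP_eq_const)
qed

context group
begin

lemma word_value_simps [simp]:
  "word_value G \<phi> [] = \<one>"
  "word_value G \<phi> ((x, b) # w) = (if b then \<phi> x else inv (\<phi> x)) \<otimes> word_value G \<phi> w"
  by (auto simp: word_value_def)

lemma word_value_closed:
  assumes "\<phi> \<in> X \<rightarrow> carrier G" "w \<in> lists (X \<times> UNIV)"
  shows "word_value G \<phi> w \<in> carrier G"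
  using assms(2)
proof (induction rule: lists.induct)
  case (Cons y l)
  then show ?case using assms(1) by (cases y) (auto simp: Pi_iff)
qed simp

lemma word_value_append:
  assumes "\<phi> \<in> X \<rightarrow> carrier G" "u \<in> lists (X \<times> UNIV)" "v \<in> lists (X \<times> UNIV)"
  shows "word_value G \<phi> (u @ v) = word_value G \<phi> u \<otimes> word_value G \<phi> v"
  using assms(2)
proof (induction rule: lists.induct)
  case Nil
  then show ?case using word_value_closed[OF assms(1,3)] by simp
next
  case (Cons y l)
  obtain x b where "y = (x, b)" by force
  moreover from this have "\<phi> x \<in> carrier G" using Cons assms(1) by auto
  ultimately show ?case
    using Cons word_value_closed[OF assms(1,3)] word_value_closed[OF assms(1), of l]
    by (simp add: m_assoc)
qed

text \<open>Soundness of evaluation: cancellation and concatenation are respected in any group, so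
  only the defining relations have to be checked.\<close>

lemma word_value_cong:
  assumes "\<phi> \<in> X \<rightarrow> carrier G"
    and "\<And>u v. (u, v) \<in> R \<Longrightarrow> u \<in> lists (X \<times> UNIV) \<Longrightarrow> v \<in> lists (X \<times> UNIV) \<Longrightarrow>
      word_value G \<phi> u = word_value G \<phi> v"
    and "word_cong X R u v"
  shows "word_value G \<phi> u = word_value G \<phi> v"
  using assms(3)
proof (induction rule: word_cong.induct)
  case (append u v u' v')
  then show ?case
    using word_cong_in_lists[OF append.hyps(1)] word_cong_in_lists[OF append.hyps(2)]
    by (simp add: word_value_append[OF assms(1)])
next
  case (cancel x b)
  then show ?case using assms(1) by (auto simp: Pi_iff)
qed (use assms(2) in auto)

text \<open>Turns surjectivity of a map out of a presented group into a statement about generating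
  sets of the target.\<close>

lemma word_value_image:
  assumes "\<phi> \<in> X \<rightarrow> carrier G"
  shows "word_value G \<phi> ` lists (X \<times> UNIV) = generate G (\<phi> ` X)"
proof (intro equalityI subsetI)
  fix a assume "a \<in> word_value G \<phi> ` lists (X \<times> UNIV)"
  then obtain w where w: "w \<in> lists (X \<times> UNIV)" "a = word_value G \<phi> w" by blast
  have "word_value G \<phi> w \<in> generate G (\<phi> ` X)"
    using w(1)
  proof (induction rule: lists.induct)
    case (Cons y l)
    then show ?case by (cases y) (auto intro!: generate.eng intro: generate.incl generate.inv)
  qed (simp add: generate.one)
  then show "a \<in> generate G (\<phi> ` X)" using w by simp
next
  fix a assume "a \<in> generate G (\<phi> ` X)"
  then show "a \<in> word_value G \<phi> ` lists (X \<times> UNIV)"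
  proof (induction rule: generate.induct)
    case one
    show ?case by (intro image_eqI[of _ _ "[]"]) auto
  next
    case (incl h)
    then obtain x where "x \<in> X" "h = \<phi> x" by blast
    then show ?case using assms by (intro image_eqI[of _ _ "[(x, True)]"]) (auto simp: Pi_iff)
  next
    case (inv h)
    then obtain x where "x \<in> X" "h = \<phi> x" by blast
    then show ?case using assms by (intro image_eqI[of _ _ "[(x, False)]"]) (auto simp: Pi_iff)
  next
    case (eng h1 h2)
    then obtain u v where "u \<in> lists (X \<times> UNIV)" "v \<in> lists (X \<times> UNIV)"
      "h1 = word_value G \<phi> u" "h2 = word_value G \<phi> v" by blast
    then show ?case
      using word_value_append[OF assms] by (intro image_eqI[of _ _ "u @ v"]) auto
  qed
qed

text \<open>Uniqueness half of the universal property; the values at negative letters are forced by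
  the cancellation rule.\<close>

lemma presented_group_hom_unique:
  assumes "f \<in> hom (presented_group X R) G"
    and "\<And>x. x \<in> X \<Longrightarrow> f (word_class X R [(x, True)]) = \<phi> x"
    and "w \<in> lists (X \<times> UNIV)"
  shows "f (word_class X R w) = word_value G \<phi> w"
proof -
  have mult: "f (word_class X R (u @ v)) = f (word_class X R u) \<otimes> f (word_class X R v)"
    if "u \<in> lists (X \<times> UNIV)" "v \<in> lists (X \<times> UNIV)" for u v
    using hom_mult[OF assms(1), of "word_class X R u" "word_class X R v"] that
    by (simp add: presented_group_mult) (simp add: presented_group_def)
  have closed: "f (word_class X R u) \<in> carrier G" if "u \<in> lists (X \<times> UNIV)" for u
    using hom_in_carrier[OF assms(1)] that by (simp add: presented_group_def)
  \<comment> \<open>The class of the empty word is idempotent, hence so is its image, and a group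
    has only one idempotent. The presented side enters merely as a set with a product.\<close>
  have nil: "f (word_class X R []) = \<one>"
    using mult[of "[]" "[]"] closed[of "[]"] by simp
  have neg: "f (word_class X R [(x, False)]) = inv (\<phi> x)" if "x \<in> X" for x
  proof -
    have "f (word_class X R [(x, False)]) \<otimes> f (word_class X R [(x, True)]) = \<one>"
      using mult[of "[(x, False)]" "[(x, True)]"] nil
        word_class_eqI[OF word_cong.cancel[OF that, of R False]] that by simp
    then show ?thesis
      using closed[of "[(x, False)]"] closed[of "[(x, True)]"] that assms(2)[OF that]
      by (simp add: inv_equality)
  qed
  show ?thesis using assms(3)
  proof (induction rule: lists.induct)
    case Nil
    then show ?case using nil by simp
  next
    case (Cons y l)
    obtain x b where "y = (x, b)" by force
    then show ?case using Cons mult[of "[y]" l] neg assms(2) by (cases b) auto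
  qed
qed

text \<open>Existence half of the universal property (von Dyck). The map is made extensional so that
  it can be the unique solution of a definite description.\<close>

lemma presented_group_hom_exists:
  assumes "\<phi> \<in> X \<rightarrow> carrier G"
    and "\<And>u v. (u, v) \<in> R \<Longrightarrow> u \<in> lists (X \<times> UNIV) \<Longrightarrow> v \<in> lists (X \<times> UNIV) \<Longrightarrow>
      word_value G \<phi> u = word_value G \<phi> v"
  obtains f where "f \<in> hom (presented_group X R) G" "f \<in> extensional (carrier (presented_group X R))"
    "\<And>w. w \<in> lists (X \<times> UNIV) \<Longrightarrow> f (word_class X R w) = word_value G \<phi> w"
proof
  \<comment> \<open>A class is evaluated at an arbitrary member; \<open>word_value_cong\<close>
    makes the choice irrelevant.\<close>
  define f where "f = (\<lambda>P\<in>carrier (presented_group X R). word_value G \<phi> (SOME w. w \<in> P))"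
  show val: "f (word_class X R w) = word_value G \<phi> w" if "w \<in> lists (X \<times> UNIV)" for w
  proof -
    have "word_cong X R w (SOME v. v \<in> word_class X R w)"
      using someI[of "\<lambda>v. v \<in> word_class X R w", OF mem_word_class[OF that]]
      by (simp add: word_class_def)
    then show ?thesis
      using word_value_cong[OF assms] that by (simp add: f_def presented_group_def)
  qed
  show "f \<in> extensional (carrier (presented_group X R))" by (simp add: f_def)
  show "f \<in> hom (presented_group X R) G"
  proof (rule homI)
    fix P assume "P \<in> carrier (presented_group X R)"
    then obtain u where "u \<in> lists (X \<times> UNIV)" "P = word_class X R u"
      by (auto simp: presented_group_def)
    then show "f P \<in> carrier G" using val word_value_closed[OF assms(1)] by simp
  next
    fix P Q assume "P \<in> carrier (presented_group X R)" "Q \<in> carrier (presented_group X R)"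
    then obtain u v where "u \<in> lists (X \<times> UNIV)" "P = word_class X R u"
       "v \<in> lists (X \<times> UNIV)" "Q = word_class X R v"
      by (auto simp: presented_group_def)
    then show "f (P \<otimes>\<^bsub>presented_group X R\<^esub> Q) = f P \<otimes> f Q"
      by (simp add: val presented_group_mult word_value_append[OF assms(1)])
  qed
qed

end

section \<open>Cocycles and their extensions\<close>

lemma (in comm_group) div_eq_iff:
  assumes "a \<in> carrier G" "b \<in> carrier G" "c \<in> carrier G" "d \<in> carrier G"
  shows "a \<otimes> inv b = c \<otimes> inv d \<longleftrightarrow> a \<otimes> d = c \<otimes> b"
proof -
  have "a \<otimes> inv b = c \<otimes> inv d \<longleftrightarrow> a \<otimes> inv b \<otimes> (b \<otimes> d) = c \<otimes> inv d \<otimes> (b \<otimes> d)"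
    using assms by simp
  also have "a \<otimes> inv b \<otimes> (b \<otimes> d) = a \<otimes> d"
    using assms by (simp add: m_assoc) (simp add: m_assoc[symmetric])
  also have "c \<otimes> inv d \<otimes> (b \<otimes> d) = c \<otimes> b"
    using assms by (simp add: m_comm[of b d] m_assoc) (simp add: m_assoc[symmetric])
  finally show ?thesis .
qed

locale trivial_module = G: group G + A: comm_group A
  for G (structure) and A (structure)
begin

abbreviation "Z2 \<equiv> carrier (Z2_group G A)"

lemma Z2_iff:
  "\<delta> \<in> Z2 \<longleftrightarrow> \<delta> \<in> extensional (carrier G \<times> carrier G) \<and>
     (\<forall>g\<in>carrier G. \<forall>h\<in>carrier G. \<delta> (g, h) \<in> carrier A) \<and>
     (\<forall>g\<in>carrier G. \<forall>h\<in>carrier G. \<forall>k\<in>carrier G.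
        \<delta> (g, h) \<otimes>\<^bsub>A\<^esub> \<delta> (g \<otimes> h, k) = \<delta> (h, k) \<otimes>\<^bsub>A\<^esub> \<delta> (g, h \<otimes> k)) \<and>
     (\<forall>g\<in>carrier G. \<delta> (g, \<one>) = \<one>\<^bsub>A\<^esub> \<and> \<delta> (\<one>, g) = \<one>\<^bsub>A\<^esub>)"
  by (auto simp: Z2_group_def PiE_def Pi_def)

lemma Z2_mult:
  "\<delta> \<otimes>\<^bsub>Z2_group G A\<^esub> \<delta>' = (\<lambda>x\<in>carrier G \<times> carrier G. \<delta> x \<otimes>\<^bsub>A\<^esub> \<delta>' x)"
  by (simp add: Z2_group_def)

lemma Z2_undefined: "\<delta> \<in> Z2 \<Longrightarrow> x \<notin> carrier G \<times> carrier G \<Longrightarrow> \<delta> x = undefined"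
  unfolding Z2_iff by (meson extensional_arb)

lemma Z2_closed [simp]:
  "\<delta> \<in> Z2 \<Longrightarrow> g \<in> carrier G \<Longrightarrow> h \<in> carrier G \<Longrightarrow> \<delta> (g, h) \<in> carrier A"
  by (simp add: Z2_iff)

lemma Z2_cocycle:
  "\<delta> \<in> Z2 \<Longrightarrow> g \<in> carrier G \<Longrightarrow> h \<in> carrier G \<Longrightarrow> k \<in> carrier G \<Longrightarrow>
     \<delta> (g, h) \<otimes>\<^bsub>A\<^esub> \<delta> (g \<otimes> h, k) = \<delta> (h, k) \<otimes>\<^bsub>A\<^esub> \<delta> (g, h \<otimes> k)"
  by (simp add: Z2_iff)

lemma Z2_normalized [simp]:
  "\<delta> \<in> Z2 \<Longrightarrow> g \<in> carrier G \<Longrightarrow> \<delta> (g, \<one>) = \<one>\<^bsub>A\<^esub>"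
  "\<delta> \<in> Z2 \<Longrightarrow> g \<in> carrier G \<Longrightarrow> \<delta> (\<one>, g) = \<one>\<^bsub>A\<^esub>"
  by (simp_all add: Z2_iff)

text \<open>The equation says that the difference of \<delta>' and \<delta> is the coboundary of
  \<epsilon>, rearranged to avoid inverses. Neither function has to be a cocycle or extensional, so
  pullbacks along \<eta> and pushforwards along \<nu> are admissible arguments.\<close>

definition cobounds :: "('a \<Rightarrow> 'c) \<Rightarrow> ('a \<times> 'a \<Rightarrow> 'c) \<Rightarrow> ('a \<times> 'a \<Rightarrow> 'c) \<Rightarrow> bool" where
  "cobounds \<epsilon> \<delta> \<delta>' \<longleftrightarrow> \<epsilon> \<in> carrier G \<rightarrow> carrier A \<and> \<epsilon> \<one> = \<one>\<^bsub>A\<^esub> \<and>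
     (\<forall>g\<in>carrier G. \<forall>h\<in>carrier G. \<delta>' (g, h) \<otimes>\<^bsub>A\<^esub> \<epsilon> (g \<otimes> h) = \<epsilon> g \<otimes>\<^bsub>A\<^esub> \<epsilon> h \<otimes>\<^bsub>A\<^esub> \<delta> (g, h))"

definition cohomologous :: "('a \<times> 'a \<Rightarrow> 'c) \<Rightarrow> ('a \<times> 'a \<Rightarrow> 'c) \<Rightarrow> bool" where
  "cohomologous \<delta> \<delta>' \<longleftrightarrow> (\<exists>\<epsilon>. cobounds \<epsilon> \<delta> \<delta>')"

lemma cobounds_D:
  assumes "cobounds \<epsilon> \<delta> \<delta>'"
  shows "g \<in> carrier G \<Longrightarrow> \<epsilon> g \<in> carrier A" "\<epsilon> \<one> = \<one>\<^bsub>A\<^esub>"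
    "g \<in> carrier G \<Longrightarrow> h \<in> carrier G \<Longrightarrow>
       \<delta>' (g, h) \<otimes>\<^bsub>A\<^esub> \<epsilon> (g \<otimes> h) = \<epsilon> g \<otimes>\<^bsub>A\<^esub> \<epsilon> h \<otimes>\<^bsub>A\<^esub> \<delta> (g, h)"
  using assms by (auto simp: cobounds_def)

lemma cohomologousI:
  assumes "\<And>g. g \<in> carrier G \<Longrightarrow> \<epsilon> g \<in> carrier A" "\<epsilon> \<one> = \<one>\<^bsub>A\<^esub>"
    "\<And>g h. g \<in> carrier G \<Longrightarrow> h \<in> carrier G \<Longrightarrow>
       \<delta>' (g, h) \<otimes>\<^bsub>A\<^esub> \<epsilon> (g \<otimes> h) = \<epsilon> g \<otimes>\<^bsub>A\<^esub> \<epsilon> h \<otimes>\<^bsub>A\<^esub> \<delta> (g, h)"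
  shows "cohomologous \<delta> \<delta>'"
  unfolding cohomologous_def cobounds_def using assms by (intro exI[of _ \<epsilon>]) auto

lemma cohomologous_refl: "\<delta> \<in> Z2 \<Longrightarrow> cohomologous \<delta> \<delta>"
  by (rule cohomologousI[of "\<lambda>_. \<one>\<^bsub>A\<^esub>"]) auto

lemma cohomologous_sym:
  assumes "\<delta> \<in> Z2" "\<delta>' \<in> Z2" "cohomologous \<delta> \<delta>'"
  shows "cohomologous \<delta>' \<delta>"
proof -
  obtain \<epsilon> where "cobounds \<epsilon> \<delta> \<delta>'" using assms(3) by (auto simp: cohomologous_def)
  note \<epsilon> = cobounds_D[OF this]
  show ?thesis
  proof (rule cohomologousI[of "\<lambda>g. inv\<^bsub>A\<^esub> \<epsilon> g"])
    fix g h assume "g \<in> carrier G" "h \<in> carrier G"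
    then show "\<delta> (g, h) \<otimes>\<^bsub>A\<^esub> inv\<^bsub>A\<^esub> \<epsilon> (g \<otimes> h) = inv\<^bsub>A\<^esub> \<epsilon> g \<otimes>\<^bsub>A\<^esub> inv\<^bsub>A\<^esub> \<epsilon> h \<otimes>\<^bsub>A\<^esub> \<delta>' (g, h)"
      using \<epsilon>(3)[of g h] \<epsilon>(1)[of g] \<epsilon>(1)[of h] \<epsilon>(1)[of "g \<otimes> h"] assms(1,2)
        A.div_eq_iff[of "\<delta> (g, h)" "\<epsilon> (g \<otimes> h)" "\<delta>' (g, h)" "\<epsilon> g \<otimes>\<^bsub>A\<^esub> \<epsilon> h"]
      by (simp add: A.m_comm[of "\<delta> (g, h)"] A.inv_mult A.m_comm[of _ "\<delta>' (g, h)"])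
  qed (use \<epsilon> in auto)
qed

lemma cohomologous_trans:
  assumes "\<delta> \<in> Z2" "\<delta>' \<in> Z2" "\<delta>'' \<in> Z2" "cohomologous \<delta> \<delta>'" "cohomologous \<delta>' \<delta>''"
  shows "cohomologous \<delta> \<delta>''"
proof -
  obtain \<epsilon> where "cobounds \<epsilon> \<delta> \<delta>'" using assms(4) by (auto simp: cohomologous_def)
  note \<epsilon> = cobounds_D[OF this]
  obtain \<epsilon>' where "cobounds \<epsilon>' \<delta>' \<delta>''" using assms(5) by (auto simp: cohomologous_def)
  note \<epsilon>' = cobounds_D[OF this]
  show ?thesis
  proof (rule cohomologousI[of "\<lambda>g. \<epsilon>' g \<otimes>\<^bsub>A\<^esub> \<epsilon> g"])
    fix g h assume gh: "g \<in> carrier G" "h \<in> carrier G"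
    note c = gh \<epsilon>(1)[OF gh(1)] \<epsilon>(1)[OF gh(2)] \<epsilon>(1)[OF G.m_closed[OF gh]]
      \<epsilon>'(1)[OF gh(1)] \<epsilon>'(1)[OF gh(2)] \<epsilon>'(1)[OF G.m_closed[OF gh]] assms(1-3)
    have "\<delta>'' (g, h) \<otimes>\<^bsub>A\<^esub> (\<epsilon>' (g \<otimes> h) \<otimes>\<^bsub>A\<^esub> \<epsilon> (g \<otimes> h))
        = \<delta>'' (g, h) \<otimes>\<^bsub>A\<^esub> \<epsilon>' (g \<otimes> h) \<otimes>\<^bsub>A\<^esub> \<epsilon> (g \<otimes> h)"
      using c by (simp add: A.m_assoc)
    also have "\<dots> = \<epsilon>' g \<otimes>\<^bsub>A\<^esub> \<epsilon>' h \<otimes>\<^bsub>A\<^esub> (\<delta>' (g, h) \<otimes>\<^bsub>A\<^esub> \<epsilon> (g \<otimes> h))"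
      using c \<epsilon>'(3)[OF gh] by (simp add: A.m_assoc)
    also have "\<dots> = \<epsilon>' g \<otimes>\<^bsub>A\<^esub> \<epsilon> g \<otimes>\<^bsub>A\<^esub> (\<epsilon>' h \<otimes>\<^bsub>A\<^esub> \<epsilon> h) \<otimes>\<^bsub>A\<^esub> \<delta> (g, h)"
      using c by (simp add: \<epsilon>(3)[OF gh] A.m_ac)
    finally show "\<delta>'' (g, h) \<otimes>\<^bsub>A\<^esub> (\<epsilon>' (g \<otimes> h) \<otimes>\<^bsub>A\<^esub> \<epsilon> (g \<otimes> h))
      = \<epsilon>' g \<otimes>\<^bsub>A\<^esub> \<epsilon> g \<otimes>\<^bsub>A\<^esub> (\<epsilon>' h \<otimes>\<^bsub>A\<^esub> \<epsilon> h) \<otimes>\<^bsub>A\<^esub> \<delta> (g, h)" .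
  qed (use \<epsilon> \<epsilon>' in auto)
qed

text \<open>Coboundaries satisfy the cocycle identity. This guarantees that a coset of
  \<open>B2_set\<close> through a cocycle consists of cocycles.\<close>

lemma Z2_cohomologous:
  assumes \<delta>: "\<delta> \<in> Z2" and \<delta>': "\<delta>' \<in> carrier G \<times> carrier G \<rightarrow>\<^sub>E carrier A"
    and "cohomologous \<delta> \<delta>'"
  shows "\<delta>' \<in> Z2"
proof -
  obtain \<epsilon> where "cobounds \<epsilon> \<delta> \<delta>'" using assms(3) by (auto simp: cohomologous_def)
  note \<epsilon> = cobounds_D[OF this]
  have cl: "\<delta>' (g, h) \<in> carrier A" if "g \<in> carrier G" "h \<in> carrier G" for g h
    using \<delta>' that by (auto simp: PiE_def Pi_def)
  have norm: "\<delta>' (g, \<one>) = \<one>\<^bsub>A\<^esub>" "\<delta>' (\<one>, g) = \<one>\<^bsub>A\<^esub>" if "g \<in> carrier G" for g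
    using \<epsilon>(3)[of g \<one>] \<epsilon>(3)[of \<one> g] that \<delta> \<epsilon>(1,2) cl by auto
  have coc: "\<delta>' (g, h) \<otimes>\<^bsub>A\<^esub> \<delta>' (g \<otimes> h, k) = \<delta>' (h, k) \<otimes>\<^bsub>A\<^esub> \<delta>' (g, h \<otimes> k)"
    if g: "g \<in> carrier G" and h: "h \<in> carrier G" and k: "k \<in> carrier G" for g h k
  proof -
    \<comment> \<open>The common multiplier for the four values of \<delta>' in the cocycle
      identity: the left side needs \<epsilon> at \<open>gh\<close> and \<open>ghk\<close>, the
      right side at \<open>hk\<close> and \<open>ghk\<close>. Multiplying by it allows \<delta>' to
      be traded for \<delta>.\<close>
    let ?e = "\<epsilon> (g \<otimes> h) \<otimes>\<^bsub>A\<^esub> \<epsilon> (h \<otimes> k) \<otimes>\<^bsub>A\<^esub> \<epsilon> (g \<otimes> h \<otimes> k)"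
    note c = g h k G.m_closed[OF g h] G.m_closed[OF h k] G.m_closed[OF G.m_closed[OF g h] k] \<delta>
    have "\<delta>' (g, h) \<otimes>\<^bsub>A\<^esub> \<delta>' (g \<otimes> h, k) \<otimes>\<^bsub>A\<^esub> ?e = \<epsilon> (h \<otimes> k) \<otimes>\<^bsub>A\<^esub>
        ((\<delta>' (g, h) \<otimes>\<^bsub>A\<^esub> \<epsilon> (g \<otimes> h)) \<otimes>\<^bsub>A\<^esub> (\<delta>' (g \<otimes> h, k) \<otimes>\<^bsub>A\<^esub> \<epsilon> (g \<otimes> h \<otimes> k)))"
      using c cl \<epsilon>(1) by (simp add: A.m_ac)
    also have "\<dots> = \<epsilon> g \<otimes>\<^bsub>A\<^esub> \<epsilon> h \<otimes>\<^bsub>A\<^esub> \<epsilon> k \<otimes>\<^bsub>A\<^esub> \<epsilon> (g \<otimes> h) \<otimes>\<^bsub>A\<^esub> \<epsilon> (h \<otimes> k) \<otimes>\<^bsub>A\<^esub>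
        (\<delta> (g, h) \<otimes>\<^bsub>A\<^esub> \<delta> (g \<otimes> h, k))"
      using c \<epsilon>(1) by (simp only: \<epsilon>(3)) (simp add: A.m_ac)
    also have "\<dots> = \<epsilon> (g \<otimes> h) \<otimes>\<^bsub>A\<^esub>
        ((\<epsilon> h \<otimes>\<^bsub>A\<^esub> \<epsilon> k \<otimes>\<^bsub>A\<^esub> \<delta> (h, k)) \<otimes>\<^bsub>A\<^esub> (\<epsilon> g \<otimes>\<^bsub>A\<^esub> \<epsilon> (h \<otimes> k) \<otimes>\<^bsub>A\<^esub> \<delta> (g, h \<otimes> k)))"
      using c \<epsilon>(1) by (simp only: Z2_cocycle[OF \<delta> g h k]) (simp add: A.m_ac)
    also have "\<dots> = \<epsilon> (g \<otimes> h) \<otimes>\<^bsub>A\<^esub> ((\<delta>' (h, k) \<otimes>\<^bsub>A\<^esub> \<epsilon> (h \<otimes> k)) \<otimes>\<^bsub>A\<^esub>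
        (\<delta>' (g, h \<otimes> k) \<otimes>\<^bsub>A\<^esub> \<epsilon> (g \<otimes> h \<otimes> k)))"
      using c by (simp only: \<epsilon>(3) G.m_assoc)
    also have "\<dots> = \<delta>' (h, k) \<otimes>\<^bsub>A\<^esub> \<delta>' (g, h \<otimes> k) \<otimes>\<^bsub>A\<^esub> ?e"
      using c cl \<epsilon>(1) by (simp add: A.m_ac)
    finally show ?thesis using c cl \<epsilon>(1) by simp
  qed
  show ?thesis
    unfolding Z2_iff by (intro conjI ballI cl norm coc) (use \<delta>' in \<open>simp_all add: PiE_def\<close>)
qed

text \<open>Replaces cosets by an equivalence relation with explicit witnesses \<epsilon>; all later
  reasoning about classes goes through this form.\<close>

lemma mem_H2_class:
  assumes \<delta>: "\<delta> \<in> Z2"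
  shows "\<delta>' \<in> H2_class G A \<delta> \<longleftrightarrow> \<delta>' \<in> Z2 \<and> cohomologous \<delta> \<delta>'"
proof
  assume "\<delta>' \<in> H2_class G A \<delta>"
  then obtain \<epsilon> where \<epsilon>: "\<epsilon> \<in> carrier G \<rightarrow> carrier A" "\<epsilon> \<one> = \<one>\<^bsub>A\<^esub>"
    and eq: "\<delta>' = (\<lambda>x\<in>carrier G \<times> carrier G.
      (\<lambda>(g, h)\<in>carrier G \<times> carrier G. \<epsilon> g \<otimes>\<^bsub>A\<^esub> \<epsilon> h \<otimes>\<^bsub>A\<^esub> inv\<^bsub>A\<^esub> \<epsilon> (g \<otimes> h)) x \<otimes>\<^bsub>A\<^esub> \<delta> x)"
    unfolding H2_class_def r_coset_def B2_set_def Z2_mult by blast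
  have ec: "\<epsilon> g \<in> carrier A" if "g \<in> carrier G" for g using \<epsilon>(1) that by blast
  have val: "\<delta>' (g, h) = \<epsilon> g \<otimes>\<^bsub>A\<^esub> \<epsilon> h \<otimes>\<^bsub>A\<^esub> inv\<^bsub>A\<^esub> \<epsilon> (g \<otimes> h) \<otimes>\<^bsub>A\<^esub> \<delta> (g, h)"
    if "g \<in> carrier G" "h \<in> carrier G" for g h
    using that by (simp add: eq)
  have coh: "cohomologous \<delta> \<delta>'"
  proof (rule cohomologousI[of \<epsilon>])
    fix g h assume gh: "g \<in> carrier G" "h \<in> carrier G"
    have "\<delta>' (g, h) \<otimes>\<^bsub>A\<^esub> \<epsilon> (g \<otimes> h)
        = \<epsilon> g \<otimes>\<^bsub>A\<^esub> \<epsilon> h \<otimes>\<^bsub>A\<^esub> \<delta> (g, h) \<otimes>\<^bsub>A\<^esub> (inv\<^bsub>A\<^esub> \<epsilon> (g \<otimes> h) \<otimes>\<^bsub>A\<^esub> \<epsilon> (g \<otimes> h))"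
      using gh \<delta> ec by (simp add: val A.m_ac)
    then show "\<delta>' (g, h) \<otimes>\<^bsub>A\<^esub> \<epsilon> (g \<otimes> h) = \<epsilon> g \<otimes>\<^bsub>A\<^esub> \<epsilon> h \<otimes>\<^bsub>A\<^esub> \<delta> (g, h)"
      using gh \<delta> ec by simp
  qed (use \<epsilon> ec in auto)
  moreover have "\<delta>' \<in> carrier G \<times> carrier G \<rightarrow>\<^sub>E carrier A"
    using ec \<delta> by (auto simp: PiE_def val) (auto simp: eq)
  ultimately show "\<delta>' \<in> Z2 \<and> cohomologous \<delta> \<delta>'" using Z2_cohomologous[OF \<delta>] by blast
next
  assume r: "\<delta>' \<in> Z2 \<and> cohomologous \<delta> \<delta>'"
  then have "cohomologous \<delta> \<delta>'" ..
  then obtain \<epsilon> where "cobounds \<epsilon> \<delta> \<delta>'" by (auto simp: cohomologous_def)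
  note \<epsilon> = cobounds_D[OF this]
  let ?\<beta> = "\<lambda>(g, h)\<in>carrier G \<times> carrier G. \<epsilon> g \<otimes>\<^bsub>A\<^esub> \<epsilon> h \<otimes>\<^bsub>A\<^esub> inv\<^bsub>A\<^esub> \<epsilon> (g \<otimes> h)"
  have "?\<beta> \<in> B2_set G A" using \<epsilon>(1,2) unfolding B2_set_def by blast
  moreover have "\<delta>' = ?\<beta> \<otimes>\<^bsub>Z2_group G A\<^esub> \<delta>"
  proof
    fix x
    show "\<delta>' x = (?\<beta> \<otimes>\<^bsub>Z2_group G A\<^esub> \<delta>) x"
    proof (cases "x \<in> carrier G \<times> carrier G")
      case True
      then obtain g h where x: "x = (g, h)" "g \<in> carrier G" "h \<in> carrier G" by blast
      have "\<delta>' (g, h) = \<delta>' (g, h) \<otimes>\<^bsub>A\<^esub> \<epsilon> (g \<otimes> h) \<otimes>\<^bsub>A\<^esub> inv\<^bsub>A\<^esub> \<epsilon> (g \<otimes> h)"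
        using x r \<epsilon>(1) by (simp add: A.m_assoc)
      also have "\<dots> = \<epsilon> g \<otimes>\<^bsub>A\<^esub> \<epsilon> h \<otimes>\<^bsub>A\<^esub> inv\<^bsub>A\<^esub> \<epsilon> (g \<otimes> h) \<otimes>\<^bsub>A\<^esub> \<delta> (g, h)"
        unfolding \<epsilon>(3)[OF x(2,3)] using x(2,3) \<delta>
          \<epsilon>(1)[OF x(2)] \<epsilon>(1)[OF x(3)] \<epsilon>(1)[OF G.m_closed[OF x(2,3)]]
        by (simp add: A.m_assoc A.m_comm[of "\<delta> (g, h)"])
      finally have "\<delta>' (g, h) = \<epsilon> g \<otimes>\<^bsub>A\<^esub> \<epsilon> h \<otimes>\<^bsub>A\<^esub> inv\<^bsub>A\<^esub> \<epsilon> (g \<otimes> h) \<otimes>\<^bsub>A\<^esub> \<delta> (g, h)" .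
      then show ?thesis unfolding x(1) Z2_mult using x(2,3) by simp
    next
      case False
      then have "\<delta>' x = undefined" using r Z2_undefined by blast
      then show ?thesis using False by (auto simp: Z2_mult)
    qed
  qed
  ultimately show "\<delta>' \<in> H2_class G A \<delta>"
    unfolding H2_class_def r_coset_def by blast
qed

lemma H2_class_eq_iff:
  assumes "\<delta> \<in> Z2" "\<delta>' \<in> Z2"
  shows "H2_class G A \<delta> = H2_class G A \<delta>' \<longleftrightarrow> cohomologous \<delta> \<delta>'"
proof
  assume "H2_class G A \<delta> = H2_class G A \<delta>'"
  then show "cohomologous \<delta> \<delta>'"
    using mem_H2_class assms cohomologous_refl by blast
next
  assume *: "cohomologous \<delta> \<delta>'"
  have "cohomologous \<delta> \<delta>'' \<longleftrightarrow> cohomologous \<delta>' \<delta>''" if "\<delta>'' \<in> Z2" for \<delta>''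
    using cohomologous_trans[of \<delta> \<delta>' \<delta>''] cohomologous_trans[of \<delta>' \<delta> \<delta>''] * that assms
      cohomologous_sym[of \<delta> \<delta>'] by blast
  then show "H2_class G A \<delta> = H2_class G A \<delta>'"
    using assms by (auto simp: mem_H2_class)
qed

lemma H2_carrier: "carrier (H2_group G A) = H2_class G A ` Z2"
  by (auto simp: H2_group_def FactGroup_def RCOSETS_def H2_class_def)

lemma H2_mem_eq_class:
  assumes "\<gamma> \<in> carrier (H2_group G A)" "\<delta> \<in> \<gamma>"
  shows "\<delta> \<in> Z2 \<and> \<gamma> = H2_class G A \<delta>"
proof -
  obtain \<delta>0 where "\<delta>0 \<in> Z2" "\<gamma> = H2_class G A \<delta>0" using assms(1) H2_carrier by blast
  then show ?thesis using assms(2) mem_H2_class H2_class_eq_iff by blast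
qed

lemma H2_class_self: "\<delta> \<in> Z2 \<Longrightarrow> \<delta> \<in> H2_class G A \<delta>"
  by (simp add: mem_H2_class cohomologous_refl)

section \<open>The group structure defined by a cocycle\<close>

lemma cocycle_extension_simps [simp]:
  "carrier (cocycle_extension G A \<delta>) = carrier G \<times> carrier A"
  "(g, a) \<otimes>\<^bsub>cocycle_extension G A \<delta>\<^esub> (h, b) = (g \<otimes> h, a \<otimes>\<^bsub>A\<^esub> b \<otimes>\<^bsub>A\<^esub> \<delta> (g, h))"
  "\<one>\<^bsub>cocycle_extension G A \<delta>\<^esub> = (\<one>, \<one>\<^bsub>A\<^esub>)"
  by (simp_all add: cocycle_extension_def)

text \<open>Associativity in the second coordinate is the cocycle identity, and the unit law is
  normalization.\<close>

lemma cocycle_extension_group: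
  assumes \<delta>: "\<delta> \<in> Z2"
  shows "group (cocycle_extension G A \<delta>)"
proof (rule groupI)
  fix x y z
  assume "x \<in> carrier (cocycle_extension G A \<delta>)" "y \<in> carrier (cocycle_extension G A \<delta>)"
    "z \<in> carrier (cocycle_extension G A \<delta>)"
  then obtain g a h b k c where xyz: "x = (g, a)" "y = (h, b)" "z = (k, c)"
    and in_G: "g \<in> carrier G" "h \<in> carrier G" "k \<in> carrier G"
    and in_A: "a \<in> carrier A" "b \<in> carrier A" "c \<in> carrier A" by auto
  have "a \<otimes>\<^bsub>A\<^esub> b \<otimes>\<^bsub>A\<^esub> \<delta> (g, h) \<otimes>\<^bsub>A\<^esub> c \<otimes>\<^bsub>A\<^esub> \<delta> (g \<otimes> h, k)
      = a \<otimes>\<^bsub>A\<^esub> b \<otimes>\<^bsub>A\<^esub> c \<otimes>\<^bsub>A\<^esub> (\<delta> (g, h) \<otimes>\<^bsub>A\<^esub> \<delta> (g \<otimes> h, k))"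
    using in_G in_A \<delta> by (simp add: A.m_ac)
  also have "\<dots> = a \<otimes>\<^bsub>A\<^esub> (b \<otimes>\<^bsub>A\<^esub> c \<otimes>\<^bsub>A\<^esub> \<delta> (h, k)) \<otimes>\<^bsub>A\<^esub> \<delta> (g, h \<otimes> k)"
    using in_G in_A \<delta> by (simp add: Z2_cocycle) (simp add: A.m_ac)
  finally show "x \<otimes>\<^bsub>cocycle_extension G A \<delta>\<^esub> y \<otimes>\<^bsub>cocycle_extension G A \<delta>\<^esub> z
      = x \<otimes>\<^bsub>cocycle_extension G A \<delta>\<^esub> (y \<otimes>\<^bsub>cocycle_extension G A \<delta>\<^esub> z)"
    using in_G by (simp add: xyz G.m_assoc)
next
  fix x assume "x \<in> carrier (cocycle_extension G A \<delta>)"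
  then obtain g a where x: "x = (g, a)" "g \<in> carrier G" "a \<in> carrier A" by auto
  \<comment> \<open>The second coordinate \<open>y\<close> of a left inverse must satisfy
    \<open>y + a + \<delta>(inv g, g) = 0\<close> in additive notation.\<close>
  let ?y = "(inv g, inv\<^bsub>A\<^esub> (a \<otimes>\<^bsub>A\<^esub> \<delta> (inv g, g)))"
  have "?y \<otimes>\<^bsub>cocycle_extension G A \<delta>\<^esub> x = \<one>\<^bsub>cocycle_extension G A \<delta>\<^esub>"
    using x \<delta> by (simp add: A.m_assoc)
  moreover have "?y \<in> carrier (cocycle_extension G A \<delta>)" using x \<delta> by simp
  ultimately show "\<exists>y\<in>carrier (cocycle_extension G A \<delta>).
      y \<otimes>\<^bsub>cocycle_extension G A \<delta>\<^esub> x = \<one>\<^bsub>cocycle_extension G A \<delta>\<^esub>" by blast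
qed (use \<delta> in auto)

end

section \<open>Commutators and lower central series extensions\<close>

context trivial_module
begin

section \<open>The copy of \<open>A\<close> as a central subgroup\<close>

lemma kernel_embedding_mon:
  assumes "\<delta> \<in> Z2"
  shows "kernel_embedding G \<in> mon A (cocycle_extension G A \<delta>)"
  using assms by (auto simp: mon_def hom_def kernel_embedding_def inj_on_def)

lemma fst_epi: "fst \<in> epi (cocycle_extension G A \<delta>) G"
  using A.one_closed by (auto simp: epi_def hom_def simp del: A.one_closed)

lemma kernel_fst:
  "kernel (cocycle_extension G A \<delta>) G fst = kernel_embedding G ` carrier A"
  by (auto simp: kernel_def kernel_embedding_def)

lemma kernel_embedding_commute:
  assumes "\<delta> \<in> Z2" "a \<in> carrier A" "x \<in> carrier (cocycle_extension G A \<delta>)"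
  shows "x \<otimes>\<^bsub>cocycle_extension G A \<delta>\<^esub> kernel_embedding G a
    = kernel_embedding G a \<otimes>\<^bsub>cocycle_extension G A \<delta>\<^esub> x"
proof -
  obtain g b where "x = (g, b)" "g \<in> carrier G" "b \<in> carrier A" using assms(3) by auto
  then show ?thesis using assms(1,2) by (simp add: kernel_embedding_def A.m_comm)
qed

lemma cocycle_extension_of:
  assumes "\<delta> \<in> Z2"
  shows "extension_of A G (cocycle_extension G A \<delta>) (kernel_embedding G) fst"
proof -
  let ?E = "cocycle_extension G A \<delta>"
  interpret E: group ?E by (rule cocycle_extension_group[OF assms])
  have "inv\<^bsub>?E\<^esub> e \<otimes>\<^bsub>?E\<^esub> kernel_embedding G a \<otimes>\<^bsub>?E\<^esub> e = kernel_embedding G a"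
    if a: "a \<in> carrier A" and e: "e \<in> carrier ?E" for a e
  proof -
    have k: "kernel_embedding G a \<in> carrier ?E" using a by (simp add: kernel_embedding_def)
    have "inv\<^bsub>?E\<^esub> e \<otimes>\<^bsub>?E\<^esub> kernel_embedding G a \<otimes>\<^bsub>?E\<^esub> e = inv\<^bsub>?E\<^esub> e \<otimes>\<^bsub>?E\<^esub> (e \<otimes>\<^bsub>?E\<^esub> kernel_embedding G a)"
      using k e kernel_embedding_commute[OF assms a e] by (simp only: E.m_assoc E.inv_closed)
    also have "\<dots> = kernel_embedding G a"
      using k e E.inv_solve_left[of "kernel_embedding G a" e "e \<otimes>\<^bsub>?E\<^esub> kernel_embedding G a"]
        E.m_closed by metis
    finally show ?thesis .
  qed
  then show ?thesis
    unfolding extension_of_def short_exact_def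
    using kernel_embedding_mon[OF assms] fst_epi kernel_fst[of \<delta>]
      A.is_group G.is_group E.is_group by blast
qed

text \<open>The two correction terms are values of \<delta> at the same pair once
  \<open>gh = hg\<close>, so they cancel.\<close>

lemma cocycle_hat_commute:
  assumes "\<delta> \<in> Z2" "g \<in> carrier G" "h \<in> carrier G" "g \<otimes> h = h \<otimes> g"
  shows "cocycle_hat G A \<delta> g h = \<delta> (g, h) \<otimes>\<^bsub>A\<^esub> inv\<^bsub>A\<^esub> \<delta> (h, g)"
  using assms by (simp add: cocycle_hat_def A.m_assoc)

lemma cocycle_hat_closed:
  assumes "\<delta> \<in> Z2" "g \<in> carrier G" "h \<in> carrier G"
  shows "cocycle_hat G A \<delta> g h \<in> carrier A"
  using assms by (simp add: cocycle_hat_def)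

text \<open>For commuting arguments the contribution of \<epsilon> is symmetric in \<open>g\<close>
  and \<open>h\<close>, so antisymmetrizing removes it. Hence the values depend only on the
  cohomology class.\<close>

lemma cocycle_hat_cohomologous:
  assumes "\<delta> \<in> Z2" "\<delta>' \<in> Z2" "cohomologous \<delta> \<delta>'"
    and gh: "g \<in> carrier G" "h \<in> carrier G" "g \<otimes> h = h \<otimes> g"
  shows "cocycle_hat G A \<delta>' g h = cocycle_hat G A \<delta> g h"
proof -
  obtain \<epsilon> where "cobounds \<epsilon> \<delta> \<delta>'" using assms(3) by (auto simp: cohomologous_def)
  note \<epsilon> = cobounds_D[OF this]
  note c = \<epsilon>(1)[OF gh(1)] \<epsilon>(1)[OF gh(2)] \<epsilon>(1)[OF G.m_closed[OF gh(2,1)]] gh(1,2) assms(1,2)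
  let ?e = "\<epsilon> g \<otimes>\<^bsub>A\<^esub> \<epsilon> h"
  have "\<delta>' (g, h) \<otimes>\<^bsub>A\<^esub> \<delta> (h, g) \<otimes>\<^bsub>A\<^esub> (?e \<otimes>\<^bsub>A\<^esub> \<epsilon> (h \<otimes> g))
      = (\<delta>' (g, h) \<otimes>\<^bsub>A\<^esub> \<epsilon> (g \<otimes> h)) \<otimes>\<^bsub>A\<^esub> (\<epsilon> h \<otimes>\<^bsub>A\<^esub> \<epsilon> g \<otimes>\<^bsub>A\<^esub> \<delta> (h, g))"
    using c by (simp add: gh(3) A.m_ac)
  also have "\<dots> = (\<epsilon> g \<otimes>\<^bsub>A\<^esub> \<epsilon> h \<otimes>\<^bsub>A\<^esub> \<delta> (g, h)) \<otimes>\<^bsub>A\<^esub> (\<delta>' (h, g) \<otimes>\<^bsub>A\<^esub> \<epsilon> (h \<otimes> g))"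
    unfolding \<epsilon>(3)[OF gh(1,2)] \<epsilon>(3)[OF gh(2,1)] ..
  also have "\<dots> = \<delta> (g, h) \<otimes>\<^bsub>A\<^esub> \<delta>' (h, g) \<otimes>\<^bsub>A\<^esub> (?e \<otimes>\<^bsub>A\<^esub> \<epsilon> (h \<otimes> g))"
    using c by (simp add: A.m_ac)
  finally have "\<delta>' (g, h) \<otimes>\<^bsub>A\<^esub> \<delta> (h, g) = \<delta> (g, h) \<otimes>\<^bsub>A\<^esub> \<delta>' (h, g)"
    using c by simp
  then show ?thesis
    using c gh(3) by (simp add: cocycle_hat_commute A.div_eq_iff)
qed

lemma cocycle_hat_mult_left:
  assumes \<delta>: "\<delta> \<in> Z2" and g: "g \<in> carrier G" and g': "g' \<in> carrier G" and h: "h \<in> carrier G"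
    and gh: "g \<otimes> h = h \<otimes> g" and gh': "g' \<otimes> h = h \<otimes> g'"
  shows "cocycle_hat G A \<delta> (g \<otimes> g') h = cocycle_hat G A \<delta> g' h \<otimes>\<^bsub>A\<^esub> cocycle_hat G A \<delta> g h"
proof -
  have comm: "g \<otimes> g' \<otimes> h = h \<otimes> (g \<otimes> g')"
    using g g' h gh gh' by (metis G.m_assoc)
  let ?P = "\<delta> (g \<otimes> g', h)" and ?Q = "\<delta> (h, g \<otimes> g')" and ?R = "\<delta> (g, g')"
    and ?S = "\<delta> (g, h \<otimes> g')" and ?T = "\<delta> (g', h)" and ?U = "\<delta> (h, g)"
    and ?V = "\<delta> (h \<otimes> g, g')" and ?W = "\<delta> (g, h)" and ?X = "\<delta> (h, g')"
  have c: "?P \<in> carrier A" "?Q \<in> carrier A" "?R \<in> carrier A" "?S \<in> carrier A" "?T \<in> carrier A"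
    "?U \<in> carrier A" "?V \<in> carrier A" "?W \<in> carrier A" "?X \<in> carrier A"
    using \<delta> g g' h by auto
  \<comment> \<open>The cocycle identity at the triples \<open>(g, g', h)\<close>,
    \<open>(h, g, g')\<close> and \<open>(g, h, g')\<close>, that is, with \<open>h\<close> in each
    of the three positions. In their combination the factors \<open>?R\<close>, \<open>?V\<close>
    and \<open>?S\<close> cancel.\<close>
  have 1: "?R \<otimes>\<^bsub>A\<^esub> ?P = ?T \<otimes>\<^bsub>A\<^esub> ?S" using Z2_cocycle[OF \<delta> g g' h] by (simp add: gh')
  have 2: "?U \<otimes>\<^bsub>A\<^esub> ?V = ?R \<otimes>\<^bsub>A\<^esub> ?Q" using Z2_cocycle[OF \<delta> h g g'] .
  have 3: "?W \<otimes>\<^bsub>A\<^esub> ?V = ?X \<otimes>\<^bsub>A\<^esub> ?S" using Z2_cocycle[OF \<delta> g h g'] by (simp add: gh)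
  have "?P \<otimes>\<^bsub>A\<^esub> (?X \<otimes>\<^bsub>A\<^esub> ?U) \<otimes>\<^bsub>A\<^esub> (?R \<otimes>\<^bsub>A\<^esub> ?V \<otimes>\<^bsub>A\<^esub> ?S)
      = (?R \<otimes>\<^bsub>A\<^esub> ?P) \<otimes>\<^bsub>A\<^esub> (?U \<otimes>\<^bsub>A\<^esub> ?V) \<otimes>\<^bsub>A\<^esub> (?X \<otimes>\<^bsub>A\<^esub> ?S)"
    using c by (simp add: A.m_ac)
  also have "\<dots> = (?T \<otimes>\<^bsub>A\<^esub> ?S) \<otimes>\<^bsub>A\<^esub> (?R \<otimes>\<^bsub>A\<^esub> ?Q) \<otimes>\<^bsub>A\<^esub> (?W \<otimes>\<^bsub>A\<^esub> ?V)"
    by (simp only: 1 2 3)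
  also have "\<dots> = (?T \<otimes>\<^bsub>A\<^esub> ?W) \<otimes>\<^bsub>A\<^esub> ?Q \<otimes>\<^bsub>A\<^esub> (?R \<otimes>\<^bsub>A\<^esub> ?V \<otimes>\<^bsub>A\<^esub> ?S)"
    using c by (simp add: A.m_ac)
  finally have key: "?P \<otimes>\<^bsub>A\<^esub> (?X \<otimes>\<^bsub>A\<^esub> ?U) = (?T \<otimes>\<^bsub>A\<^esub> ?W) \<otimes>\<^bsub>A\<^esub> ?Q"
    using c by (subst (asm) A.right_cancel) auto
  then have "?P \<otimes>\<^bsub>A\<^esub> inv\<^bsub>A\<^esub> ?Q = ?T \<otimes>\<^bsub>A\<^esub> ?W \<otimes>\<^bsub>A\<^esub> inv\<^bsub>A\<^esub> (?X \<otimes>\<^bsub>A\<^esub> ?U)"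
    using c by (simp only: A.div_eq_iff A.m_closed)
  also have "\<dots> = (?T \<otimes>\<^bsub>A\<^esub> inv\<^bsub>A\<^esub> ?X) \<otimes>\<^bsub>A\<^esub> (?W \<otimes>\<^bsub>A\<^esub> inv\<^bsub>A\<^esub> ?U)"
    using c by (simp add: A.inv_mult A.m_ac)
  finally show ?thesis
    using cocycle_hat_commute[OF \<delta> G.m_closed[OF g g'] h comm] cocycle_hat_commute[OF \<delta> g h gh]
      cocycle_hat_commute[OF \<delta> g' h gh'] by simp
qed

lemma cocycle_hat_swap:
  assumes "\<delta> \<in> Z2" "g \<in> carrier G" "h \<in> carrier G" "g \<otimes> h = h \<otimes> g"
  shows "cocycle_hat G A \<delta> g h = inv\<^bsub>A\<^esub> cocycle_hat G A \<delta> h g"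
  using assms cocycle_hat_commute[OF assms] cocycle_hat_commute[OF assms(1,3,2) assms(4)[symmetric]]
  by (simp add: A.inv_mult_group)

text \<open>Follows from the left version by antisymmetry of the pairing.\<close>

lemma cocycle_hat_mult_right:
  assumes \<delta>: "\<delta> \<in> Z2" and g: "g \<in> carrier G" and h: "h \<in> carrier G" and h': "h' \<in> carrier G"
    and gh: "g \<otimes> h = h \<otimes> g" and gh': "g \<otimes> h' = h' \<otimes> g"
  shows "cocycle_hat G A \<delta> g (h \<otimes> h') = cocycle_hat G A \<delta> g h \<otimes>\<^bsub>A\<^esub> cocycle_hat G A \<delta> g h'"
proof -
  have "g \<otimes> (h \<otimes> h') = h \<otimes> h' \<otimes> g" using g h h' gh gh' by (metis G.m_assoc)
  then have "cocycle_hat G A \<delta> g (h \<otimes> h') = inv\<^bsub>A\<^esub> cocycle_hat G A \<delta> (h \<otimes> h') g"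
    using cocycle_hat_swap[OF \<delta> g G.m_closed[OF h h']] by simp
  also have "\<dots> = inv\<^bsub>A\<^esub> cocycle_hat G A \<delta> h g \<otimes>\<^bsub>A\<^esub> inv\<^bsub>A\<^esub> cocycle_hat G A \<delta> h' g"
    using cocycle_hat_mult_left[OF \<delta> h h' g gh[symmetric] gh'[symmetric]]
    by (simp add: A.inv_mult_group cocycle_hat_closed \<delta> g h h')
  finally show ?thesis
    by (simp add: cocycle_hat_swap[OF \<delta> g h gh] cocycle_hat_swap[OF \<delta> g h' gh'])
qed

text \<open>Writing \<open>x\<close>, \<open>y\<close> for the two elements and \<open>z\<close> for
  the claimed value, the proof verifies \<open>z (y x) = x y\<close>, which needs no inverses in the
  extension. The value is independent of \<open>a\<close> and \<open>b\<close>, so commutators are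
  determined by the projections to \<open>G\<close>.\<close>

lemma commutator_cocycle_extension:
  fixes \<delta>
  defines "E \<equiv> cocycle_extension G A \<delta>"
  assumes \<delta>: "\<delta> \<in> Z2" and g: "g \<in> carrier G" and h: "h \<in> carrier G" and gh: "g \<otimes> h = h \<otimes> g"
    and a: "a \<in> carrier A" and b: "b \<in> carrier A"
  shows "(g, a) \<otimes>\<^bsub>E\<^esub> (h, b) \<otimes>\<^bsub>E\<^esub> inv\<^bsub>E\<^esub> (g, a) \<otimes>\<^bsub>E\<^esub> inv\<^bsub>E\<^esub> (h, b) = kernel_embedding G (cocycle_hat G A \<delta> g h)"
proof -
  interpret E: group E unfolding E_def by (rule cocycle_extension_group[OF \<delta>])
  let ?z = "kernel_embedding G (cocycle_hat G A \<delta> g h)"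
  have cl: "?z \<in> carrier E" "(g, a) \<in> carrier E" "(h, b) \<in> carrier E"
    using g h a b cocycle_hat_closed[OF \<delta> g h] by (simp_all add: E_def kernel_embedding_def)
  have "b \<otimes>\<^bsub>A\<^esub> a \<otimes>\<^bsub>A\<^esub> \<delta> (h, g) \<otimes>\<^bsub>A\<^esub> (\<delta> (g, h) \<otimes>\<^bsub>A\<^esub> inv\<^bsub>A\<^esub> \<delta> (h, g)) = a \<otimes>\<^bsub>A\<^esub> b \<otimes>\<^bsub>A\<^esub> \<delta> (g, h)"
  proof -
    have "b \<otimes>\<^bsub>A\<^esub> a \<otimes>\<^bsub>A\<^esub> \<delta> (h, g) \<otimes>\<^bsub>A\<^esub> (\<delta> (g, h) \<otimes>\<^bsub>A\<^esub> inv\<^bsub>A\<^esub> \<delta> (h, g))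
      = a \<otimes>\<^bsub>A\<^esub> b \<otimes>\<^bsub>A\<^esub> \<delta> (g, h) \<otimes>\<^bsub>A\<^esub> (\<delta> (h, g) \<otimes>\<^bsub>A\<^esub> inv\<^bsub>A\<^esub> \<delta> (h, g))"
      using a b \<delta> g h by (simp add: A.m_ac)
    then show ?thesis using a b \<delta> g h by simp
  qed
  then have "?z \<otimes>\<^bsub>E\<^esub> ((h, b) \<otimes>\<^bsub>E\<^esub> (g, a)) = (g, a) \<otimes>\<^bsub>E\<^esub> (h, b)"
    unfolding E_def using \<delta> g h a b
    by (simp add: kernel_embedding_def cocycle_hat_commute[OF \<delta> g h gh] gh A.m_comm)
  then have "(g, a) \<otimes>\<^bsub>E\<^esub> (h, b) \<otimes>\<^bsub>E\<^esub> inv\<^bsub>E\<^esub> ((h, b) \<otimes>\<^bsub>E\<^esub> (g, a)) = ?z"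
    using cl by (metis E.inv_solve_right E.m_closed)
  then show ?thesis
    using cl by (simp add: E.inv_mult_group E.m_assoc)
qed

end

section \<open>The criterion for lower central series extensions\<close>

locale nilpotent_module = trivial_module +
  fixes n :: nat
  assumes lower_central_nontrivial: "lower_central G n \<noteq> {\<one>}"
    and lower_central_trivial: "lower_central G (Suc n) = {\<one>}"
    and A_nontrivial: "carrier A \<noteq> {\<one>\<^bsub>A\<^esub>}"
begin

abbreviation "L \<equiv> last_lower_central G"

lemma L_eq: "L = lower_central G n"
  by (rule last_lower_central_eq[OF G.is_group lower_central_nontrivial lower_central_trivial])

lemma L_carrier: "h \<in> L \<Longrightarrow> h \<in> carrier G"
  using lower_central_in_carrier[OF G.is_group, of n] L_eq by blast

lemma L_commute: "g \<in> carrier G \<Longrightarrow> h \<in> L \<Longrightarrow> g \<otimes> h = h \<otimes> g"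
  using lower_central_last_commute[OF G.is_group lower_central_trivial] L_eq by blast

lemma L_subgroup: "subgroup L G"
  using lower_central_subgroup[OF G.is_group] L_eq by simp

text \<open>The subgroup generated by these values is the common meeting point: it is the image of
  \<open>kappa_bar\<close>, and its copy is the term of index \<open>Suc n\<close> of the
  extension.\<close>

definition hats :: "('a \<times> 'a \<Rightarrow> 'c) \<Rightarrow> 'c set" where
  "hats \<delta> = (\<lambda>(g, h). cocycle_hat G A \<delta> g h) ` (carrier G \<times> L)"

lemma hats_closed: "\<delta> \<in> Z2 \<Longrightarrow> hats \<delta> \<subseteq> carrier A"
  using cocycle_hat_closed L_carrier by (auto simp: hats_def)

text \<open>Term \<open>n\<close> of the extension need not be known exactly: it projects onto
  \<open>L\<close>, and its commutators with arbitrary elements see only that projection.\<close>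

lemma lower_central_extension:
  assumes \<delta>: "\<delta> \<in> Z2"
  shows "lower_central (cocycle_extension G A \<delta>) (Suc n) = kernel_embedding G ` generate A (hats \<delta>)"
proof -
  let ?E = "cocycle_extension G A \<delta>"
  interpret E: group ?E by (rule cocycle_extension_group[OF \<delta>])
  interpret k: group_hom A ?E "kernel_embedding G"
    using kernel_embedding_mon[OF \<delta>] by unfold_locales (simp add: mon_def)
  have fst_img: "fst ` lower_central ?E n = L"
    unfolding L_eq by (rule lower_central_image[OF E.is_group G.is_group fst_epi])
  have sub: "lower_central ?E n \<subseteq> carrier G \<times> carrier A"
    using lower_central_in_carrier[OF E.is_group, of n] by simp
  have "{x \<otimes>\<^bsub>?E\<^esub> y \<otimes>\<^bsub>?E\<^esub> inv\<^bsub>?E\<^esub> x \<otimes>\<^bsub>?E\<^esub> inv\<^bsub>?E\<^esub> y | x y. x \<in> carrier ?E \<and> y \<in> lower_central ?E n}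
      = kernel_embedding G ` hats \<delta>"
  proof (intro equalityI subsetI)
    fix z assume "z \<in> {x \<otimes>\<^bsub>?E\<^esub> y \<otimes>\<^bsub>?E\<^esub> inv\<^bsub>?E\<^esub> x \<otimes>\<^bsub>?E\<^esub> inv\<^bsub>?E\<^esub> y | x y.
        x \<in> carrier ?E \<and> y \<in> lower_central ?E n}"
    then obtain g a h b where z: "z = (g, a) \<otimes>\<^bsub>?E\<^esub> (h, b) \<otimes>\<^bsub>?E\<^esub> inv\<^bsub>?E\<^esub> (g, a) \<otimes>\<^bsub>?E\<^esub> inv\<^bsub>?E\<^esub> (h, b)"
      "(g, a) \<in> carrier ?E" "(h, b) \<in> lower_central ?E n" by auto
    have h: "h \<in> L" "b \<in> carrier A" using z(3) fst_img sub by force+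
    have "z = kernel_embedding G (cocycle_hat G A \<delta> g h)"
      unfolding z(1) using z(2) h L_commute L_carrier
      by (intro commutator_cocycle_extension[OF \<delta>]) auto
    then show "z \<in> kernel_embedding G ` hats \<delta>" using z(2) h by (auto simp: hats_def)
  next
    fix z assume "z \<in> kernel_embedding G ` hats \<delta>"
    then obtain g h where gh: "g \<in> carrier G" "h \<in> L" "z = kernel_embedding G (cocycle_hat G A \<delta> g h)"
      by (auto simp: hats_def)
    \<comment> \<open>Some lift of \<open>h\<close> lies in term \<open>n\<close>; which
      \<open>b\<close> occurs does not affect the commutator.\<close>
    then obtain b where b: "(h, b) \<in> lower_central ?E n" using fst_img by force
    then have "b \<in> carrier A" using sub by blast
    then have "z = (g, \<one>\<^bsub>A\<^esub>) \<otimes>\<^bsub>?E\<^esub> (h, b) \<otimes>\<^bsub>?E\<^esub> inv\<^bsub>?E\<^esub> (g, \<one>\<^bsub>A\<^esub>) \<otimes>\<^bsub>?E\<^esub> inv\<^bsub>?E\<^esub> (h, b)"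
      using commutator_cocycle_extension[OF \<delta> gh(1) L_carrier[OF gh(2)] L_commute[OF gh(1,2)], of "\<one>\<^bsub>A\<^esub>" b]
        gh(3) by simp
    moreover have "(g, \<one>\<^bsub>A\<^esub>) \<in> carrier ?E" using gh by simp
    ultimately show "z \<in> {x \<otimes>\<^bsub>?E\<^esub> y \<otimes>\<^bsub>?E\<^esub> inv\<^bsub>?E\<^esub> x \<otimes>\<^bsub>?E\<^esub> inv\<^bsub>?E\<^esub> y | x y.
        x \<in> carrier ?E \<and> y \<in> lower_central ?E n}" using b by blast
  qed
  then show ?thesis
    unfolding lower_central.simps commutator_subgroup_def
    using k.generate_img[OF hats_closed[OF \<delta>]] by simp
qed

lemma lcs_extension_iff_generate:
  assumes \<delta>: "\<delta> \<in> Z2"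
  shows "lcs_extension_of A G (cocycle_extension G A \<delta>) (kernel_embedding G) fst
    \<longleftrightarrow> generate A (hats \<delta>) = carrier A"
proof -
  let ?E = "cocycle_extension G A \<delta>" and ?k = "kernel_embedding G"
  interpret E: group ?E by (rule cocycle_extension_group[OF \<delta>])
  have inj: "inj (kernel_embedding G :: 'c \<Rightarrow> 'a \<times> 'c)" by (auto simp: inj_def kernel_embedding_def)
  have one: "?k \<one>\<^bsub>A\<^esub> = \<one>\<^bsub>?E\<^esub>" by (simp add: kernel_embedding_def)
  have ntriv: "?k ` carrier A \<noteq> {\<one>\<^bsub>?E\<^esub>}"
    using A_nontrivial inj_image_eq_iff[OF inj, of "carrier A" "{\<one>\<^bsub>A\<^esub>}"] one by simp
  show ?thesis
  proof
    assume "lcs_extension_of A G ?E ?k fst"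
    then have nil: "nilpotent_group ?E" and last: "?k ` carrier A = last_lower_central ?E"
      by (auto simp: lcs_extension_of_def)
    have "carrier ?E \<noteq> {\<one>\<^bsub>?E\<^esub>}"
      using ntriv A.one_closed by (auto simp: kernel_embedding_def)
    then obtain m where m: "last_lower_central ?E = lower_central ?E m"
      using nilpotent_last[OF nil] by metis
    \<comment> \<open>A term equal to the copy of \<open>A\<close> dies in \<open>G\<close>. Its
      image is also term \<open>m\<close> of \<open>G\<close>, which therefore is trivial, so
      \<open>m\<close> exceeds \<open>n\<close>.\<close>
    have "fst ` lower_central ?E m = {\<one>}"
      unfolding m[symmetric] last[symmetric] using A.one_closed by (force simp: kernel_embedding_def)
    then have triv: "lower_central G m = {\<one>}"
      using lower_central_image[OF E.is_group G.is_group fst_epi] by simp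
    have "\<not> m \<le> n"
    proof
      assume "m \<le> n"
      then have "lower_central G n \<subseteq> {\<one>}" using lower_central_antimono[OF G.is_group] triv by metis
      then show False using lower_central_nontrivial subgroup.one_closed[OF L_subgroup] L_eq by auto
    qed
    \<comment> \<open>As \<open>m\<close> is at least \<open>Suc n\<close>, the copy of
      \<open>A\<close> lies in the term of index \<open>Suc n\<close>, which is the copy of the
      generated subgroup.\<close>
    then have "?k ` carrier A \<subseteq> ?k ` generate A (hats \<delta>)"
      using lower_central_antimono[OF E.is_group, of "Suc n" m] lower_central_extension[OF \<delta>] m last
      by simp
    then have "carrier A \<subseteq> generate A (hats \<delta>)" using inj by (simp add: inj_image_subset_iff)
    then show "generate A (hats \<delta>) = carrier A"
      using A.generate_incl[OF hats_closed[OF \<delta>]] by blast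
  next
    assume "generate A (hats \<delta>) = carrier A"
    then have Suc: "lower_central ?E (Suc n) = ?k ` carrier A"
      using lower_central_extension[OF \<delta>] by simp
    \<comment> \<open>The copy of \<open>A\<close> is central, so the series ends right after index
      \<open>Suc n\<close>; by non-triviality of \<open>A\<close> it does not end before.\<close>
    have "commutator_subgroup ?E (carrier ?E) (?k ` carrier A) = {\<one>\<^bsub>?E\<^esub>}"
    proof (rule commutator_subgroup_central[OF E.is_group])
      show "?k ` carrier A \<subseteq> carrier ?E" by (auto simp: kernel_embedding_def)
      show "?k ` carrier A \<noteq> {}" using A.one_closed by blast
    qed (use kernel_embedding_commute[OF \<delta>] in blast)
    then have SucSuc: "lower_central ?E (Suc (Suc n)) = {\<one>\<^bsub>?E\<^esub>}" using Suc by simp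
    then have "nilpotent_group ?E" using E.is_group unfolding nilpotent_group_def by blast
    moreover have "last_lower_central ?E = ?k ` carrier A"
      using last_lower_central_eq[OF E.is_group _ SucSuc] Suc ntriv by simp
    ultimately show "lcs_extension_of A G ?E ?k fst"
      using cocycle_extension_of[OF \<delta>] by (simp add: lcs_extension_of_def)
  qed
qed

section \<open>The Schur multiplier of the pair and the image of \<open>kappa_bar\<close>\<close>

lemma commutator_subgroup_L: "commutator_subgroup G (carrier G) L = {\<one>}"
  using lower_central_trivial L_eq by simp

lemma ext_product_carrier:
  "carrier (ext_product G L) = word_class (carrier G \<times> L) (wedge_relations G L) ` lists ((carrier G \<times> L) \<times> UNIV)"
  by (simp add: ext_product_def presented_group_def)

lemma ext_product_mult_closed:
  assumes "P \<in> carrier (ext_product G L)" "Q \<in> carrier (ext_product G L)"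
  shows "P \<otimes>\<^bsub>ext_product G L\<^esub> Q \<in> carrier (ext_product G L)"
proof -
  obtain u v where "u \<in> lists ((carrier G \<times> L) \<times> UNIV)" "v \<in> lists ((carrier G \<times> L) \<times> UNIV)"
    "P = word_class (carrier G \<times> L) (wedge_relations G L) u"
    "Q = word_class (carrier G \<times> L) (wedge_relations G L) v"
    using assms unfolding ext_product_carrier by blast
  then show ?thesis
    unfolding ext_product_carrier
    by (simp add: ext_product_def presented_group_mult)
qed

text \<open>The commutator map takes values in the trivial group, so the constant map is its only
  candidate and its kernel is everything.\<close>

lemma schur_multiplier_L: "schur_multiplier G L = ext_product G L"
proof -
  let ?C = "commutator_subgroup G (carrier G) L"
  let ?f = "\<lambda>x\<in>carrier (ext_product G L). \<one>"
  have wedge: "wedge G L g h \<in> carrier (ext_product G L)" if "g \<in> carrier G" "h \<in> L" for g h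
    using that unfolding wedge_def ext_product_carrier by (intro imageI) simp
  have comm: "g \<otimes> h \<otimes> inv g \<otimes> inv h = \<one>" if "g \<in> carrier G" "h \<in> L" for g h
    unfolding L_commute[OF that] using that L_carrier by (simp add: G.m_assoc)
  have "commutator_map G L = ?f"
    unfolding commutator_map_def
  proof (rule the_equality)
    show "?f \<in> hom (ext_product G L) (G\<lparr>carrier := ?C\<rparr>) \<and> ?f \<in> extensional (carrier (ext_product G L)) \<and>
      (\<forall>g\<in>carrier G. \<forall>h\<in>L. ?f (wedge G L g h) = g \<otimes> h \<otimes> inv g \<otimes> inv h)"
      using wedge comm by (auto simp: hom_def commutator_subgroup_L ext_product_mult_closed)
  next
    fix f assume f: "f \<in> hom (ext_product G L) (G\<lparr>carrier := ?C\<rparr>) \<and> f \<in> extensional (carrier (ext_product G L)) \<and>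
      (\<forall>g\<in>carrier G. \<forall>h\<in>L. f (wedge G L g h) = g \<otimes> h \<otimes> inv g \<otimes> inv h)"
    then show "f = ?f"
      by (intro extensionalityI[of f "carrier (ext_product G L)"])
        (auto simp: hom_def commutator_subgroup_L Pi_iff)
  qed
  then have "kernel (ext_product G L) (G\<lparr>carrier := ?C\<rparr>) (commutator_map G L) = carrier (ext_product G L)"
    by (auto simp: kernel_def)
  then show ?thesis by (simp add: schur_multiplier_def)
qed

text \<open>Conjugation fixes the entries from \<open>L\<close> and is invisible to a multiplicative
  map into an abelian group, so the first two families of relations reduce to bimultiplicativity;
  the third is the alternating property.\<close>

lemma word_value_wedge_relations:
  assumes \<delta>: "\<delta> \<in> Z2" and "(u, v) \<in> wedge_relations G L"
  shows "word_value A (\<lambda>(g, h). cocycle_hat G A \<delta> g h) u = word_value A (\<lambda>(g, h). cocycle_hat G A \<delta> g h) v"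
proof -
  let ?c = "cocycle_hat G A \<delta>"
  consider (left) g g' h where "g \<in> carrier G" "g' \<in> carrier G" "h \<in> L"
      "u = [((g \<otimes> g', h), True)]" "v = [((conj_by G g g', conj_by G g h), True), ((g, h), True)]"
    | (right) g h h' where "g \<in> carrier G" "h \<in> L" "h' \<in> L"
      "u = [((g, h \<otimes> h'), True)]" "v = [((g, h), True), ((conj_by G h g, conj_by G h h'), True)]"
    | (diag) h where "h \<in> L" "u = [((h, h), True)]" "v = []"
    using assms(2) unfolding wedge_relations_def by blast
  then show ?thesis
  proof cases
    case left
    note h = L_carrier[OF left(3)] and comm = L_commute[OF _ left(3)]
    have inv_g: "inv g \<in> carrier G" and gg': "g \<otimes> g' \<in> carrier G" using left by simp_all
    have "conj_by G g h = h" using left h comm[of g] by (simp add: conj_by_def G.m_assoc)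
    moreover have "?c (conj_by G g g') h = ?c g' h"
    proof -
      \<comment> \<open>Split as \<open>(g g')\<close> times \<open>inv g\<close>: the contributions
        of \<open>g\<close> and \<open>inv g\<close> combine to the value at \<one>, which is
        trivial by normalization.\<close>
      have "?c (conj_by G g g') h = ?c (inv g) h \<otimes>\<^bsub>A\<^esub> (?c g' h \<otimes>\<^bsub>A\<^esub> ?c g h)"
        unfolding conj_by_def
        using cocycle_hat_mult_left[OF \<delta> gg' inv_g h comm[OF gg'] comm[OF inv_g]]
          cocycle_hat_mult_left[OF \<delta> left(1,2) h comm[OF left(1)] comm[OF left(2)]] by simp
      also have "\<dots> = ?c g' h \<otimes>\<^bsub>A\<^esub> (?c (inv g) h \<otimes>\<^bsub>A\<^esub> ?c g h)"
        using cocycle_hat_closed[OF \<delta> _ h] left by (simp add: A.m_ac)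
      also have "?c (inv g) h \<otimes>\<^bsub>A\<^esub> ?c g h = ?c \<one> h"
        using cocycle_hat_mult_left[OF \<delta> left(1) inv_g h comm[OF left(1)] comm[OF inv_g]] left by simp
      also have "?c \<one> h = \<one>\<^bsub>A\<^esub>"
        using cocycle_hat_commute[OF \<delta> G.one_closed h] h \<delta> by simp
      finally show ?thesis using cocycle_hat_closed[OF \<delta> left(2) h] by simp
    qed
    ultimately show ?thesis
      using left cocycle_hat_mult_left[OF \<delta> left(1,2) h comm[OF left(1)] comm[OF left(2)]]
        cocycle_hat_closed[OF \<delta> _ h] by simp
  next
    case right
    note h = L_carrier[OF right(2)] and h' = L_carrier[OF right(3)]
    have "conj_by G h g = g" "conj_by G h h' = h'"
      using right h h' L_commute[of h h'] L_commute[of g h]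
      by (simp_all add: conj_by_def G.m_assoc, metis G.inv_closed G.inv_solve_right G.m_assoc G.m_closed L_commute right(2))
    then show ?thesis
      using right cocycle_hat_mult_right[OF \<delta> right(1) h h' L_commute[OF right(1,2)] L_commute[OF right(1,3)]]
        cocycle_hat_closed[OF \<delta> right(1)] h h' by simp
  next
    case diag
    then show ?thesis
      using cocycle_hat_commute[OF \<delta> L_carrier L_carrier, of h h] L_carrier \<delta> by simp
  qed
qed

text \<open>The homomorphism supplied by the universal property is shown to be the one that the
  description selects; its image is then the set of word values.\<close>

lemma kappa_bar_image:
  assumes \<delta>: "\<delta> \<in> Z2"
  shows "kappa_bar G A (H2_class G A \<delta>) ` carrier (schur_multiplier G L) = generate A (hats \<delta>)"
proof -
  let ?X = "carrier G \<times> L" and ?R = "wedge_relations G L" and ?\<phi> = "\<lambda>(g, h). cocycle_hat G A \<delta> g h"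
  have \<phi>: "?\<phi> \<in> ?X \<rightarrow> carrier A" using cocycle_hat_closed[OF \<delta>] L_carrier by auto
  obtain f where f: "f \<in> hom (presented_group ?X ?R) A" "f \<in> extensional (carrier (presented_group ?X ?R))"
    and fv: "\<And>w. w \<in> lists (?X \<times> UNIV) \<Longrightarrow> f (word_class ?X ?R w) = word_value A ?\<phi> w"
    using A.presented_group_hom_exists[OF \<phi>, of ?R] word_value_wedge_relations[OF \<delta>] by metis
  have "kappa_bar G A (H2_class G A \<delta>) = f"
    unfolding kappa_bar_def schur_multiplier_L
  proof (rule the_equality)
    have "f (wedge G L g h) = cocycle_hat G A \<delta>' g h"
      if "\<delta>' \<in> H2_class G A \<delta>" "g \<in> carrier G" "h \<in> L" for \<delta>' g h
    proof -
      have "f (wedge G L g h) = cocycle_hat G A \<delta> g h"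
        using fv[of "[((g, h), True)]"] that cocycle_hat_closed[OF \<delta> that(2) L_carrier[OF that(3)]]
        by (simp add: wedge_def)
      then show ?thesis
        using that mem_H2_class[OF \<delta>] L_carrier L_commute cocycle_hat_cohomologous[OF \<delta>] by metis
    qed
    then show "f \<in> hom (ext_product G L) A \<and> f \<in> extensional (carrier (ext_product G L)) \<and>
      (\<forall>\<delta>'\<in>H2_class G A \<delta>. \<forall>g\<in>carrier G. \<forall>h\<in>L. f (wedge G L g h) = cocycle_hat G A \<delta>' g h)"
      using f by (simp add: ext_product_def)
  next
    fix f' assume f': "f' \<in> hom (ext_product G L) A \<and> f' \<in> extensional (carrier (ext_product G L)) \<and>
      (\<forall>\<delta>'\<in>H2_class G A \<delta>. \<forall>g\<in>carrier G. \<forall>h\<in>L. f' (wedge G L g h) = cocycle_hat G A \<delta>' g h)"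
    then have hom': "f' \<in> hom (presented_group ?X ?R) A" by (simp add: ext_product_def)
    \<comment> \<open>One representative suffices here: the condition at \<delta> itself fixes a
      competitor on all letters.\<close>
    have val': "f' (word_class ?X ?R [(x, True)]) = ?\<phi> x" if "x \<in> ?X" for x
      using that f' H2_class_self[OF \<delta>] by (auto simp: wedge_def)
    show "f' = f"
    proof (rule extensionalityI[of _ "carrier (ext_product G L)"])
      fix P assume "P \<in> carrier (ext_product G L)"
      then obtain w where w: "w \<in> lists (?X \<times> UNIV)" "P = word_class ?X ?R w"
        unfolding ext_product_carrier by blast
      then show "f' P = f P"
        using A.presented_group_hom_unique[OF hom' val' w(1)] fv[OF w(1)] by simp
    qed (use f f' in \<open>simp_all add: ext_product_def\<close>)
  qed
  then have "kappa_bar G A (H2_class G A \<delta>) ` carrier (schur_multiplier G L)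
      = word_value A ?\<phi> ` lists (?X \<times> UNIV)"
    unfolding schur_multiplier_L ext_product_carrier image_image using fv by (intro image_cong) auto
  then show ?thesis using A.word_value_image[OF \<phi>] by (simp add: hats_def)
qed

text \<open>Both sides say that \<open>hats\<close> generates \<open>A\<close>. From here on
  surjectivity is only used in the form of the right-hand side.\<close>

lemma Delta_iff:
  assumes "\<delta> \<in> Z2"
  shows "H2_class G A \<delta> \<in> Delta G A \<longleftrightarrow>
    lcs_extension_of A G (cocycle_extension G A \<delta>) (kernel_embedding G) fst"
  using kappa_bar_image[OF assms] lcs_extension_iff_generate[OF assms] assms
  by (simp add: Delta_def H2_carrier)

end

section \<open>Isomorphisms of extensions\<close>

lemma auto_D:
  assumes "f \<in> auto G"
  shows "x \<in> carrier G \<Longrightarrow> f x \<in> carrier G"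
    "x \<in> carrier G \<Longrightarrow> y \<in> carrier G \<Longrightarrow> f (x \<otimes>\<^bsub>G\<^esub> y) = f x \<otimes>\<^bsub>G\<^esub> f y"
    "x \<in> carrier G \<Longrightarrow> y \<in> carrier G \<Longrightarrow> f x = f y \<longleftrightarrow> x = y"
    "f \<in> extensional (carrier G)"
    "x \<in> carrier G \<Longrightarrow> inv_into (carrier G) f x \<in> carrier G"
    "x \<in> carrier G \<Longrightarrow> f (inv_into (carrier G) f x) = x"
    "x \<in> carrier G \<Longrightarrow> inv_into (carrier G) f (f x) = x"
  using assms
  by (auto simp: auto_def hom_def Bij_def bij_betw_def inj_on_eq_iff f_inv_into_f inv_into_into)

lemma auto_I:
  assumes "\<And>x. x \<in> carrier G \<Longrightarrow> f x \<in> carrier G"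
    and "\<And>x y. x \<in> carrier G \<Longrightarrow> y \<in> carrier G \<Longrightarrow> f (x \<otimes>\<^bsub>G\<^esub> y) = f x \<otimes>\<^bsub>G\<^esub> f y"
    and "\<And>x y. x \<in> carrier G \<Longrightarrow> y \<in> carrier G \<Longrightarrow> f x = f y \<Longrightarrow> x = y"
    and "\<And>y. y \<in> carrier G \<Longrightarrow> \<exists>x\<in>carrier G. f x = y"
    and "f \<in> extensional (carrier G)"
  shows "f \<in> auto G"
proof -
  have "f ` carrier G = carrier G" using assms(1,4) by blast
  moreover have "inj_on f (carrier G)" using assms(3) by (rule inj_onI)
  ultimately show ?thesis using assms(1,2,5) by (simp add: auto_def hom_def Bij_def bij_betw_def)
qed

lemma auto_D_one:
  assumes "group G" "f \<in> auto G"
  shows "f \<one>\<^bsub>G\<^esub> = \<one>\<^bsub>G\<^esub>"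
  using hom_one[of f G G] assms by (simp add: auto_def)

text \<open>Members of \<open>auto\<close> are extensional while those of \<open>iso\<close> need
  not be; restriction bridges the two.\<close>

lemma restrict_iso_auto:
  assumes "group E" "f \<in> iso E E"
  shows "restrict f (carrier E) \<in> auto E"
proof -
  interpret E: group E by fact
  show ?thesis
    using assms(2) unfolding iso_def auto_def Bij_def by (auto simp: hom_def)
qed

lemma auto_imp_iso: "f \<in> auto E \<Longrightarrow> f \<in> iso E E"
  by (simp add: auto_def iso_def Bij_def)

lemma carrier_AutoGroup: "carrier (AutoGroup G) = auto G"
  by (simp add: AutoGroup_def)

lemma AutoGroup_mult:
  assumes "f \<in> auto G" "f' \<in> auto G"
  shows "f \<otimes>\<^bsub>AutoGroup G\<^esub> f' = compose (carrier G) f f'"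
  using assms by (simp add: AutoGroup_def BijGroup_def auto_def)

lemma AutoGroup_one: "\<one>\<^bsub>AutoGroup G\<^esub> = (\<lambda>x\<in>carrier G. x)"
  by (simp add: AutoGroup_def BijGroup_def)

lemma carrier_Comp: "carrier (Comp G A) = auto G \<times> auto A"
  by (simp add: Comp_def carrier_AutoGroup)

section \<open>The action of compatible pairs on cocycles and classes\<close>

context trivial_module
begin

lemma Z2_act_apply:
  "g \<in> carrier G \<Longrightarrow> h \<in> carrier G \<Longrightarrow> Z2_act G (\<eta>, \<nu>) \<delta> (g, h)
    = \<nu> (\<delta> (inv_into (carrier G) \<eta> g, inv_into (carrier G) \<eta> h))"
  by (simp add: Z2_act_def)

lemma auto_inv_mult:
  assumes "\<eta> \<in> auto G" "g \<in> carrier G" "h \<in> carrier G"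
  shows "inv_into (carrier G) \<eta> (g \<otimes> h) = inv_into (carrier G) \<eta> g \<otimes> inv_into (carrier G) \<eta> h"
  using auto_D(7)[OF assms(1), of "inv_into (carrier G) \<eta> g \<otimes> inv_into (carrier G) \<eta> h"]
    auto_D(2,5,6)[OF assms(1)] assms(2,3) by simp

lemma Z2_act_closed:
  assumes \<eta>: "\<eta> \<in> auto G" and \<nu>: "\<nu> \<in> auto A" and \<delta>: "\<delta> \<in> Z2"
  shows "Z2_act G (\<eta>, \<nu>) \<delta> \<in> Z2"
  unfolding Z2_iff
proof (intro conjI ballI)
  let ?i = "inv_into (carrier G) \<eta>"
  note i = auto_D(5)[OF \<eta>]
  show "Z2_act G (\<eta>, \<nu>) \<delta> \<in> extensional (carrier G \<times> carrier G)" by (simp add: Z2_act_def)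
  show "Z2_act G (\<eta>, \<nu>) \<delta> (g, h) \<in> carrier A" if "g \<in> carrier G" "h \<in> carrier G" for g h
    using that \<delta> i auto_D(1)[OF \<nu>] by (simp add: Z2_act_apply)
  have "?i \<one> = \<one>" using auto_D(7)[OF \<eta>, of \<one>] auto_D_one[OF G.is_group \<eta>] by simp
  then show "Z2_act G (\<eta>, \<nu>) \<delta> (g, \<one>) = \<one>\<^bsub>A\<^esub>" "Z2_act G (\<eta>, \<nu>) \<delta> (\<one>, g) = \<one>\<^bsub>A\<^esub>"
    if "g \<in> carrier G" for g
    using that \<delta> i auto_D_one[OF A.is_group \<nu>] by (simp_all add: Z2_act_apply)
  fix g h k assume ghk: "g \<in> carrier G" "h \<in> carrier G" "k \<in> carrier G"
  note j = i[OF ghk(1)] i[OF ghk(2)] i[OF ghk(3)]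
  have "\<nu> (\<delta> (?i g, ?i h)) \<otimes>\<^bsub>A\<^esub> \<nu> (\<delta> (?i g \<otimes> ?i h, ?i k))
      = \<nu> (\<delta> (?i g, ?i h) \<otimes>\<^bsub>A\<^esub> \<delta> (?i g \<otimes> ?i h, ?i k))"
    using j \<delta> auto_D(2)[OF \<nu>] by simp
  also have "\<dots> = \<nu> (\<delta> (?i h, ?i k)) \<otimes>\<^bsub>A\<^esub> \<nu> (\<delta> (?i g, ?i h \<otimes> ?i k))"
    unfolding Z2_cocycle[OF \<delta> j] using j \<delta> auto_D(2)[OF \<nu>] by simp
  finally show "Z2_act G (\<eta>, \<nu>) \<delta> (g, h) \<otimes>\<^bsub>A\<^esub> Z2_act G (\<eta>, \<nu>) \<delta> (g \<otimes> h, k)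
      = Z2_act G (\<eta>, \<nu>) \<delta> (h, k) \<otimes>\<^bsub>A\<^esub> Z2_act G (\<eta>, \<nu>) \<delta> (g, h \<otimes> k)"
    using ghk by (simp add: Z2_act_apply auto_inv_mult[OF \<eta>])
qed

text \<open>The cochain is transported like the cocycles, by precomposing with the inverse of \<eta>
  and applying \<nu>.\<close>

lemma Z2_act_cohomologous:
  assumes \<eta>: "\<eta> \<in> auto G" and \<nu>: "\<nu> \<in> auto A" and \<delta>: "\<delta> \<in> Z2" "\<delta>' \<in> Z2"
    and "cohomologous \<delta> \<delta>'"
  shows "cohomologous (Z2_act G (\<eta>, \<nu>) \<delta>) (Z2_act G (\<eta>, \<nu>) \<delta>')"
proof -
  obtain \<epsilon> where "cobounds \<epsilon> \<delta> \<delta>'" using assms(5) by (auto simp: cohomologous_def)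
  note \<epsilon> = cobounds_D[OF this]
  let ?i = "inv_into (carrier G) \<eta>"
  note i = auto_D(5)[OF \<eta>] and \<nu>m = auto_D(2)[OF \<nu>]
  show ?thesis
  proof (rule cohomologousI[of "\<lambda>g. \<nu> (\<epsilon> (?i g))"])
    show "\<nu> (\<epsilon> (?i g)) \<in> carrier A" if "g \<in> carrier G" for g
      using that i \<epsilon>(1) auto_D(1)[OF \<nu>] by blast
    show "\<nu> (\<epsilon> (?i \<one>)) = \<one>\<^bsub>A\<^esub>"
      using auto_D(7)[OF \<eta>, of \<one>] auto_D_one[OF G.is_group \<eta>] auto_D_one[OF A.is_group \<nu>] \<epsilon>(2) by simp
    fix g h assume gh: "g \<in> carrier G" "h \<in> carrier G"
    note j = i[OF gh(1)] i[OF gh(2)]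
    note c = j \<delta> \<epsilon>(1)[OF j(1)] \<epsilon>(1)[OF j(2)] \<epsilon>(1)[OF G.m_closed[OF j]]
    have "\<nu> (\<delta>' (?i g, ?i h)) \<otimes>\<^bsub>A\<^esub> \<nu> (\<epsilon> (?i g \<otimes> ?i h)) = \<nu> (\<delta>' (?i g, ?i h) \<otimes>\<^bsub>A\<^esub> \<epsilon> (?i g \<otimes> ?i h))"
      using c \<nu>m by simp
    also have "\<dots> = \<nu> (\<epsilon> (?i g)) \<otimes>\<^bsub>A\<^esub> \<nu> (\<epsilon> (?i h)) \<otimes>\<^bsub>A\<^esub> \<nu> (\<delta> (?i g, ?i h))"
      unfolding \<epsilon>(3)[OF j] using c \<nu>m by simp
    finally show "Z2_act G (\<eta>, \<nu>) \<delta>' (g, h) \<otimes>\<^bsub>A\<^esub> \<nu> (\<epsilon> (?i (g \<otimes> h)))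
        = \<nu> (\<epsilon> (?i g)) \<otimes>\<^bsub>A\<^esub> \<nu> (\<epsilon> (?i h)) \<otimes>\<^bsub>A\<^esub> Z2_act G (\<eta>, \<nu>) \<delta> (g, h)"
      using gh by (simp add: Z2_act_apply auto_inv_mult[OF \<eta>])
  qed
qed

lemma H2_act_class:
  assumes \<eta>: "\<eta> \<in> auto G" and \<nu>: "\<nu> \<in> auto A" and \<delta>: "\<delta> \<in> Z2"
  shows "H2_act G A (\<eta>, \<nu>) (H2_class G A \<delta>) = H2_class G A (Z2_act G (\<eta>, \<nu>) \<delta>)"
proof -
  have "(\<Union>\<delta>'\<in>H2_class G A \<delta>. H2_class G A (Z2_act G (\<eta>, \<nu>) \<delta>')) = H2_class G A (Z2_act G (\<eta>, \<nu>) \<delta>)"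
  proof (rule SUP_eq_const)
    show "H2_class G A \<delta> \<noteq> {}" using H2_class_self[OF \<delta>] by blast
    fix \<delta>' assume "\<delta>' \<in> H2_class G A \<delta>"
    then have "\<delta>' \<in> Z2" "cohomologous \<delta> \<delta>'" using mem_H2_class[OF \<delta>] by blast+
    then have "H2_class G A (Z2_act G (\<eta>, \<nu>) \<delta>) = H2_class G A (Z2_act G (\<eta>, \<nu>) \<delta>')"
      using H2_class_eq_iff Z2_act_closed[OF \<eta> \<nu>] Z2_act_cohomologous[OF \<eta> \<nu> \<delta>] \<delta> by blast
    then show "H2_class G A (Z2_act G (\<eta>, \<nu>) \<delta>') = H2_class G A (Z2_act G (\<eta>, \<nu>) \<delta>)" ..
  qed
  then show ?thesis using \<delta> by (simp add: H2_act_def H2_carrier)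
qed

text \<open>Evaluating the coboundary equation at \<eta>-images clears the inverse of \<eta> hidden
  in \<open>Z2_act\<close>. The right-hand side is then literally the multiplicativity condition for
  a map between the two extensions.\<close>

lemma H2_act_eq_iff:
  assumes \<eta>: "\<eta> \<in> auto G" and \<nu>: "\<nu> \<in> auto A" and \<delta>: "\<delta> \<in> Z2" and \<delta>': "\<delta>' \<in> Z2"
  shows "H2_act G A (\<eta>, \<nu>) (H2_class G A \<delta>) = H2_class G A \<delta>' \<longleftrightarrow>
    (\<exists>\<epsilon>. cobounds \<epsilon> (\<lambda>(g, h). \<delta>' (\<eta> g, \<eta> h)) (\<lambda>x. \<nu> (\<delta> x)))"
proof -
  let ?i = "inv_into (carrier G) \<eta>"
  have "H2_act G A (\<eta>, \<nu>) (H2_class G A \<delta>) = H2_class G A \<delta>' \<longleftrightarrow>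
      cohomologous \<delta>' (Z2_act G (\<eta>, \<nu>) \<delta>)"
    unfolding H2_act_class[OF \<eta> \<nu> \<delta>]
    using H2_class_eq_iff[OF \<delta>' Z2_act_closed[OF \<eta> \<nu> \<delta>]] by auto
  also have "\<dots> \<longleftrightarrow> (\<exists>\<epsilon>. cobounds \<epsilon> (\<lambda>(g, h). \<delta>' (\<eta> g, \<eta> h)) (\<lambda>x. \<nu> (\<delta> x)))"
  proof
    assume "cohomologous \<delta>' (Z2_act G (\<eta>, \<nu>) \<delta>)"
    then obtain \<epsilon> where "cobounds \<epsilon> \<delta>' (Z2_act G (\<eta>, \<nu>) \<delta>)" by (auto simp: cohomologous_def)
    note \<epsilon> = cobounds_D[OF this]
    have "cobounds (\<lambda>g. \<epsilon> (\<eta> g)) (\<lambda>(g, h). \<delta>' (\<eta> g, \<eta> h)) (\<lambda>x. \<nu> (\<delta> x))"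
      unfolding cobounds_def
    proof (intro conjI ballI)
      show "(\<lambda>g. \<epsilon> (\<eta> g)) \<in> carrier G \<rightarrow> carrier A" using \<epsilon>(1) auto_D(1)[OF \<eta>] by auto
      show "\<epsilon> (\<eta> \<one>) = \<one>\<^bsub>A\<^esub>" using \<epsilon>(2) auto_D_one[OF G.is_group \<eta>] by simp
      fix g h assume gh: "g \<in> carrier G" "h \<in> carrier G"
      show "\<nu> (\<delta> (g, h)) \<otimes>\<^bsub>A\<^esub> \<epsilon> (\<eta> (g \<otimes> h))
          = \<epsilon> (\<eta> g) \<otimes>\<^bsub>A\<^esub> \<epsilon> (\<eta> h) \<otimes>\<^bsub>A\<^esub> (case (g, h) of (g, h) \<Rightarrow> \<delta>' (\<eta> g, \<eta> h))"
        using \<epsilon>(3)[of "\<eta> g" "\<eta> h"] gh auto_D(1,2,7)[OF \<eta>] by (simp add: Z2_act_apply)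
    qed
    then show "\<exists>\<epsilon>. cobounds \<epsilon> (\<lambda>(g, h). \<delta>' (\<eta> g, \<eta> h)) (\<lambda>x. \<nu> (\<delta> x))"
      by (rule exI[of _ "\<lambda>g. \<epsilon> (\<eta> g)"])
  next
    assume "\<exists>\<epsilon>. cobounds \<epsilon> (\<lambda>(g, h). \<delta>' (\<eta> g, \<eta> h)) (\<lambda>x. \<nu> (\<delta> x))"
    then obtain \<epsilon> where "cobounds \<epsilon> (\<lambda>(g, h). \<delta>' (\<eta> g, \<eta> h)) (\<lambda>x. \<nu> (\<delta> x))" ..
    note \<epsilon> = cobounds_D[OF this]
    show "cohomologous \<delta>' (Z2_act G (\<eta>, \<nu>) \<delta>)"
    \<comment> \<open>The cochain lives on the source copy of \<open>G\<close> and is carried to the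
      target copy by the inverse of \<eta>.\<close>
    proof (rule cohomologousI[of "\<lambda>g. \<epsilon> (?i g)"])
      show "\<epsilon> (?i g) \<in> carrier A" if "g \<in> carrier G" for g using that auto_D(5)[OF \<eta>] \<epsilon>(1) by blast
      show "\<epsilon> (?i \<one>) = \<one>\<^bsub>A\<^esub>"
        using auto_D(7)[OF \<eta>, of \<one>] auto_D_one[OF G.is_group \<eta>] \<epsilon>(2) by simp
      fix g h assume gh: "g \<in> carrier G" "h \<in> carrier G"
      show "Z2_act G (\<eta>, \<nu>) \<delta> (g, h) \<otimes>\<^bsub>A\<^esub> \<epsilon> (?i (g \<otimes> h)) = \<epsilon> (?i g) \<otimes>\<^bsub>A\<^esub> \<epsilon> (?i h) \<otimes>\<^bsub>A\<^esub> \<delta>' (g, h)"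
        using \<epsilon>(3)[of "?i g" "?i h"] gh auto_D(5,6)[OF \<eta>] by (simp add: Z2_act_apply auto_inv_mult[OF \<eta>])
    qed
  qed
  finally show ?thesis .
qed

text \<open>An isomorphism of extensions that preserves the copies of \<open>A\<close> has the form
  \<open>(g, a) \<mapsto> (\<eta> g, \<epsilon> g + \<nu> a)\<close>, and such a map is multiplicative exactly if \<open>\<epsilon>\<close> cobounds
  between the pullback of \<open>\<delta>'\<close> along \<open>\<eta>\<close> and the pushforward of \<open>\<delta>\<close> along \<open>\<nu>\<close>.\<close>

definition quotient_part :: "('a \<times> 'c \<Rightarrow> 'a \<times> 'c) \<Rightarrow> 'a \<Rightarrow> 'a" where
  "quotient_part f = (\<lambda>g\<in>carrier G. fst (f (g, \<one>\<^bsub>A\<^esub>)))"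

definition kernel_part :: "('a \<times> 'c \<Rightarrow> 'a \<times> 'c) \<Rightarrow> 'c \<Rightarrow> 'c" where
  "kernel_part f = (\<lambda>a\<in>carrier A. snd (f (\<one>, a)))"

text \<open>Everything comes from \<open>(g, a) = (g, 0)(1, a)\<close>, with \<open>A\<close>
  written additively: the image of the second factor stays in the copy of \<open>A\<close>, so the
  first coordinate of the image depends on \<open>g\<close> alone.\<close>

lemma iso_parts:
  assumes \<delta>: "\<delta> \<in> Z2" and \<delta>': "\<delta>' \<in> Z2"
    and f: "f \<in> iso (cocycle_extension G A \<delta>) (cocycle_extension G A \<delta>')"
    and img: "f ` kernel_embedding G ` carrier A = kernel_embedding G ` carrier A"
  shows "quotient_part f \<in> auto G" (is "?\<eta> \<in> _") and "kernel_part f \<in> auto A" (is "?\<nu> \<in> _")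
    and "g \<in> carrier G \<Longrightarrow> a \<in> carrier A \<Longrightarrow>
      f (g, a) = (quotient_part f g, snd (f (g, \<one>\<^bsub>A\<^esub>)) \<otimes>\<^bsub>A\<^esub> kernel_part f a)"
    and "cobounds (\<lambda>g. snd (f (g, \<one>\<^bsub>A\<^esub>)))
      (\<lambda>(g, h). \<delta>' (quotient_part f g, quotient_part f h)) (\<lambda>x. kernel_part f (\<delta> x))"
proof -
  let ?E = "cocycle_extension G A \<delta>" and ?E' = "cocycle_extension G A \<delta>'"
  let ?\<epsilon> = "\<lambda>g. snd (f (g, \<one>\<^bsub>A\<^esub>))"
  have bij: "inj_on f (carrier G \<times> carrier A)" "f ` (carrier G \<times> carrier A) = carrier G \<times> carrier A"
    using f by (auto simp: iso_iff)
  have mult: "f ((g, a) \<otimes>\<^bsub>?E\<^esub> (h, b)) = f (g, a) \<otimes>\<^bsub>?E'\<^esub> f (h, b)"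
    if "g \<in> carrier G" "a \<in> carrier A" "h \<in> carrier G" "b \<in> carrier A" for g a h b
    using f that by (auto simp: iso_def hom_def)
  have fA: "f (\<one>, a) = (\<one>, ?\<nu> a)" and \<nu>c: "?\<nu> a \<in> carrier A" if "a \<in> carrier A" for a
  proof -
    have "f (\<one>, a) \<in> f ` kernel_embedding G ` carrier A"
      using that by (simp add: kernel_embedding_def)
    then have "f (\<one>, a) \<in> kernel_embedding G ` carrier A" by (simp only: img)
    then show "f (\<one>, a) = (\<one>, ?\<nu> a)" "?\<nu> a \<in> carrier A"
      using that by (auto simp: kernel_embedding_def kernel_part_def)
  qed
  have f1: "f (g, \<one>\<^bsub>A\<^esub>) = (?\<eta> g, ?\<epsilon> g)" and \<eta>c: "?\<eta> g \<in> carrier G" and \<epsilon>c: "?\<epsilon> g \<in> carrier A"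
    if "g \<in> carrier G" for g
  proof -
    have "f (g, \<one>\<^bsub>A\<^esub>) \<in> carrier G \<times> carrier A" using that bij(2) by auto
    then show "f (g, \<one>\<^bsub>A\<^esub>) = (?\<eta> g, ?\<epsilon> g)" "?\<eta> g \<in> carrier G" "?\<epsilon> g \<in> carrier A"
      using that by (auto simp: quotient_part_def)
  qed
  have split: "f (g, a) = (?\<eta> g, ?\<epsilon> g \<otimes>\<^bsub>A\<^esub> ?\<nu> a)" if "g \<in> carrier G" "a \<in> carrier A" for g a
  proof -
    have "f (g, a) = f (g, \<one>\<^bsub>A\<^esub>) \<otimes>\<^bsub>?E'\<^esub> f (\<one>, a)"
      using mult[of g "\<one>\<^bsub>A\<^esub>" \<one> a] that \<delta> by simp
    also have "\<dots> = (?\<eta> g, ?\<epsilon> g) \<otimes>\<^bsub>?E'\<^esub> (\<one>, ?\<nu> a)"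
      by (rule arg_cong2[OF f1[OF that(1)] fA[OF that(2)]])
    finally show ?thesis using that \<delta>' \<eta>c[of g] \<epsilon>c[of g] \<nu>c[of a] by simp
  qed
  then show "g \<in> carrier G \<Longrightarrow> a \<in> carrier A \<Longrightarrow> f (g, a) = (?\<eta> g, ?\<epsilon> g \<otimes>\<^bsub>A\<^esub> ?\<nu> a)" .
  have prod: "?\<eta> (g \<otimes> h) = ?\<eta> g \<otimes> ?\<eta> h"
    "?\<epsilon> (g \<otimes> h) \<otimes>\<^bsub>A\<^esub> ?\<nu> (\<delta> (g, h)) = ?\<epsilon> g \<otimes>\<^bsub>A\<^esub> ?\<epsilon> h \<otimes>\<^bsub>A\<^esub> \<delta>' (?\<eta> g, ?\<eta> h)"
    if gh: "g \<in> carrier G" "h \<in> carrier G" for g h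
  proof -
    \<comment> \<open>The element is the product of \<open>(g, 0)\<close> and \<open>(h, 0)\<close>.
      Comparing its image computed factorwise with the split form yields multiplicativity of \<eta>
      and the coboundary equation together.\<close>
    have "f (g \<otimes> h, \<delta> (g, h)) = (?\<eta> g, ?\<epsilon> g) \<otimes>\<^bsub>?E'\<^esub> (?\<eta> h, ?\<epsilon> h)"
      using mult[of g "\<one>\<^bsub>A\<^esub>" h "\<one>\<^bsub>A\<^esub>"] gh \<delta> f1[of g] f1[of h] by simp
    moreover have "f (g \<otimes> h, \<delta> (g, h)) = (?\<eta> (g \<otimes> h), ?\<epsilon> (g \<otimes> h) \<otimes>\<^bsub>A\<^esub> ?\<nu> (\<delta> (g, h)))"
      by (rule split) (use gh \<delta> in auto)
    ultimately show "?\<eta> (g \<otimes> h) = ?\<eta> g \<otimes> ?\<eta> h"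
      "?\<epsilon> (g \<otimes> h) \<otimes>\<^bsub>A\<^esub> ?\<nu> (\<delta> (g, h)) = ?\<epsilon> g \<otimes>\<^bsub>A\<^esub> ?\<epsilon> h \<otimes>\<^bsub>A\<^esub> \<delta>' (?\<eta> g, ?\<eta> h)" by simp_all
  qed
  have \<epsilon>1: "?\<epsilon> \<one> = \<one>\<^bsub>A\<^esub>"
    using hom_one[OF iso_imp_homomorphism[OF f] cocycle_extension_group[OF \<delta>] cocycle_extension_group[OF \<delta>']]
    by simp
  have \<nu>mult: "?\<nu> (a \<otimes>\<^bsub>A\<^esub> b) = ?\<nu> a \<otimes>\<^bsub>A\<^esub> ?\<nu> b" if "a \<in> carrier A" "b \<in> carrier A" for a b
  proof -
    have "f (\<one>, a \<otimes>\<^bsub>A\<^esub> b) = (\<one>, ?\<nu> a) \<otimes>\<^bsub>?E'\<^esub> (\<one>, ?\<nu> b)"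
      using mult[of \<one> a \<one> b] that \<delta> fA[OF that(1)] fA[OF that(2)] by simp
    then show ?thesis using that \<nu>c fA[of "a \<otimes>\<^bsub>A\<^esub> b"] \<delta>' by simp
  qed
  have \<nu>surj: "\<exists>a\<in>carrier A. ?\<nu> a = b" if "b \<in> carrier A" for b
  proof -
    have "(\<one>, b) \<in> f ` kernel_embedding G ` carrier A" using that img by (simp add: kernel_embedding_def)
    then obtain a where "a \<in> carrier A" "(\<one>, b) = f (\<one>, a)" by (auto simp: kernel_embedding_def)
    then show ?thesis using fA[of a] by auto
  qed
  have \<nu>inj: "a = b" if "a \<in> carrier A" "b \<in> carrier A" "?\<nu> a = ?\<nu> b" for a b
    using inj_onD[OF bij(1), of "(\<one>, a)" "(\<one>, b)"] fA that by simp
  have \<eta>surj: "\<exists>g\<in>carrier G. ?\<eta> g = x" if "x \<in> carrier G" for x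
  proof -
    have "(x, \<one>\<^bsub>A\<^esub>) \<in> f ` (carrier G \<times> carrier A)" using that bij(2) by simp
    then obtain g a where "g \<in> carrier G" "a \<in> carrier A" "(x, \<one>\<^bsub>A\<^esub>) = f (g, a)" by auto
    then show ?thesis using split[of g a] by auto
  qed
  have \<eta>inj: "g = h" if gh: "g \<in> carrier G" "h \<in> carrier G" "?\<eta> g = ?\<eta> h" for g h
  proof -
    \<comment> \<open>The images of \<open>(g, 0)\<close> and \<open>(h, 0)\<close> differ by an
      element of \<open>A\<close>. Surjectivity of \<nu> lifts this difference to \<open>a\<close>,
      and then injectivity of \<open>f\<close> applies.\<close>
    obtain a where a: "a \<in> carrier A" "?\<nu> a = inv\<^bsub>A\<^esub> ?\<epsilon> g \<otimes>\<^bsub>A\<^esub> ?\<epsilon> h"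
      using \<nu>surj[of "inv\<^bsub>A\<^esub> ?\<epsilon> g \<otimes>\<^bsub>A\<^esub> ?\<epsilon> h"] \<epsilon>c gh by auto
    have "f (g, a) = f (h, \<one>\<^bsub>A\<^esub>)"
      using split[OF gh(1) a(1)] f1[OF gh(2)] a(2) gh \<epsilon>c[OF gh(1)] \<epsilon>c[OF gh(2)]
      by (simp add: A.m_assoc[symmetric])
    then show ?thesis using inj_onD[OF bij(1), of "(g, a)" "(h, \<one>\<^bsub>A\<^esub>)"] gh a(1) by simp
  qed
  show "?\<eta> \<in> auto G"
    by (rule auto_I) (use \<eta>c prod(1) \<eta>inj \<eta>surj in \<open>simp_all add: quotient_part_def\<close>)
  show "?\<nu> \<in> auto A"
    by (rule auto_I) (use \<nu>c \<nu>mult \<nu>inj \<nu>surj in \<open>simp_all add: kernel_part_def\<close>)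
  have "?\<nu> (\<delta> (g, h)) \<otimes>\<^bsub>A\<^esub> ?\<epsilon> (g \<otimes> h) = ?\<epsilon> g \<otimes>\<^bsub>A\<^esub> ?\<epsilon> h \<otimes>\<^bsub>A\<^esub> \<delta>' (?\<eta> g, ?\<eta> h)"
    if "g \<in> carrier G" "h \<in> carrier G" for g h
    using prod(2)[OF that] A.m_comm[OF \<nu>c \<epsilon>c, of "\<delta> (g, h)" "g \<otimes> h"] that \<delta> by simp
  then show "cobounds ?\<epsilon> (\<lambda>(g, h). \<delta>' (?\<eta> g, ?\<eta> h)) (\<lambda>x. ?\<nu> (\<delta> x))"
    unfolding cobounds_def using \<epsilon>c \<epsilon>1 by simp
qed

text \<open>The cocycle of the source is the one pushed forward, hence the second cocycle argument
  of \<open>cobounds\<close>; multiplicativity in the second coordinate is its equation.\<close>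

lemma iso_of_parts:
  assumes \<delta>: "\<delta> \<in> Z2" and \<delta>': "\<delta>' \<in> Z2" and \<eta>: "\<eta> \<in> auto G" and \<nu>: "\<nu> \<in> auto A"
    and cob: "cobounds \<epsilon> (\<lambda>(g, h). \<delta>' (\<eta> g, \<eta> h)) (\<lambda>x. \<nu> (\<delta> x))"
  shows "(\<lambda>(g, a). (\<eta> g, \<epsilon> g \<otimes>\<^bsub>A\<^esub> \<nu> a)) \<in> iso (cocycle_extension G A \<delta>) (cocycle_extension G A \<delta>')"
    (is "?f \<in> iso ?E ?E'")
proof (rule isoI)
  note \<epsilon> = cobounds_D[OF cob]
  show "?f \<in> hom ?E ?E'"
  proof (rule homI)
    fix x assume "x \<in> carrier ?E"
    then show "?f x \<in> carrier ?E'" using auto_D(1)[OF \<eta>] auto_D(1)[OF \<nu>] \<epsilon>(1) by auto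
  next
    fix x y assume "x \<in> carrier ?E" "y \<in> carrier ?E"
    then obtain g a h b where xy: "x = (g, a)" "y = (h, b)"
      and gh: "g \<in> carrier G" "h \<in> carrier G" and ab: "a \<in> carrier A" "b \<in> carrier A" by auto
    note c = auto_D(1)[OF \<nu> ab(1)] auto_D(1)[OF \<nu> ab(2)] \<epsilon>(1)[OF gh(1)] \<epsilon>(1)[OF gh(2)]
      \<epsilon>(1)[OF G.m_closed[OF gh]] auto_D(1)[OF \<nu> Z2_closed[OF \<delta> gh]]
      Z2_closed[OF \<delta>' auto_D(1)[OF \<eta> gh(1)] auto_D(1)[OF \<eta> gh(2)]]
    have "\<epsilon> (g \<otimes> h) \<otimes>\<^bsub>A\<^esub> \<nu> (a \<otimes>\<^bsub>A\<^esub> b \<otimes>\<^bsub>A\<^esub> \<delta> (g, h))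
        = \<nu> a \<otimes>\<^bsub>A\<^esub> \<nu> b \<otimes>\<^bsub>A\<^esub> (\<nu> (\<delta> (g, h)) \<otimes>\<^bsub>A\<^esub> \<epsilon> (g \<otimes> h))"
      using c ab gh \<delta> auto_D(2)[OF \<nu>] by (simp add: A.m_ac)
    also have "\<dots> = (\<epsilon> g \<otimes>\<^bsub>A\<^esub> \<nu> a) \<otimes>\<^bsub>A\<^esub> (\<epsilon> h \<otimes>\<^bsub>A\<^esub> \<nu> b) \<otimes>\<^bsub>A\<^esub> \<delta>' (\<eta> g, \<eta> h)"
      unfolding \<epsilon>(3)[OF gh] using c by (simp add: A.m_ac)
    finally show "?f (x \<otimes>\<^bsub>?E\<^esub> y) = ?f x \<otimes>\<^bsub>?E'\<^esub> ?f y"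
      using gh auto_D(2)[OF \<eta>] by (simp add: xy)
  qed
  show "bij_betw ?f (carrier ?E) (carrier ?E')"
    unfolding bij_betw_def
  proof (intro conjI equalityI subsetI)
    show "inj_on ?f (carrier ?E)"
      using auto_D(1,3)[OF \<eta>] auto_D(1,3)[OF \<nu>] \<epsilon>(1) by (auto simp: inj_on_def)
    show "x \<in> carrier ?E'" if "x \<in> ?f ` carrier ?E" for x
      using that auto_D(1)[OF \<eta>] auto_D(1)[OF \<nu>] \<epsilon>(1) by auto
    fix x assume "x \<in> carrier ?E'"
    then obtain g b where x: "x = (g, b)" "g \<in> carrier G" "b \<in> carrier A" by auto
    let ?g = "inv_into (carrier G) \<eta> g"
    \<comment> \<open>Solves \<open>\<epsilon> ?g + \<nu> a = b\<close> for \<open>a\<close>, in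
      additive notation.\<close>
    let ?a = "inv_into (carrier A) \<nu> (inv\<^bsub>A\<^esub> \<epsilon> ?g \<otimes>\<^bsub>A\<^esub> b)"
    have g: "?g \<in> carrier G" "\<eta> ?g = g" using auto_D(5,6)[OF \<eta>] x by auto
    have "inv\<^bsub>A\<^esub> \<epsilon> ?g \<otimes>\<^bsub>A\<^esub> b \<in> carrier A" using x \<epsilon>(1)[OF g(1)] by simp
    then have a: "?a \<in> carrier A" "\<nu> ?a = inv\<^bsub>A\<^esub> \<epsilon> ?g \<otimes>\<^bsub>A\<^esub> b" using auto_D(5,6)[OF \<nu>] by auto
    have "x = ?f (?g, ?a)" using x g a \<epsilon>(1)[OF g(1)] by (simp add: A.m_assoc[symmetric])
    then show "x \<in> ?f ` carrier ?E" by (rule image_eqI) (use g a in simp)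
  qed
qed

lemma iso_of_parts_kernel:
  assumes "\<nu> \<in> auto A" "\<eta> \<in> auto G" "\<epsilon> \<one> = \<one>\<^bsub>A\<^esub>"
  shows "(\<lambda>(g, a). (\<eta> g, \<epsilon> g \<otimes>\<^bsub>A\<^esub> \<nu> a)) ` kernel_embedding G ` carrier A = kernel_embedding G ` carrier A"
proof -
  have "\<nu> ` carrier A = carrier A" using assms(1) by (auto simp: auto_def Bij_def bij_betw_def)
  moreover have "(\<lambda>(g, a). (\<eta> g, \<epsilon> g \<otimes>\<^bsub>A\<^esub> \<nu> a)) ` kernel_embedding G ` carrier A
      = kernel_embedding G ` \<nu> ` carrier A"
    unfolding image_image
    using auto_D(1)[OF assms(1)] auto_D_one[OF G.is_group assms(2)] assms(3)
    by (intro image_cong) (simp_all add: kernel_embedding_def)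
  ultimately show ?thesis by simp
qed

text \<open>Schreier's construction: a set-theoretic section of the projection yields a factor set,
  and every element is uniquely an element of the copy of \<open>A\<close> times a chosen
  representative.\<close>

lemma extension_iso_cocycle_extension:
  fixes E :: "('e, 'l) monoid_scheme"
  assumes "extension_of A G E i p"
  obtains \<delta> f where "\<delta> \<in> Z2" "f \<in> iso (cocycle_extension G A \<delta>) E"
    "f ` kernel_embedding G ` carrier A = i ` carrier A"
proof -
  have i: "i \<in> mon A E" and p: "p \<in> epi E G" and ker: "i ` carrier A = kernel E G p"
    and E: "group E"
    and conj: "\<And>a e. a \<in> carrier A \<Longrightarrow> e \<in> carrier E \<Longrightarrow> inv\<^bsub>E\<^esub> e \<otimes>\<^bsub>E\<^esub> i a \<otimes>\<^bsub>E\<^esub> e = i a"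
    using assms by (auto simp: extension_of_def short_exact_def)
  interpret E: group E by fact
  interpret i: group_hom A E i using i by unfold_locales (simp add: mon_def)
  interpret p: group_hom E G p using p by unfold_locales (simp add: epi_def)
  have inj: "inj_on i (carrier A)" using i by (simp add: mon_def)
  have comm: "e \<otimes>\<^bsub>E\<^esub> i a = i a \<otimes>\<^bsub>E\<^esub> e" if "a \<in> carrier A" "e \<in> carrier E" for a e
    using conj[OF that] that by (metis E.inv_closed E.inv_solve_left E.m_assoc E.m_closed i.hom_closed)
  have pi: "p (i a) = \<one>" if "a \<in> carrier A" for a
    using ker that by (auto simp: kernel_def)
  \<comment> \<open>The value at \<one> is prescribed rather than chosen, so that the resulting
    cocycle is normalized and \<open>f\<close> below restricts to \<open>i\<close> on the copy of
    \<open>A\<close>.\<close>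
  define s where "s g = (if g = \<one> then \<one>\<^bsub>E\<^esub> else SOME e. e \<in> carrier E \<and> p e = g)" for g
  have s: "s g \<in> carrier E \<and> p (s g) = g" if "g \<in> carrier G" for g
  proof (cases "g = \<one>")
    case False
    have "g \<in> p ` carrier E" using p that by (simp add: epi_def)
    then have "\<exists>e. e \<in> carrier E \<and> p e = g" by blast
    from someI_ex[OF this] show ?thesis using False by (simp add: s_def)
  qed (simp add: s_def)
  have s1: "s \<one> = \<one>\<^bsub>E\<^esub>" by (simp add: s_def)
  have lift: "e \<in> i ` carrier A" if "e \<in> carrier E" "p e = \<one>" for e
    unfolding ker using that by (simp add: kernel_def)
  \<comment> \<open>Measures the failure of \<open>s\<close> to be multiplicative; the element lies
    over \<one> and so comes from \<open>A\<close>.\<close>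
  define \<delta> where "\<delta> = (\<lambda>(g, h)\<in>carrier G \<times> carrier G.
    inv_into (carrier A) i (s g \<otimes>\<^bsub>E\<^esub> s h \<otimes>\<^bsub>E\<^esub> inv\<^bsub>E\<^esub> s (g \<otimes> h)))"
  have \<delta>c: "\<delta> (g, h) \<in> carrier A" and \<delta>s: "i (\<delta> (g, h)) \<otimes>\<^bsub>E\<^esub> s (g \<otimes> h) = s g \<otimes>\<^bsub>E\<^esub> s h"
    if gh: "g \<in> carrier G" "h \<in> carrier G" for g h
  proof -
    let ?e = "s g \<otimes>\<^bsub>E\<^esub> s h \<otimes>\<^bsub>E\<^esub> inv\<^bsub>E\<^esub> s (g \<otimes> h)"
    note c = s[OF gh(1)] s[OF gh(2)] s[OF G.m_closed[OF gh]]
    have "?e \<in> i ` carrier A" using lift[of ?e] c gh by simp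
    then have "\<delta> (g, h) \<in> carrier A" "i (\<delta> (g, h)) = ?e"
      using gh by (simp_all add: \<delta>_def inv_into_into f_inv_into_f)
    then show "\<delta> (g, h) \<in> carrier A" "i (\<delta> (g, h)) \<otimes>\<^bsub>E\<^esub> s (g \<otimes> h) = s g \<otimes>\<^bsub>E\<^esub> s h"
      using c by (simp_all add: E.m_assoc)
  qed
  have \<delta>: "\<delta> \<in> Z2"
    unfolding Z2_iff
  proof (intro conjI ballI)
    show "\<delta> \<in> extensional (carrier G \<times> carrier G)" by (simp add: \<delta>_def)
    show "\<delta> (g, h) \<in> carrier A" if "g \<in> carrier G" "h \<in> carrier G" for g h using \<delta>c that .
    show "\<delta> (g, \<one>) = \<one>\<^bsub>A\<^esub>" "\<delta> (\<one>, g) = \<one>\<^bsub>A\<^esub>" if "g \<in> carrier G" for g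
      using that \<delta>s[of g \<one>] \<delta>s[of \<one> g] \<delta>c[of g \<one>] \<delta>c[of \<one> g] s[OF that] s1 inj
      by (auto simp: inj_on_eq_iff[OF inj, of _ "\<one>\<^bsub>A\<^esub>", symmetric])
    fix g h k assume g: "g \<in> carrier G" and h: "h \<in> carrier G" and k: "k \<in> carrier G"
    note c = g h k s[OF g] s[OF h] s[OF k] s[OF G.m_closed[OF g h]] s[OF G.m_closed[OF h k]]
      s[OF G.m_closed[OF G.m_closed[OF g h] k]] \<delta>c[OF g h] \<delta>c[OF h k] \<delta>c[OF G.m_closed[OF g h] k]
      \<delta>c[OF g G.m_closed[OF h k]]
    have "i (\<delta> (g, h) \<otimes>\<^bsub>A\<^esub> \<delta> (g \<otimes> h, k)) \<otimes>\<^bsub>E\<^esub> s (g \<otimes> h \<otimes> k)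
        = i (\<delta> (g, h)) \<otimes>\<^bsub>E\<^esub> (i (\<delta> (g \<otimes> h, k)) \<otimes>\<^bsub>E\<^esub> s (g \<otimes> h \<otimes> k))"
      using c by (simp add: E.m_assoc)
    also have "\<dots> = i (\<delta> (g, h)) \<otimes>\<^bsub>E\<^esub> s (g \<otimes> h) \<otimes>\<^bsub>E\<^esub> s k"
      unfolding \<delta>s[OF G.m_closed[OF g h] k] using c by (simp add: E.m_assoc)
    also have "\<dots> = s g \<otimes>\<^bsub>E\<^esub> (s h \<otimes>\<^bsub>E\<^esub> s k)"
      unfolding \<delta>s[OF g h] using c by (simp add: E.m_assoc)
    also have "\<dots> = s g \<otimes>\<^bsub>E\<^esub> i (\<delta> (h, k)) \<otimes>\<^bsub>E\<^esub> s (h \<otimes> k)"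
      unfolding \<delta>s[OF h k, symmetric] using c by (simp add: E.m_assoc)
    \<comment> \<open>The product of \<open>s g\<close>, \<open>s h\<close> and \<open>s k\<close>
      is bracketed in both ways. Triviality of the action enters here, moving the value of
      \<open>i\<close> past \<open>s g\<close>.\<close>
    also have "\<dots> = i (\<delta> (h, k)) \<otimes>\<^bsub>E\<^esub> (s g \<otimes>\<^bsub>E\<^esub> s (h \<otimes> k))"
      using c comm[OF \<delta>c[OF h k], of "s g"] by (simp add: E.m_assoc)
    also have "\<dots> = i (\<delta> (h, k) \<otimes>\<^bsub>A\<^esub> \<delta> (g, h \<otimes> k)) \<otimes>\<^bsub>E\<^esub> s (g \<otimes> h \<otimes> k)"
      unfolding \<delta>s[OF g G.m_closed[OF h k], symmetric] using c by (simp add: E.m_assoc G.m_assoc)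
    finally have "i (\<delta> (g, h) \<otimes>\<^bsub>A\<^esub> \<delta> (g \<otimes> h, k)) = i (\<delta> (h, k) \<otimes>\<^bsub>A\<^esub> \<delta> (g, h \<otimes> k))"
      by (subst (asm) E.right_cancel) (use c in auto)
    then show "\<delta> (g, h) \<otimes>\<^bsub>A\<^esub> \<delta> (g \<otimes> h, k) = \<delta> (h, k) \<otimes>\<^bsub>A\<^esub> \<delta> (g, h \<otimes> k)"
      by (subst (asm) inj_on_eq_iff[OF inj]) (use c in auto)
  qed
  define f where "f = (\<lambda>(g, a). i a \<otimes>\<^bsub>E\<^esub> s g)"
  have pf: "p (f (g, a)) = g" if "g \<in> carrier G" "a \<in> carrier A" for g a
    using that s[OF that(1)] pi by (simp add: f_def)
  have "f \<in> iso (cocycle_extension G A \<delta>) E"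
  proof (rule isoI)
    show "f \<in> hom (cocycle_extension G A \<delta>) E"
    proof (rule homI)
      fix x assume "x \<in> carrier (cocycle_extension G A \<delta>)"
      then show "f x \<in> carrier E" using s by (auto simp: f_def)
    next
      fix x y assume "x \<in> carrier (cocycle_extension G A \<delta>)" "y \<in> carrier (cocycle_extension G A \<delta>)"
      then obtain g a h b where xy: "x = (g, a)" "y = (h, b)"
        and gh: "g \<in> carrier G" "h \<in> carrier G" and ab: "a \<in> carrier A" "b \<in> carrier A" by auto
      note c = gh ab s[OF gh(1)] s[OF gh(2)] s[OF G.m_closed[OF gh]] \<delta>c[OF gh]
      have "f (x \<otimes>\<^bsub>cocycle_extension G A \<delta>\<^esub> y) = i a \<otimes>\<^bsub>E\<^esub> i b \<otimes>\<^bsub>E\<^esub> (i (\<delta> (g, h)) \<otimes>\<^bsub>E\<^esub> s (g \<otimes> h))"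
        using c by (simp add: xy f_def E.m_assoc)
      also have "\<dots> = i a \<otimes>\<^bsub>E\<^esub> (i b \<otimes>\<^bsub>E\<^esub> s g) \<otimes>\<^bsub>E\<^esub> s h"
        unfolding \<delta>s[OF gh] using c by (simp add: E.m_assoc)
      also have "\<dots> = i a \<otimes>\<^bsub>E\<^esub> s g \<otimes>\<^bsub>E\<^esub> (i b \<otimes>\<^bsub>E\<^esub> s h)"
        unfolding comm[OF ab(2), of "s g", symmetric, OF conjunct1[OF s[OF gh(1)]]]
        using c by (simp add: E.m_assoc)
      finally show "f (x \<otimes>\<^bsub>cocycle_extension G A \<delta>\<^esub> y) = f x \<otimes>\<^bsub>E\<^esub> f y" by (simp add: xy f_def)
    qed
    show "bij_betw f (carrier (cocycle_extension G A \<delta>)) (carrier E)"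
      unfolding bij_betw_def
    proof (intro conjI equalityI subsetI)
      show "inj_on f (carrier (cocycle_extension G A \<delta>))"
      proof (rule inj_onI)
        fix x y assume "x \<in> carrier (cocycle_extension G A \<delta>)" "y \<in> carrier (cocycle_extension G A \<delta>)"
          and eq: "f x = f y"
        then obtain g a h b where xy: "x = (g, a)" "y = (h, b)"
          and gh: "g \<in> carrier G" "h \<in> carrier G" and ab: "a \<in> carrier A" "b \<in> carrier A" by auto
        have g: "g = h" using pf[OF gh(1) ab(1)] pf[OF gh(2) ab(2)] eq xy by simp
        then have "i a = i b" using eq s[OF gh(1)] ab by (simp add: xy f_def)
        then show "x = y" using g inj ab xy by (simp add: inj_on_eq_iff)
      qed
      show "e \<in> carrier E" if "e \<in> f ` carrier (cocycle_extension G A \<delta>)" for e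
        using that s by (auto simp: f_def)
      fix e assume e: "e \<in> carrier E"
      then have pe: "p e \<in> carrier G" by simp
      note c = s[OF pe]
      \<comment> \<open>An element and the representative of its image differ by an element of the
        kernel, which is the copy of \<open>A\<close>.\<close>
      have "e \<otimes>\<^bsub>E\<^esub> inv\<^bsub>E\<^esub> s (p e) \<in> i ` carrier A"
        using lift[of "e \<otimes>\<^bsub>E\<^esub> inv\<^bsub>E\<^esub> s (p e)"] e c by simp
      then obtain a where a: "a \<in> carrier A" "i a = e \<otimes>\<^bsub>E\<^esub> inv\<^bsub>E\<^esub> s (p e)" by (metis imageE)
      have "e = f (p e, a)" using a e c by (simp add: f_def E.m_assoc)
      then show "e \<in> f ` carrier (cocycle_extension G A \<delta>)" by (rule image_eqI) (use pe a in simp)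
    qed
  qed
  moreover have "f ` kernel_embedding G ` carrier A = i ` carrier A"
    unfolding image_image by (intro image_cong) (simp_all add: f_def kernel_embedding_def s1)
  ultimately show thesis using that \<delta> by blast
qed

end

section \<open>Automorphisms and orbits\<close>

context trivial_module
begin

text \<open>The cochain is exported with the map because its value at \<one> is needed to read \<nu>
  back off the isomorphism.\<close>

lemma H2_act_eq_imp_iso:
  assumes "\<eta> \<in> auto G" "\<nu> \<in> auto A" "\<delta> \<in> Z2" "\<delta>' \<in> Z2"
    and "H2_act G A (\<eta>, \<nu>) (H2_class G A \<delta>) = H2_class G A \<delta>'"
  obtains \<epsilon> where "(\<lambda>(g, a). (\<eta> g, \<epsilon> g \<otimes>\<^bsub>A\<^esub> \<nu> a)) \<in> iso (cocycle_extension G A \<delta>) (cocycle_extension G A \<delta>')"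
    "(\<lambda>(g, a). (\<eta> g, \<epsilon> g \<otimes>\<^bsub>A\<^esub> \<nu> a)) ` kernel_embedding G ` carrier A = kernel_embedding G ` carrier A"
    "\<epsilon> \<in> carrier G \<rightarrow> carrier A" "\<epsilon> \<one> = \<one>\<^bsub>A\<^esub>"
proof -
  obtain \<epsilon> where c: "cobounds \<epsilon> (\<lambda>(g, h). \<delta>' (\<eta> g, \<eta> h)) (\<lambda>x. \<nu> (\<delta> x))"
    using H2_act_eq_iff[OF assms(1-4)] assms(5) by blast
  show thesis
    using that[OF iso_of_parts[OF assms(3,4,1,2) c] iso_of_parts_kernel[OF assms(2,1)]] cobounds_D[OF c]
    by auto
qed

lemma iso_imp_H2_act_eq:
  assumes "\<delta> \<in> Z2" "\<delta>' \<in> Z2" "f \<in> iso (cocycle_extension G A \<delta>) (cocycle_extension G A \<delta>')"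
    and "f ` kernel_embedding G ` carrier A = kernel_embedding G ` carrier A"
  shows "H2_act G A (quotient_part f, kernel_part f) (H2_class G A \<delta>) = H2_class G A \<delta>'"
  using H2_act_eq_iff[OF iso_parts(1,2)[OF assms] assms(1,2)] iso_parts(4)[OF assms] by blast

section \<open>Homomorphisms from \<open>G\<close> to \<open>A\<close> as automorphisms of the
  extension\<close>

lemma Z1_simps [simp]:
  "carrier (Z1_group G A) = hom G A \<inter> extensional (carrier G)"
  "\<psi> \<otimes>\<^bsub>Z1_group G A\<^esub> \<psi>' = (\<lambda>g\<in>carrier G. \<psi> g \<otimes>\<^bsub>A\<^esub> \<psi>' g)"
  "\<one>\<^bsub>Z1_group G A\<^esub> = (\<lambda>g\<in>carrier G. \<one>\<^bsub>A\<^esub>)"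
  by (simp_all add: Z1_group_def)

lemma Z1_D:
  assumes "\<psi> \<in> carrier (Z1_group G A)"
  shows "g \<in> carrier G \<Longrightarrow> \<psi> g \<in> carrier A"
    "g \<in> carrier G \<Longrightarrow> h \<in> carrier G \<Longrightarrow> \<psi> (g \<otimes> h) = \<psi> g \<otimes>\<^bsub>A\<^esub> \<psi> h"
    "\<psi> \<in> extensional (carrier G)" "\<psi> \<one> = \<one>\<^bsub>A\<^esub>"
  using assms hom_one[of \<psi> G A] by (auto simp: hom_def)

lemma Z1_I:
  assumes "\<And>g. g \<in> carrier G \<Longrightarrow> \<psi> g \<in> carrier A"
    "\<And>g h. g \<in> carrier G \<Longrightarrow> h \<in> carrier G \<Longrightarrow> \<psi> (g \<otimes> h) = \<psi> g \<otimes>\<^bsub>A\<^esub> \<psi> h"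
    "\<psi> \<in> extensional (carrier G)"
  shows "\<psi> \<in> carrier (Z1_group G A)"
  using assms by (auto simp: hom_def)

lemma Z1_is_group: "group (Z1_group G A)"
proof (rule groupI)
  fix \<psi> \<psi>' assume p: "\<psi> \<in> carrier (Z1_group G A)" "\<psi>' \<in> carrier (Z1_group G A)"
  show "\<psi> \<otimes>\<^bsub>Z1_group G A\<^esub> \<psi>' \<in> carrier (Z1_group G A)"
    by (rule Z1_I) (use Z1_D[OF p(1)] Z1_D[OF p(2)] in \<open>simp_all add: A.m_ac\<close>)
next
  show "\<one>\<^bsub>Z1_group G A\<^esub> \<in> carrier (Z1_group G A)" by (rule Z1_I) auto
next
  fix \<psi>1 \<psi>2 \<psi>3 assume p: "\<psi>1 \<in> carrier (Z1_group G A)" "\<psi>2 \<in> carrier (Z1_group G A)"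
    "\<psi>3 \<in> carrier (Z1_group G A)"
  show "\<psi>1 \<otimes>\<^bsub>Z1_group G A\<^esub> \<psi>2 \<otimes>\<^bsub>Z1_group G A\<^esub> \<psi>3 = \<psi>1 \<otimes>\<^bsub>Z1_group G A\<^esub> (\<psi>2 \<otimes>\<^bsub>Z1_group G A\<^esub> \<psi>3)"
    using Z1_D(1)[OF p(1)] Z1_D(1)[OF p(2)] Z1_D(1)[OF p(3)] by (auto simp: fun_eq_iff A.m_assoc)
next
  fix \<psi> assume p: "\<psi> \<in> carrier (Z1_group G A)"
  show "\<one>\<^bsub>Z1_group G A\<^esub> \<otimes>\<^bsub>Z1_group G A\<^esub> \<psi> = \<psi>"
    by (rule extensionalityI[of _ "carrier G"]) (use Z1_D[OF p] in auto)
  have "(\<lambda>g\<in>carrier G. inv\<^bsub>A\<^esub> \<psi> g) \<in> carrier (Z1_group G A)"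
    by (rule Z1_I) (use Z1_D[OF p] in \<open>simp_all add: A.inv_mult\<close>)
  moreover have "(\<lambda>g\<in>carrier G. inv\<^bsub>A\<^esub> \<psi> g) \<otimes>\<^bsub>Z1_group G A\<^esub> \<psi> = \<one>\<^bsub>Z1_group G A\<^esub>"
    using Z1_D(1)[OF p] by (auto simp: fun_eq_iff)
  ultimately show "\<exists>\<psi>'\<in>carrier (Z1_group G A). \<psi>' \<otimes>\<^bsub>Z1_group G A\<^esub> \<psi> = \<one>\<^bsub>Z1_group G A\<^esub>" by blast
qed

definition Z1_auto :: "('a \<Rightarrow> 'c) \<Rightarrow> 'a \<times> 'c \<Rightarrow> 'a \<times> 'c" where
  "Z1_auto \<psi> = (\<lambda>(g, a)\<in>carrier G \<times> carrier A. (g, \<psi> g \<otimes>\<^bsub>A\<^esub> a))"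

text \<open>The case of identity maps on \<open>G\<close> and \<open>A\<close>: a homomorphism has
  trivial coboundary, so it cobounds between \<delta> and itself.\<close>

lemma Z1_auto_closed:
  assumes \<delta>: "\<delta> \<in> Z2" and \<psi>: "\<psi> \<in> carrier (Z1_group G A)"
  shows "Z1_auto \<psi> \<in> auto (cocycle_extension G A \<delta>)"
proof -
  let ?\<eta> = "\<lambda>g\<in>carrier G. g" and ?\<nu> = "\<lambda>a\<in>carrier A. a"
  note D = Z1_D[OF \<psi>]
  have "\<delta> (g, h) \<otimes>\<^bsub>A\<^esub> (\<psi> g \<otimes>\<^bsub>A\<^esub> \<psi> h) = \<psi> g \<otimes>\<^bsub>A\<^esub> \<psi> h \<otimes>\<^bsub>A\<^esub> \<delta> (g, h)"
    if "g \<in> carrier G" "h \<in> carrier G" for g h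
    using that D(1)[of g] D(1)[of h] \<delta> by (intro A.m_comm) auto
  then have "cobounds \<psi> (\<lambda>(g, h). \<delta> (?\<eta> g, ?\<eta> h)) (\<lambda>x. ?\<nu> (\<delta> x))"
    using D(1,2,4) \<delta> by (auto simp: cobounds_def)
  from restrict_iso_auto[OF cocycle_extension_group[OF \<delta>]
      iso_of_parts[OF \<delta> \<delta> G.id_in_auto A.id_in_auto this]]
  have "restrict (\<lambda>(g, a). (?\<eta> g, \<psi> g \<otimes>\<^bsub>A\<^esub> ?\<nu> a)) (carrier (cocycle_extension G A \<delta>))
      \<in> auto (cocycle_extension G A \<delta>)" .
  also have "restrict (\<lambda>(g, a). (?\<eta> g, \<psi> g \<otimes>\<^bsub>A\<^esub> ?\<nu> a)) (carrier (cocycle_extension G A \<delta>)) = Z1_auto \<psi>"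
    by (auto simp: Z1_auto_def fun_eq_iff)
  finally show ?thesis .
qed

lemma Z1_auto_mon:
  assumes \<delta>: "\<delta> \<in> Z2"
  shows "Z1_auto \<in> mon (Z1_group G A) (AutoGroup (cocycle_extension G A \<delta>))"
  unfolding mon_def
proof (intro CollectI conjI)
  show "Z1_auto \<in> hom (Z1_group G A) (AutoGroup (cocycle_extension G A \<delta>))"
  proof (rule homI)
    show "Z1_auto \<psi> \<in> carrier (AutoGroup (cocycle_extension G A \<delta>))"
      if "\<psi> \<in> carrier (Z1_group G A)" for \<psi>
      using Z1_auto_closed[OF \<delta> that] by (simp add: carrier_AutoGroup)
    fix \<psi> \<psi>' assume p: "\<psi> \<in> carrier (Z1_group G A)" "\<psi>' \<in> carrier (Z1_group G A)"
    show "Z1_auto (\<psi> \<otimes>\<^bsub>Z1_group G A\<^esub> \<psi>')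
        = Z1_auto \<psi> \<otimes>\<^bsub>AutoGroup (cocycle_extension G A \<delta>)\<^esub> Z1_auto \<psi>'"
      unfolding AutoGroup_mult[OF Z1_auto_closed[OF \<delta> p(1)] Z1_auto_closed[OF \<delta> p(2)]]
      using Z1_D(1)[OF p(1)] Z1_D(1)[OF p(2)]
      by (auto simp: fun_eq_iff compose_def Z1_auto_def A.m_assoc)
  qed
  show "inj_on (Z1_auto) (carrier (Z1_group G A))"
  proof (rule inj_onI)
    fix \<psi> \<psi>' assume p: "\<psi> \<in> carrier (Z1_group G A)" "\<psi>' \<in> carrier (Z1_group G A)"
      and eq: "Z1_auto \<psi> = Z1_auto \<psi>'"
    show "\<psi> = \<psi>'"
    proof (rule extensionalityI[OF Z1_D(3)[OF p(1)] Z1_D(3)[OF p(2)]])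
      fix g assume "g \<in> carrier G"
      then show "\<psi> g = \<psi>' g"
        using fun_cong[OF eq, of "(g, \<one>\<^bsub>A\<^esub>)"] Z1_D(1)[OF p(1)] Z1_D(1)[OF p(2)]
        by (simp add: Z1_auto_def)
    qed
  qed
qed

text \<open>Inducing maps on quotient and kernel is functorial; composition is taken in the same
  order in all the automorphism groups.\<close>

lemma parts_hom:
  assumes \<delta>: "\<delta> \<in> Z2"
    and stab: "\<And>f. f \<in> auto (cocycle_extension G A \<delta>) \<Longrightarrow>
      f ` kernel_embedding G ` carrier A = kernel_embedding G ` carrier A"
  shows "(\<lambda>f. (quotient_part f, kernel_part f)) \<in> hom (AutoGroup (cocycle_extension G A \<delta>)) (Comp G A)"
proof (rule homI)
  let ?E = "cocycle_extension G A \<delta>"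
  note parts = iso_parts[OF \<delta> \<delta> auto_imp_iso stab]
  show "(quotient_part f, kernel_part f) \<in> carrier (Comp G A)" if "f \<in> carrier (AutoGroup ?E)" for f
    using parts(1,2) that by (simp add: carrier_Comp carrier_AutoGroup)
  fix f f' assume "f \<in> carrier (AutoGroup ?E)" "f' \<in> carrier (AutoGroup ?E)"
  then have f: "f \<in> auto ?E" and f': "f' \<in> auto ?E" by (simp_all add: carrier_AutoGroup)
  note pf = parts[OF f f] and pf' = parts[OF f' f']
  have \<epsilon>: "snd (f' (g, \<one>\<^bsub>A\<^esub>)) \<in> carrier A" if "g \<in> carrier G" for g
    using cobounds_D(1)[OF pf'(4) that] .
  have "quotient_part (compose (carrier ?E) f f') = compose (carrier G) (quotient_part f) (quotient_part f')"
  proof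
    fix g
    show "quotient_part (compose (carrier ?E) f f') g = compose (carrier G) (quotient_part f) (quotient_part f') g"
    proof (cases "g \<in> carrier G")
      case True
      \<comment> \<open>The second coordinate of the inner value need not be trivial, but it does
        not influence the first coordinate after applying \<open>f\<close>.\<close>
      have "fst (f (f' (g, \<one>\<^bsub>A\<^esub>))) = quotient_part f (quotient_part f' g)"
        using pf'(3)[OF True A.one_closed] pf(3)[OF auto_D(1)[OF pf'(1) True]]
          \<epsilon>[OF True] auto_D(1)[OF pf'(2) A.one_closed] by (metis A.m_closed fst_conv)
      then show ?thesis using True by (simp add: quotient_part_def compose_def)
    qed (simp add: quotient_part_def compose_def)
  qed
  moreover have "kernel_part (compose (carrier ?E) f f') = compose (carrier A) (kernel_part f) (kernel_part f')"
  proof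
    fix a
    show "kernel_part (compose (carrier ?E) f f') a = compose (carrier A) (kernel_part f) (kernel_part f') a"
    proof (cases "a \<in> carrier A")
      case True
      have "f' (\<one>, a) = (\<one>, kernel_part f' a)"
        using pf'(3)[OF G.one_closed True] cobounds_D(2)[OF pf'(4)] auto_D(1)[OF pf'(2) True]
          auto_D_one[OF G.is_group pf'(1)] by simp
      then show ?thesis using True auto_D(1)[OF pf'(2) True] by (simp add: compose_def) (simp add: kernel_part_def)
    qed (simp add: kernel_part_def compose_def)
  qed
  ultimately show "(quotient_part (f \<otimes>\<^bsub>AutoGroup ?E\<^esub> f'), kernel_part (f \<otimes>\<^bsub>AutoGroup ?E\<^esub> f'))
      = (quotient_part f, kernel_part f) \<otimes>\<^bsub>Comp G A\<^esub> (quotient_part f', kernel_part f')"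
    unfolding AutoGroup_mult[OF f f'] Comp_def mult_DirProd
      AutoGroup_mult[OF pf(1) pf'(1)] AutoGroup_mult[OF pf(2) pf'(2)] by simp
qed

text \<open>A pair is induced by an automorphism exactly if the coboundary equation from \<delta> to
  itself is solvable, which is the stabilizer condition. The solutions for the identity pair are the
  homomorphisms from \<open>G\<close> to \<open>A\<close>.\<close>

lemma automorphism_sequence:
  assumes \<delta>: "\<delta> \<in> Z2"
    and stab: "\<And>f. f \<in> auto (cocycle_extension G A \<delta>) \<Longrightarrow>
      f ` kernel_embedding G ` carrier A = kernel_embedding G ` carrier A"
  shows "short_exact (Z1_group G A) (Z1_auto) (AutoGroup (cocycle_extension G A \<delta>))
    (\<lambda>f. (quotient_part f, kernel_part f)) (stabilizer_group (Comp G A) (H2_act G A) (H2_class G A \<delta>))"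
proof -
  let ?E = "cocycle_extension G A \<delta>" and ?p = "\<lambda>f. (quotient_part f, kernel_part f)"
  let ?S = "stabilizer (Comp G A) (H2_act G A) (H2_class G A \<delta>)"
  interpret E: group ?E by (rule cocycle_extension_group[OF \<delta>])
  note parts = iso_parts[OF \<delta> \<delta> auto_imp_iso stab]
  have img: "?p ` auto ?E = ?S"
  proof (intro equalityI subsetI)
    fix c assume "c \<in> ?p ` auto ?E"
    then obtain f where f: "f \<in> auto ?E" "c = ?p f" by blast
    show "c \<in> ?S"
      using parts(1,2)[OF f(1) f(1)] iso_imp_H2_act_eq[OF \<delta> \<delta> auto_imp_iso[OF f(1)] stab[OF f(1)]]
      by (simp add: f(2) stabilizer_def carrier_Comp)
  next
    fix c assume "c \<in> ?S"
    then obtain \<eta> \<nu> where c: "c = (\<eta>, \<nu>)" "\<eta> \<in> auto G" "\<nu> \<in> auto A"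
      and act: "H2_act G A (\<eta>, \<nu>) (H2_class G A \<delta>) = H2_class G A \<delta>"
      by (auto simp: stabilizer_def carrier_Comp)
    \<comment> \<open>A stabilizing pair supplies a cochain, and with it an automorphism of the
      extension. Normalization of the cochain ensures that its restriction to the copy of
      \<open>A\<close> is exactly \<nu>.\<close>
    obtain \<epsilon> where \<epsilon>: "(\<lambda>(g, a). (\<eta> g, \<epsilon> g \<otimes>\<^bsub>A\<^esub> \<nu> a)) \<in> iso ?E ?E" "\<epsilon> \<one> = \<one>\<^bsub>A\<^esub>"
      by (rule H2_act_eq_imp_iso[OF c(2,3) \<delta> \<delta> act]) (rule that)
    let ?f = "restrict (\<lambda>(g, a). (\<eta> g, \<epsilon> g \<otimes>\<^bsub>A\<^esub> \<nu> a)) (carrier ?E)"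
    have "?f \<in> auto ?E" by (rule restrict_iso_auto[OF E.is_group \<epsilon>(1)])
    moreover have "quotient_part ?f = \<eta>"
      by (rule extensionalityI[OF _ auto_D(4)[OF c(2)]]) (auto simp: quotient_part_def)
    moreover have "kernel_part ?f = \<nu>"
      by (rule extensionalityI[OF _ auto_D(4)[OF c(3)]])
        (use auto_D(1)[OF c(3)] \<epsilon>(2) in \<open>auto simp: kernel_part_def\<close>)
    ultimately show "c \<in> ?p ` auto ?E" using c(1) by (intro rev_image_eqI[of ?f]) simp_all
  qed
  have Comp: "group (Comp G A)"
    unfolding Comp_def by (intro DirProd_group G.AutoGroup A.AutoGroup)
  interpret p: group_hom "AutoGroup ?E" "Comp G A" ?p
    using E.AutoGroup Comp parts_hom[OF assms] by (simp add: group_hom_def group_hom_axioms_def)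
  \<comment> \<open>The group structure of the stabilizer is inherited from its being the image of a
    homomorphism.\<close>
  have "subgroup ?S (Comp G A)"
    using p.img_is_subgroup img by (simp add: carrier_AutoGroup)
  then have stab_group: "group (stabilizer_group (Comp G A) (H2_act G A) (H2_class G A \<delta>))"
    using Comp by (simp add: stabilizer_group_def subgroup.subgroup_is_group)
  have epi: "?p \<in> epi (AutoGroup ?E) (stabilizer_group (Comp G A) (H2_act G A) (H2_class G A \<delta>))"
    using parts_hom[OF assms] img
    by (auto simp: epi_def hom_def stabilizer_group_def carrier_AutoGroup)
  have "Z1_auto ` carrier (Z1_group G A)
      = kernel (AutoGroup ?E) (stabilizer_group (Comp G A) (H2_act G A) (H2_class G A \<delta>)) ?p"
  proof (intro equalityI subsetI)
    fix f assume "f \<in> Z1_auto ` carrier (Z1_group G A)"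
    then obtain \<psi> where \<psi>: "\<psi> \<in> carrier (Z1_group G A)" "f = Z1_auto \<psi>" by blast
    have "quotient_part f = (\<lambda>g\<in>carrier G. g)" "kernel_part f = (\<lambda>a\<in>carrier A. a)"
      using Z1_D(4)[OF \<psi>(1)] by (auto simp: \<psi>(2) quotient_part_def kernel_part_def Z1_auto_def fun_eq_iff)
    then show "f \<in> kernel (AutoGroup ?E) (stabilizer_group (Comp G A) (H2_act G A) (H2_class G A \<delta>)) ?p"
      using Z1_auto_closed[OF \<delta> \<psi>(1)]
      by (simp add: kernel_def carrier_AutoGroup \<psi>(2) stabilizer_group_def Comp_def AutoGroup_one)
  next
    fix f assume "f \<in> kernel (AutoGroup ?E) (stabilizer_group (Comp G A) (H2_act G A) (H2_class G A \<delta>)) ?p"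
    then have f: "f \<in> auto ?E" "quotient_part f = (\<lambda>g\<in>carrier G. g)" "kernel_part f = (\<lambda>a\<in>carrier A. a)"
      by (simp_all add: kernel_def carrier_AutoGroup stabilizer_group_def Comp_def AutoGroup_one)
    let ?\<psi> = "\<lambda>g\<in>carrier G. snd (f (g, \<one>\<^bsub>A\<^esub>))"
    note pf = parts[OF f(1) f(1)]
    note \<epsilon> = cobounds_D[OF pf(4)]
    have "?\<psi> \<in> carrier (Z1_group G A)"
    proof (rule Z1_I)
      fix g h assume gh: "g \<in> carrier G" "h \<in> carrier G"
      note c = \<epsilon>(1)[OF gh(1)] \<epsilon>(1)[OF gh(2)] \<epsilon>(1)[OF G.m_closed[OF gh]] Z2_closed[OF \<delta> gh]
      \<comment> \<open>For the identity pair \<delta> stands on both sides of the coboundary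
        equation; cancelling it leaves multiplicativity of the cochain.\<close>
      have "\<delta> (g, h) \<otimes>\<^bsub>A\<^esub> snd (f (g \<otimes> h, \<one>\<^bsub>A\<^esub>))
          = \<delta> (g, h) \<otimes>\<^bsub>A\<^esub> (snd (f (g, \<one>\<^bsub>A\<^esub>)) \<otimes>\<^bsub>A\<^esub> snd (f (h, \<one>\<^bsub>A\<^esub>)))"
        using \<epsilon>(3)[OF gh] gh c by (simp add: f(2,3) A.m_comm[of "\<delta> (g, h)"])
      then show "?\<psi> (g \<otimes> h) = ?\<psi> g \<otimes>\<^bsub>A\<^esub> ?\<psi> h" using c gh by simp
    qed (use \<epsilon>(1) in auto)
    moreover have "f = Z1_auto ?\<psi>"
    proof (rule extensionalityI[of _ "carrier G \<times> carrier A"])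
      show "f \<in> extensional (carrier G \<times> carrier A)" using auto_D(4)[OF f(1)] by simp
      show "Z1_auto ?\<psi> \<in> extensional (carrier G \<times> carrier A)" by (simp add: Z1_auto_def)
      fix x assume "x \<in> carrier G \<times> carrier A"
      then obtain g a where "x = (g, a)" "g \<in> carrier G" "a \<in> carrier A" by blast
      then show "f x = Z1_auto ?\<psi> x" using pf(3)[of g a] by (simp add: f(2,3) Z1_auto_def)
    qed
    ultimately show "f \<in> Z1_auto ` carrier (Z1_group G A)"
      by (rule rev_image_eqI[where f = Z1_auto])
  qed
  then show ?thesis
    unfolding short_exact_def
    using Z1_is_group E.AutoGroup stab_group Z1_auto_mon[OF \<delta>] epi by blast
qed

end

section \<open>Isomorphism types and orbits on \<open>Delta\<close>\<close>

context nilpotent_module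
begin

lemma cocycle_extension_nontrivial:
  "carrier (cocycle_extension G A \<delta>) \<noteq> {\<one>\<^bsub>cocycle_extension G A \<delta>\<^esub>}"
proof
  assume "carrier (cocycle_extension G A \<delta>) = {\<one>\<^bsub>cocycle_extension G A \<delta>\<^esub>}"
  then have "carrier A = {\<one>\<^bsub>A\<^esub>}"
    using A.one_closed G.one_closed by (auto simp del: G.one_closed A.one_closed)
  then show False using A_nontrivial by blast
qed

text \<open>On both sides the copy of \<open>A\<close> is the last term of the lower central series,
  and isomorphisms preserve last terms.\<close>

lemma Delta_iso_kernel:
  assumes "\<delta> \<in> Z2" "\<delta>' \<in> Z2" "H2_class G A \<delta> \<in> Delta G A" "H2_class G A \<delta>' \<in> Delta G A"
    and "f \<in> iso (cocycle_extension G A \<delta>) (cocycle_extension G A \<delta>')"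
  shows "f ` kernel_embedding G ` carrier A = kernel_embedding G ` carrier A"
  using last_lower_central_iso[OF _ cocycle_extension_nontrivial cocycle_extension_group[OF assms(2)] assms(5)]
    assms(3,4) Delta_iff[OF assms(1)] Delta_iff[OF assms(2)] by (simp add: lcs_extension_of_def)

lemma Delta_transport:
  assumes "\<delta> \<in> Z2" "\<delta>' \<in> Z2" "H2_class G A \<delta> \<in> Delta G A"
    and f: "f \<in> iso (cocycle_extension G A \<delta>) (cocycle_extension G A \<delta>')"
    and "f ` kernel_embedding G ` carrier A = kernel_embedding G ` carrier A"
  shows "H2_class G A \<delta>' \<in> Delta G A"
proof -
  have "nilpotent_group (cocycle_extension G A \<delta>)"
    and "last_lower_central (cocycle_extension G A \<delta>) = kernel_embedding G ` carrier A"
    using assms(3) Delta_iff[OF assms(1)] by (auto simp: lcs_extension_of_def)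
  then have "nilpotent_group (cocycle_extension G A \<delta>')"
    and "last_lower_central (cocycle_extension G A \<delta>') = kernel_embedding G ` carrier A"
    using nilpotent_group_iso[OF _ cocycle_extension_group[OF assms(2)] f]
      last_lower_central_iso[OF _ cocycle_extension_nontrivial cocycle_extension_group[OF assms(2)] f]
      assms(5) by simp_all
  then show ?thesis
    using Delta_iff[OF assms(2)] cocycle_extension_of[OF assms(2)] by (simp add: lcs_extension_of_def)
qed

lemma Delta_mem:
  assumes "\<gamma> \<in> Delta G A" "\<delta> \<in> \<gamma>"
  shows "\<delta> \<in> Z2" "\<gamma> = H2_class G A \<delta>"
  using H2_mem_eq_class[OF _ assms(2)] assms(1) by (auto simp: Delta_def)

lemma Delta_nonempty:
  assumes "\<gamma> \<in> Delta G A"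
  obtains \<delta> where "\<delta> \<in> Z2" "\<gamma> = H2_class G A \<delta>"
  using assms by (auto simp: Delta_def H2_carrier)

text \<open>The transported cocycle defines an isomorphic extension with the copies of
  \<open>A\<close> matched, so membership carries over by \<open>Delta_transport\<close>.\<close>

lemma Delta_invariant:
  assumes "c \<in> carrier (Comp G A)" "\<gamma> \<in> Delta G A"
  shows "H2_act G A c \<gamma> \<in> Delta G A"
proof -
  obtain \<eta> \<nu> where c: "c = (\<eta>, \<nu>)" "\<eta> \<in> auto G" "\<nu> \<in> auto A" using assms(1) by (auto simp: carrier_Comp)
  obtain \<delta> where \<delta>: "\<delta> \<in> Z2" "\<gamma> = H2_class G A \<delta>" using Delta_nonempty[OF assms(2)] .
  note \<delta>' = Z2_act_closed[OF c(2,3) \<delta>(1)] and act = H2_act_class[OF c(2,3) \<delta>(1)]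
  obtain \<epsilon> where "(\<lambda>(g, a). (\<eta> g, \<epsilon> g \<otimes>\<^bsub>A\<^esub> \<nu> a))
      \<in> iso (cocycle_extension G A \<delta>) (cocycle_extension G A (Z2_act G (\<eta>, \<nu>) \<delta>))"
    "(\<lambda>(g, a). (\<eta> g, \<epsilon> g \<otimes>\<^bsub>A\<^esub> \<nu> a)) ` kernel_embedding G ` carrier A = kernel_embedding G ` carrier A"
    using H2_act_eq_imp_iso[OF c(2,3) \<delta>(1) \<delta>' act] .
  then show ?thesis
    using Delta_transport[OF \<delta>(1) \<delta>'] assms(2) \<delta>(2) act c(1) by simp
qed

lemma orbit_of_iso:
  assumes "\<delta> \<in> Z2" "\<delta>' \<in> Z2" "H2_class G A \<delta> \<in> Delta G A" "H2_class G A \<delta>' \<in> Delta G A"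
    and "f \<in> iso (cocycle_extension G A \<delta>) (cocycle_extension G A \<delta>')"
  shows "H2_class G A \<delta>' \<in> orbit (Comp G A) (H2_act G A) (H2_class G A \<delta>)"
proof -
  note img = Delta_iso_kernel[OF assms]
  show ?thesis
    using iso_parts(1,2)[OF assms(1,2,5) img] iso_imp_H2_act_eq[OF assms(1,2,5) img]
    unfolding orbit_def carrier_Comp by blast
qed

lemma iso_of_orbit:
  assumes "\<delta> \<in> Z2" "\<delta>' \<in> Z2"
    and "H2_class G A \<delta>' \<in> orbit (Comp G A) (H2_act G A) (H2_class G A \<delta>)"
  shows "cocycle_extension G A \<delta> \<cong> cocycle_extension G A \<delta>'"
proof -
  obtain \<eta> \<nu> where c: "\<eta> \<in> auto G" "\<nu> \<in> auto A"
    and act: "H2_act G A (\<eta>, \<nu>) (H2_class G A \<delta>) = H2_class G A \<delta>'"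
    using assms(3) by (auto simp: orbit_def carrier_Comp)
  show ?thesis by (rule H2_act_eq_imp_iso[OF c assms(1,2) act]) (rule is_isoI)
qed

text \<open>A given extension is first replaced by a cocycle extension; nilpotency and the position
  of the last term are then carried back along the isomorphism.\<close>

lemma lcs_extension_class:
  fixes E :: "('e, 'l) monoid_scheme"
  assumes "lcs_extension_of A G E i p"
  obtains \<delta> where "\<delta> \<in> Z2" "H2_class G A \<delta> \<in> Delta G A" "E \<cong> cocycle_extension G A \<delta>"
proof -
  have ext: "extension_of A G E i p" and nil: "nilpotent_group E" and last: "i ` carrier A = last_lower_central E"
    using assms by (auto simp: lcs_extension_of_def)
  have E: "group E" using nil by (simp add: nilpotent_group_def)
  obtain \<delta> f where \<delta>: "\<delta> \<in> Z2" and f: "f \<in> iso (cocycle_extension G A \<delta>) E"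
    and img: "f ` kernel_embedding G ` carrier A = i ` carrier A"
    using extension_iso_cocycle_extension[OF ext] .
  let ?E = "cocycle_extension G A \<delta>"
  interpret D: group ?E by (rule cocycle_extension_group[OF \<delta>])
  have inv: "inv_into (carrier ?E) f \<in> iso E ?E" using D.iso_set_sym[OF f] .
  have nilD: "nilpotent_group ?E" by (rule nilpotent_group_iso[OF nil D.is_group inv])
  \<comment> \<open>Both images are the copy of \<open>A\<close> in \<open>E\<close>; injectivity of
    \<open>f\<close> then identifies the two subgroups of \<open>?E\<close>.\<close>
  have "f ` last_lower_central ?E = f ` kernel_embedding G ` carrier A"
    using last_lower_central_iso[OF nilD cocycle_extension_nontrivial E f] last img by simp
  moreover have "last_lower_central ?E \<subseteq> carrier ?E"
    using nilpotent_last[OF nilD cocycle_extension_nontrivial] lower_central_in_carrier[OF D.is_group]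
    by metis
  moreover have "kernel_embedding G ` carrier A \<subseteq> carrier ?E" by (auto simp: kernel_embedding_def)
  moreover have "inj_on f (carrier ?E)" using f by (simp add: iso_iff)
  ultimately have "last_lower_central ?E = kernel_embedding G ` carrier A"
    by (metis inj_on_image_eq_iff)
  then have "H2_class G A \<delta> \<in> Delta G A"
    using Delta_iff[OF \<delta>] cocycle_extension_of[OF \<delta>] nilD by (simp add: lcs_extension_of_def)
  moreover have "E \<cong> ?E" using inv by (rule is_isoI)
  ultimately show thesis using that \<delta> by blast
qed

end

theorem theorem7:
  fixes G :: "('g, 'm) monoid_scheme" and A :: "('a, 'k) monoid_scheme"
  assumes "nilpotent_group G" and "carrier G \<noteq> {\<one>\<^bsub>G\<^esub>}"
    and "comm_group A" and "carrier A \<noteq> {\<one>\<^bsub>A\<^esub>}"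
  shows
    "(\<forall>c\<in>carrier (Comp G A). \<forall>\<gamma>\<in>Delta G A. H2_act G A c \<gamma> \<in> Delta G A)
     \<and>
     (\<forall>\<Omega>. orbit_reps (Comp G A) (H2_act G A) (Delta G A) \<Omega> \<longrightarrow>
        (\<forall>\<omega>\<in>\<Omega>. \<forall>\<delta>\<in>\<omega>.
           lcs_extension_of A G (cocycle_extension G A \<delta>) (kernel_embedding G) fst) \<and>
        (\<forall>(E :: ('e, 'l) monoid_scheme) i p. lcs_extension_of A G E i p \<longrightarrow>
           (\<exists>\<omega>\<in>\<Omega>. \<forall>\<delta>\<in>\<omega>. E \<cong> cocycle_extension G A \<delta>)) \<and>
        (\<forall>\<omega>\<in>\<Omega>. \<forall>\<omega>'\<in>\<Omega>. \<omega> \<noteq> \<omega>' \<longrightarrow>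
           (\<forall>\<delta>\<in>\<omega>. \<forall>\<delta>'\<in>\<omega>'. \<not> cocycle_extension G A \<delta> \<cong> cocycle_extension G A \<delta>')))
     \<and>
     (\<forall>\<delta>\<in>carrier (Z2_group G A). H2_class G A \<delta> \<in> Delta G A \<longrightarrow>
        auto (cocycle_extension G A \<delta>)
          = auto_stabilizing (cocycle_extension G A \<delta>) (kernel_embedding G ` carrier A) \<and>
        (\<exists>i p. short_exact (Z1_group G A) i (AutoGroup (cocycle_extension G A \<delta>)) p
           (stabilizer_group (Comp G A) (H2_act G A) (H2_class G A \<delta>))))"
proof -
  obtain n where n: "lower_central G n \<noteq> {\<one>\<^bsub>G\<^esub>}" "lower_central G (Suc n) = {\<one>\<^bsub>G\<^esub>}"
    using nilpotent_last[OF assms(1,2)] .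
  interpret G: group G using assms(1) by (simp add: nilpotent_group_def)
  interpret A: comm_group A by fact
  interpret nilpotent_module G A n by unfold_locales (use n assms(4) in auto)
  show ?thesis
  proof (intro conjI allI impI ballI)
    fix c \<gamma> assume "c \<in> carrier (Comp G A)" "\<gamma> \<in> Delta G A"
    then show "H2_act G A c \<gamma> \<in> Delta G A" by (rule Delta_invariant)
  next
    fix \<Omega> \<omega> \<delta> assume "orbit_reps (Comp G A) (H2_act G A) (Delta G A) \<Omega>" "\<omega> \<in> \<Omega>" and \<delta>: "\<delta> \<in> \<omega>"
    then have "\<omega> \<in> Delta G A" by (auto simp: orbit_reps_def)
    then show "lcs_extension_of A G (cocycle_extension G A \<delta>) (kernel_embedding G) fst"
      using Delta_mem[OF _ \<delta>] Delta_iff by blast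
  next
    fix \<Omega> i p and E :: "('e, 'l) monoid_scheme"
    assume reps: "orbit_reps (Comp G A) (H2_act G A) (Delta G A) \<Omega>" and "lcs_extension_of A G E i p"
    then obtain \<delta> where \<delta>: "\<delta> \<in> Z2" "H2_class G A \<delta> \<in> Delta G A" and E: "E \<cong> cocycle_extension G A \<delta>"
      using lcs_extension_class by blast
    then obtain \<omega> where \<omega>: "\<omega> \<in> \<Omega>" "\<omega> \<in> orbit (Comp G A) (H2_act G A) (H2_class G A \<delta>)"
      using reps by (auto simp: orbit_reps_def)
    have "\<omega> \<in> Delta G A" using \<omega>(1) reps by (auto simp: orbit_reps_def)
    then have "E \<cong> cocycle_extension G A \<delta>'" if "\<delta>' \<in> \<omega>" for \<delta>'
      using iso_of_orbit[OF \<delta>(1), of \<delta>'] Delta_mem[OF _ that] \<omega>(2) iso_trans[OF E] by metis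
    then show "\<exists>\<omega>\<in>\<Omega>. \<forall>\<delta>\<in>\<omega>. E \<cong> cocycle_extension G A \<delta>" using \<omega>(1) by blast
  next
    fix \<Omega> \<omega> \<omega>' \<delta> \<delta>'
    assume reps: "orbit_reps (Comp G A) (H2_act G A) (Delta G A) \<Omega>" and \<omega>: "\<omega> \<in> \<Omega>" "\<omega>' \<in> \<Omega>"
      and ne: "\<omega> \<noteq> \<omega>'" and \<delta>: "\<delta> \<in> \<omega>" "\<delta>' \<in> \<omega>'"
    have D: "\<omega> \<in> Delta G A" "\<omega>' \<in> Delta G A" using \<omega> reps by (auto simp: orbit_reps_def)
    note m = Delta_mem[OF D(1) \<delta>(1)] Delta_mem[OF D(2) \<delta>(2)]
    show "\<not> cocycle_extension G A \<delta> \<cong> cocycle_extension G A \<delta>'"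
    proof
      assume "cocycle_extension G A \<delta> \<cong> cocycle_extension G A \<delta>'"
      then obtain f where f: "f \<in> iso (cocycle_extension G A \<delta>) (cocycle_extension G A \<delta>')"
        by (auto simp: is_iso_def)
      \<comment> \<open>Both representatives are placed in the orbit of \<omega>, contradicting
        uniqueness. That \<omega> lies in its own orbit is obtained from the identity
        isomorphism.\<close>
      have "\<omega>' \<in> orbit (Comp G A) (H2_act G A) \<omega>"
        using orbit_of_iso[OF m(1,3) _ _ f] m(2,4) D by simp
      moreover have "\<omega> \<in> orbit (Comp G A) (H2_act G A) \<omega>"
        using orbit_of_iso[OF m(1,1) _ _ iso_set_refl] m(2) D by simp
      ultimately show False using reps \<omega> D(1) ne unfolding orbit_reps_def by blast
    qed
  next
    fix \<delta> assume \<delta>: "\<delta> \<in> Z2" "H2_class G A \<delta> \<in> Delta G A"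
    have stab: "f ` kernel_embedding G ` carrier A = kernel_embedding G ` carrier A"
      if "f \<in> auto (cocycle_extension G A \<delta>)" for f
      using Delta_iso_kernel[OF \<delta>(1,1) \<delta>(2,2) auto_imp_iso[OF that]] .
    then show "auto (cocycle_extension G A \<delta>)
        = auto_stabilizing (cocycle_extension G A \<delta>) (kernel_embedding G ` carrier A)"
      unfolding auto_stabilizing_def by blast
    show "\<exists>i p. short_exact (Z1_group G A) i (AutoGroup (cocycle_extension G A \<delta>)) p
        (stabilizer_group (Comp G A) (H2_act G A) (H2_class G A \<delta>))"
      using automorphism_sequence[OF \<delta>(1) stab] by blast
  qed
qed

end
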